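(* Let $F$ be the fakeness budget and assume that $F$ is unknown to the platform. Then the expected regret of the FORC algorithm (which does not take $F$ as input) satisfies $$\mathrm{Reg}_T=O\left(\left(n^2F+\log(T)\right)\sum_{j=1}^n\sum_{i=j+1}^n\frac{\log(nT)}{\Delta_{j,i}}\right),$$ where $\Delta_{j,i}=\mu_j-\mu_i$ and the $O(\cdot)$ hides an absolute constant.
   Context: **Model.** There are $n$ products $[n]=\{1,\dots,n\}$, a horizon of $T\ge2$ rounds, click probabilities $\mu_1>\mu_2>\dots>\mu_n$ in $[0,1]$, and exit probabilities $q_1,\dots,q_{n-1}\in[0,1]$, all unknown to the platform. A ranking $\pi$ is a permutation; $\pi(j)=i$ means that product $i$ is in position $j$. In round $t$ the platform shows a ranking $\pi_t$ to one customer. A *real* customer examines positions $1,2,\dots$ in order; when examining the product $i$ in position $j$ she clicks on it with probability $\mu_i$ (independently of everything else) and then stops at position $j$; if she does not click, she exits at position $j$ with probability $q_j$ (independently) and otherwise moves to position $j+1$ (after position $n$ she exits). The platform observes $c_t\in(\{\emptyset\}\cup[n])\times[n]$: the clicked product (if any) and the exit position (the last examined position). **Fake users.** Let $f_t=1$ if the user in round $t$ is fake and $f_t=0$ otherwise, and $\mathcal H_t=\{(\pi_s,f_s,c_s)\}_{s\le t}$. A fake-user policy $\mathbf P=(P_t)_{t=1}^T$ maps each $\mathcal H_{t-1}$ to a (possibly randomized) action in round $t$: whether the user in round $t$ is fake and, if so, which (at most one) product is clicked (she then exits at that product's position) or, if none is clicked, at which position she exits. The platform does not observe $f_t$. $\mathcal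 P$ is the family of policies respecting the fakeness budget: $\sum_t f_t\le F$ always. **Regret.** $\mathcal C_{r,t}(\pi)=1$ if the customer in round $t$ is real and clicks on some product when shown $\pi$, and $0$ otherwise. Let $\pi^\star(i)=i$ for all $i$ (the optimal ranking). Then $$\mathrm{Reg}_T=\sup_{\mathbf P\in\mathcal P}\Big\{\mathbb E\Big[\sum_{t=1}^T\mathcal C_{r,t}(\pi^\star)\Big]-\mathbb E\Big[\sum_{t=1}^T\mathcal C_{r,t}(\pi_t)\Big]\Big\},$$ where the first expectation is over the history generated when $\pi^\star$ is shown in every round and the second over the history generated by the algorithm (both against $\mathbf P$). **Function GraphRankSelect$(\boldsymbol\eta,G)$.** Input: a directed graph $G$ on $[n]$ and counts $\boldsymbol\eta=(\eta_1,\dots,\eta_n)$. If $G$ has a cycle, return an arbitrary ranking. Otherwise set $S=[n]$ and for $j=1,\dots,n$: among the products of $S$ with no outgoing edge in $G$ to another product of $S$, choose one with the smallest $\eta_i$; set $\pi(j)=i$ and remove $i$ from $S$. Return $\pi$. **FORC algorithm.** Parameters $\delta=\frac1{n^3T}$ and $L=\log_2(T)$ (treated as an integer); levels $\ell\in[L]$. Initialize $r_i^{(\ell)}=\hat r_i^{(\ell)}=0$, $\eta_i^{(\ell)}=\hat\eta_i^{(\ell)}=0$ and graphs $G^{(\ell)}=([n],\emptyset)$, none eliminated. In each round $t=1,\dots,T$: (1) Draw a level $\ell_t$, independently of everything else in the past and of the fake user's round-$t$ decision, with $\mathbb P(\ell_t=\ell)=2^{-\ell}$ for $\ell\in\{2,\dots,L\}$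 and $\mathbb P(\ell_t=1)=1-\sum_{\ell=2}^L2^{-\ell}$. (2) Let $G=G^{(\ell_t)}$ if it is not eliminated; otherwise $G=G^{(\ell)}$ for the smallest $\ell>\ell_t$ whose graph is not eliminated (if there is none, use an arbitrary ranking). Show $\pi_t=$ GraphRankSelect$(\boldsymbol\eta^{(\ell_t)},G)$ and observe $c_t$. (3) If $j$ is the last examined position, increase $\eta_i^{(\ell_t)}$ by one for each $i\in\{\pi_t(1),\dots,\pi_t(j)\}$ and update $r_i^{(\ell_t)}$ so that it is the fraction, among the rounds so far counted in $\eta_i^{(\ell_t)}$, in which $i$ was clicked. (4) For all $\ell\ge\ell_t$ and $i\in\{\pi_t(1),\dots,\pi_t(j)\}$ set $$\hat\eta_i^{(\ell)}=\frac{\sum_{g=1}^{\ell-1}\eta_i^{(g)}}{2^\ell}+\eta_i^{(\ell)},\qquad \hat r_i^{(\ell)}=\frac{\sum_{g=1}^{\ell-1}\eta_i^{(g)}r_i^{(g)}}{2^\ell\hat\eta_i^{(\ell)}}+\frac{\eta_i^{(\ell)}}{\hat\eta_i^{(\ell)}}r_i^{(\ell)}.$$ (5) For every $\ell$ with $G^{(\ell)}$ not eliminated and all $i,j$ with $\hat\eta_i^{(\ell)},\hat\eta_j^{(\ell)}>0$ and $\hat r_i^{(\ell)}+w_i^{(\ell)}<\hat r_j^{(\ell)}-w_j^{(\ell)}$, add the directed edge $(i,j)$ to $G^{(g)}$ for all $g\le\ell$ with $G^{(g)}$ not eliminated, where $w_i^{(\ell)}=\sqrt{\frac32\frac{\log(4nT/\delta)}{\hat\eta_i^{(\ell)}}}+\frac{\log(2L/\delta)+4}{\hat\eta_i^{(\ell)}}$.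 (6) If $G^{(\ell)}$ has a cycle for some $\ell$, eliminate $G^{(g)}$ for all $g\le\ell$. $\log$ is the natural logarithm. *)

theory Defs
  imports "HOL-Probability.Probability" "HOL-Combinatorics.Permutations"
begin

section \<open>Rankings, customers and fake users\<close>

text \<open>
  Products and positions are both numbered \<open>1, \<dots>, n\<close>.  A ranking is a map \<open>\<pi>\<close> with
  \<open>\<pi> permutes {1..n}\<close>, where \<open>\<pi> j\<close> is the product in position \<open>j\<close>; hence \<open>inv \<pi> i\<close> is the
  position of product \<open>i\<close>.  An observation is the clicked product (if any) together with the
  exit position.
\<close>

type_synonym ranking = "nat \<Rightarrow> nat"
type_synonym observation = "nat option \<times> nat"

function customer_from ::
  "nat \<Rightarrow> (nat \<Rightarrow> real) \<Rightarrow> (nat \<Rightarrow> real) \<Rightarrow> ranking \<Rightarrow> nat \<Rightarrow> observation pmf" where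
  "customer_from n \<mu> q \<pi> j =
     do {
       click \<leftarrow> bernoulli_pmf (\<mu> (\<pi> j));
       if click then return_pmf (Some (\<pi> j), j)
       else if j < n then
         do {
           quit \<leftarrow> bernoulli_pmf (q j);
           if quit then return_pmf (None, j) else customer_from n \<mu> q \<pi> (Suc j)
         }
       else return_pmf (None, j)
     }"
  by pat_completeness auto
termination
  by (relation "Wellfounded.measure (\<lambda>(n, \<mu>, q, \<pi>, j). n - j)") auto

declare customer_from.simps [simp del]

definition real_customer ::
  "nat \<Rightarrow> (nat \<Rightarrow> real) \<Rightarrow> (nat \<Rightarrow> real) \<Rightarrow> ranking \<Rightarrow> observation pmf" where
  "real_customer n \<mu> q \<pi> = customer_from n \<mu> q \<pi> 1"

datatype action = Real_User | Fake_Click nat | Fake_Exit nat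

definition actions :: "nat \<Rightarrow> action set" where
  "actions n = {Real_User} \<union> Fake_Click ` {1..n} \<union> Fake_Exit ` {1..n}"

primrec response ::
  "nat \<Rightarrow> (nat \<Rightarrow> real) \<Rightarrow> (nat \<Rightarrow> real) \<Rightarrow> ranking \<Rightarrow> action \<Rightarrow> observation pmf" where
  "response n \<mu> q \<pi> Real_User = real_customer n \<mu> q \<pi>"
| "response n \<mu> q \<pi> (Fake_Click i) = return_pmf (Some i, inv \<pi> i)"
| "response n \<mu> q \<pi> (Fake_Exit j) = return_pmf (None, j)"

text \<open>
  One round \<open>(\<pi>, f, c)\<close> of the history available to the fake-user policy.  All histories below
  list the most recent round first.  The round number of a policy decision is one plus the length
  of the history it is applied to, so a single function encodes \<open>(P\<^sub>1, \<dots>, P\<^sub>T)\<close>.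
\<close>

type_synonym event = "ranking \<times> bool \<times> observation"
type_synonym policy = "event list \<Rightarrow> action pmf"

primrec possible_responses :: "nat \<Rightarrow> ranking \<Rightarrow> action \<Rightarrow> observation set" where
  "possible_responses n \<pi> Real_User = (\<Union>j\<in>{1..n}. {(Some (\<pi> j), j), (None, j)})"
| "possible_responses n \<pi> (Fake_Click i) = {(Some i, inv \<pi> i)}"
| "possible_responses n \<pi> (Fake_Exit j) = {(None, j)}"

text \<open>
  The histories that can arise against a policy, whatever rankings the platform shows and however
  real customers behave.  The fakeness budget has to hold on all of them.
\<close>

primrec possible_history :: "nat \<Rightarrow> policy \<Rightarrow> event list \<Rightarrow> bool" where
  "possible_history n P [] \<longleftrightarrow> True"
| "possible_history n P (e # h) \<longleftrightarrow> possible_history n P h \<and>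
     (case e of (\<pi>, f, c) \<Rightarrow> \<pi> permutes {1..n} \<and>
        (\<exists>a\<in>set_pmf (P h). f = (a \<noteq> Real_User) \<and> c \<in> possible_responses n \<pi> a))"

definition num_fakes :: "event list \<Rightarrow> nat" where
  "num_fakes h = length (filter (\<lambda>(\<pi>, f, c). f) h)"

definition policies :: "nat \<Rightarrow> nat \<Rightarrow> nat \<Rightarrow> policy set" where
  "policies n T F =
     {P. (\<forall>h. set_pmf (P h) \<subseteq> actions n) \<and>
         (\<forall>h. possible_history n P h \<longrightarrow> length h = T \<longrightarrow> num_fakes h \<le> F)}"

section \<open>Interaction and regret\<close>

text \<open>
  In each round the platform chooses a ranking, possibly together with a private value of type
  \<open>'r\<close> that it remembers but that is not visible to the fake-user policy.  It sees its own
  private values, the rankings and the observations, but not which users were fake.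
\<close>

type_synonym 'r platform = "('r \<times> ranking \<times> observation) list \<Rightarrow> ('r \<times> ranking) pmf"

text \<open>The fake-user decision and the platform's choice in a round are made independently, given
  the past.\<close>

primrec run ::
  "nat \<Rightarrow> (nat \<Rightarrow> real) \<Rightarrow> (nat \<Rightarrow> real) \<Rightarrow> policy \<Rightarrow> 'r platform \<Rightarrow> nat \<Rightarrow> ('r \<times> event) list pmf" where
  "run n \<mu> q P A 0 = return_pmf []"
| "run n \<mu> q P A (Suc t) =
     do {
       h \<leftarrow> run n \<mu> q P A t;
       a \<leftarrow> P (map snd h);
       (x, \<pi>) \<leftarrow> A (map (\<lambda>(x, \<pi>, f, c). (x, \<pi>, c)) h);
       c \<leftarrow> response n \<mu> q \<pi> a;
       return_pmf ((x, \<pi>, a \<noteq> Real_User, c) # h)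
     }"

definition real_clicks :: "('r \<times> event) list \<Rightarrow> nat" where
  "real_clicks h = length (filter (\<lambda>(x, \<pi>, f, c). \<not> f \<and> fst c \<noteq> None) h)"

definition expected_real_clicks ::
  "nat \<Rightarrow> (nat \<Rightarrow> real) \<Rightarrow> (nat \<Rightarrow> real) \<Rightarrow> policy \<Rightarrow> 'r platform \<Rightarrow> nat \<Rightarrow> real" where
  "expected_real_clicks n \<mu> q P A T =
     measure_pmf.expectation (run n \<mu> q P A T) (\<lambda>h. real (real_clicks h))"

definition optimal_platform :: "unit platform" where
  "optimal_platform = (\<lambda>h. return_pmf ((), id))"

text \<open>The supremum is over a nonempty set of reals in \<open>{- T..T}\<close>.\<close>

definition regret ::
  "nat \<Rightarrow> (nat \<Rightarrow> real) \<Rightarrow> (nat \<Rightarrow> real) \<Rightarrow> nat \<Rightarrow> nat \<Rightarrow> 'r platform \<Rightarrow> real" where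
  "regret n \<mu> q T F A =
     (SUP P\<in>policies n T F.
        expected_real_clicks n \<mu> q P optimal_platform T - expected_real_clicks n \<mu> q P A T)"

section \<open>GraphRankSelect\<close>

text \<open>All rankings that the procedure may return, over all ways of breaking ties and of choosing
  the arbitrary ranking.\<close>

definition graph_rank_select :: "nat \<Rightarrow> (nat \<Rightarrow> nat) \<Rightarrow> (nat \<times> nat) set \<Rightarrow> ranking set" where
  "graph_rank_select n \<eta> G =
     {\<pi>. \<pi> permutes {1..n} \<and>
         (acyclic G \<longrightarrow>
           (\<forall>j\<in>{1..n}.
              let S = {1..n} - \<pi> ` {1..<j};
                  M = {i \<in> S. \<forall>k\<in>S - {i}. (i, k) \<notin> G}
              in \<pi> j \<in> M \<and> (\<forall>i\<in>M. \<eta> (\<pi> j) \<le> \<eta> i)))}"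

section \<open>The FORC algorithm\<close>

definition level_prob :: "nat \<Rightarrow> nat \<Rightarrow> real" where
  "level_prob L l =
     (if l = 1 then 1 - (\<Sum>k=2..L. 1 / 2 ^ k) else if l \<in> {2..L} then 1 / 2 ^ l else 0)"

definition level_pmf :: "nat \<Rightarrow> nat pmf" where
  "level_pmf L = embed_pmf (level_prob L)"

lemma level_prob_nonneg: "0 \<le> level_prob L l"
proof -
  have "(\<Sum>k=2..L. 1 / 2 ^ k :: real) + 1 / 2 ^ L \<le> 1"
    by (induction L) (auto simp: atLeastAtMostSuc_conv)
  then have "(\<Sum>k=2..L. 1 / 2 ^ k :: real) \<le> 1"
    by (smt (verit) zero_le_divide_1_iff zero_le_numeral zero_le_power)
  then show ?thesis
    by (simp add: level_prob_def)
qed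

lemma pmf_level_pmf: "pmf (level_pmf L) l = level_prob L l"
  unfolding level_pmf_def
proof (rule pmf_embed_pmf)
  show "0 \<le> level_prob L x" for x
    by (rule level_prob_nonneg)
  have sum: "(\<Sum>l\<in>insert 1 {2..L}. level_prob L l) = 1"
  proof -
    have "(\<Sum>l=2..L. level_prob L l) = (\<Sum>l=2..L. 1 / 2 ^ l)"
      by (rule sum.cong) (auto simp: level_prob_def)
    then show ?thesis
      by (simp add: level_prob_def)
  qed
  have "(\<integral>\<^sup>+ x. ennreal (level_prob L x) \<partial>count_space UNIV) =
        (\<Sum>l\<in>insert 1 {2..L}. ennreal (level_prob L l))"
    by (rule nn_integral_count_space') (auto simp: level_prob_def)
  also have "\<dots> = ennreal (\<Sum>l\<in>insert 1 {2..L}. level_prob L l)"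
    by (rule sum_ennreal) (rule level_prob_nonneg)
  finally show "(\<integral>\<^sup>+ x. ennreal (level_prob L x) \<partial>count_space UNIV) = 1"
    by (simp only: sum ennreal_1)
qed

text \<open>In all components the level is the first argument.\<close>

record forc_state =
  eta :: "nat \<Rightarrow> nat \<Rightarrow> nat"
  rate :: "nat \<Rightarrow> nat \<Rightarrow> real"
  eta_hat :: "nat \<Rightarrow> nat \<Rightarrow> real"
  rate_hat :: "nat \<Rightarrow> nat \<Rightarrow> real"
  graph :: "nat \<Rightarrow> (nat \<times> nat) set"
  eliminated :: "nat \<Rightarrow> bool"

definition initial_state :: forc_state where
  "initial_state =
     \<lparr>eta = (\<lambda>_ _. 0), rate = (\<lambda>_ _. 0), eta_hat = (\<lambda>_ _. 0), rate_hat = (\<lambda>_ _. 0),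
      graph = (\<lambda>_. {}), eliminated = (\<lambda>_. False)\<rparr>"

definition examined :: "ranking \<Rightarrow> observation \<Rightarrow> nat set" where
  "examined \<pi> c = \<pi> ` {1..snd c}"

type_synonym forc_history = "(nat \<times> ranking \<times> observation) list"

definition clicks :: "forc_history \<Rightarrow> nat \<Rightarrow> nat \<Rightarrow> nat" where
  "clicks h l i =
     length (filter (\<lambda>(l', \<pi>, c). l' = l \<and> i \<in> examined \<pi> c \<and> fst c = Some i) h)"

text \<open>Here \<open>h\<close> includes the current round, which was played at level \<open>lt\<close> with examined
  products \<open>X\<close>.\<close>

definition update_rates :: "forc_history \<Rightarrow> nat \<Rightarrow> nat set \<Rightarrow> forc_state \<Rightarrow> forc_state" where
  "update_rates h lt X s =
     (let \<eta>' = (\<lambda>l i. if l = lt \<and> i \<in> X then eta s l i + 1 else eta s l i)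
      in s\<lparr>eta := \<eta>',
           rate := (\<lambda>l i. if l = lt \<and> i \<in> X then real (clicks h l i) / real (\<eta>' l i)
                          else rate s l i)\<rparr>)"

definition update_hats :: "nat \<Rightarrow> nat \<Rightarrow> nat set \<Rightarrow> forc_state \<Rightarrow> forc_state" where
  "update_hats L lt X s =
     (let eh = (\<lambda>l i. (\<Sum>g=1..<l. real (eta s g i)) / 2 ^ l + real (eta s l i));
          rh = (\<lambda>l i. (\<Sum>g=1..<l. real (eta s g i) * rate s g i) / (2 ^ l * eh l i)
                      + real (eta s l i) / eh l i * rate s l i)
      in s\<lparr>eta_hat := (\<lambda>l i. if l \<in> {lt..L} \<and> i \<in> X then eh l i else eta_hat s l i),
           rate_hat := (\<lambda>l i. if l \<in> {lt..L} \<and> i \<in> X then rh l i else rate_hat s l i)\<rparr>)"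

definition forc_delta :: "nat \<Rightarrow> nat \<Rightarrow> real" where
  "forc_delta n T = 1 / (real n ^ 3 * real T)"

definition width :: "nat \<Rightarrow> nat \<Rightarrow> nat \<Rightarrow> forc_state \<Rightarrow> nat \<Rightarrow> nat \<Rightarrow> real" where
  "width n T L s l i =
     sqrt (3 / 2 * (ln (4 * real n * real T / forc_delta n T) / eta_hat s l i))
     + (ln (2 * real L / forc_delta n T) + 4) / eta_hat s l i"

definition new_edges :: "nat \<Rightarrow> nat \<Rightarrow> nat \<Rightarrow> forc_state \<Rightarrow> nat \<Rightarrow> (nat \<times> nat) set" where
  "new_edges n T L s l =
     {(i, j). i \<in> {1..n} \<and> j \<in> {1..n} \<and> eta_hat s l i > 0 \<and> eta_hat s l j > 0 \<and>
              rate_hat s l i + width n T L s l i < rate_hat s l j - width n T L s l j}"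

definition add_edges :: "nat \<Rightarrow> nat \<Rightarrow> nat \<Rightarrow> forc_state \<Rightarrow> forc_state" where
  "add_edges n T L s =
     s\<lparr>graph := (\<lambda>g. if eliminated s g then graph s g
                     else graph s g \<union> (\<Union>l\<in>{l \<in> {g..L}. \<not> eliminated s l}. new_edges n T L s l))\<rparr>"

definition eliminate :: "nat \<Rightarrow> forc_state \<Rightarrow> forc_state" where
  "eliminate L s =
     s\<lparr>eliminated := (\<lambda>g. eliminated s g \<or> (\<exists>l\<in>{g..L}. \<not> acyclic (graph s l)))\<rparr>"

primrec forc_state_after :: "nat \<Rightarrow> nat \<Rightarrow> nat \<Rightarrow> forc_history \<Rightarrow> forc_state" where
  "forc_state_after n T L [] = initial_state"
| "forc_state_after n T L (e # h) =
     (case e of (l, \<pi>, c) \<Rightarrow>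
        eliminate L (add_edges n T L (update_hats L l (examined \<pi> c)
          (update_rates (e # h) l (examined \<pi> c) (forc_state_after n T L h)))))"

definition forc_rankings :: "nat \<Rightarrow> nat \<Rightarrow> forc_state \<Rightarrow> nat \<Rightarrow> ranking set" where
  "forc_rankings n L s l =
     (let live = {g \<in> {l..L}. \<not> eliminated s g}
      in if live = {} then {\<pi>. \<pi> permutes {1..n}}
         else graph_rank_select n (eta s l) (graph s (Min live)))"

text \<open>
  The algorithm leaves ties and arbitrary rankings unspecified.  The set below contains its
  implementations for every way of resolving them, possibly at random and depending on everything
  the platform has seen.  The platform's private value is the level drawn in the round.
\<close>

definition forc :: "nat \<Rightarrow> nat \<Rightarrow> nat \<Rightarrow> nat platform set" where
  "forc n T L =
     {A. \<exists>choice.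
           (\<forall>h. \<forall>l\<in>{1..L}. set_pmf (choice h l) \<subseteq> forc_rankings n L (forc_state_after n T L h) l) \<and>
           A = (\<lambda>h. do { l \<leftarrow> level_pmf L; \<pi> \<leftarrow> choice h l; return_pmf (l, \<pi>) })}"

end

theory Submission
  imports Defs
begin

text \<open>
  Let \<open>m\<close> be the least level with \<open>F \<le> 2 ^ m\<close>.  Fake users carry little weight in the estimates of
  the levels from \<open>m\<close> on, so with high probability these are accurate at all times and the graphs of
  these levels contain correct edges only.  The loss of a ranking is at most the sum, over the
  products \<open>a\<close> and the best product \<open>b\<close> not ranked above \<open>a\<close>, of \<open>\<mu> b - \<mu> a\<close> times the
  probability that \<open>a\<close> is examined.  On a level from \<open>m\<close> on, the tie breaking by counts makes \<open>a\<close>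
  the less explored of the two, and the missing edge bounds its count.  On a lower level, either
  \<open>a\<close> is not yet well explored in the estimates of level \<open>m\<close>, or the ranking that level \<open>m\<close> would
  have shown in the same round would reach, with at least the same probability, an insufficiently
  explored product; as level \<open>m\<close> is drawn with probability at least \<open>2 ^ - m\<close>, this costs a factor
  \<open>2 ^ m \<le> 2 * F\<close>.  Both charges are paid by a bounded potential that grows with the counts.
\<close>

text \<open>The policy is adaptive, but its decision in a round is independent of the level drawn in
  that round. This is what the levels buy: for \<open>l \<ge> 2\<close> a fake round falls on level
  \<open>l\<close> with probability \<open>1 / 2 ^ l\<close> whatever the past, and rounds of lower
  levels enter the estimates of level \<open>l\<close> with weight \<open>1 / 2 ^ l\<close>. From
  level \<open>m\<close> on, the fake weight is thus a constant plus a logarithmic deviation, which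
  the additive term of the widths covers. The obstacle is the levels below \<open>m\<close>: their
  graphs may contain wrong edges and their estimates may be useless. They are controlled only
  through the graph of level \<open>m\<close>, which the graph they use contains, and through a
  ranking of level \<open>m\<close> that is imagined but not shown. Inaccurate estimates have
  probability at most \<open>1 / T\<close> in each round and cost 1 in total; fake rounds cost
  another \<open>F\<close>. Two cases lie outside the potential argument: \<open>F > 2 ^ L\<close>,
  where the horizon is below \<open>2 * F\<close>, and \<open>n = 1\<close>, where the bound is 0
  and the regret has to vanish exactly.\<close>

abbreviation expect :: "'a pmf \<Rightarrow> ('a \<Rightarrow> real) \<Rightarrow> real" where
  "expect \<equiv> measure_pmf.expectation"

section \<open>Expectations over finitely supported distributions\<close>

lemma expect_bind:
  assumes "finite (set_pmf M)" "\<And>x. x \<in> set_pmf M \<Longrightarrow> finite (set_pmf (N x))"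
  shows "expect (M \<bind> N) f = expect M (\<lambda>x. expect (N x) f)"
proof -
  have "expect (M \<bind> N) f = (\<Sum>a\<in>set_pmf M. pmf M a *\<^sub>R expect (N a) f)"
    using assms by (intro pmf_expectation_bind) auto
  also have "\<dots> = expect M (\<lambda>x. expect (N x) f)"
    using assms(1) by (subst integral_measure_pmf[where A = "set_pmf M"]) auto
  finally show ?thesis .
qed

lemma expect_mono:
  fixes f g :: "'a \<Rightarrow> real"
  assumes "finite (set_pmf M)" "\<And>x. x \<in> set_pmf M \<Longrightarrow> f x \<le> g x"
  shows "expect M f \<le> expect M g"
  using assms by (intro integral_mono_AE) (auto simp: integrable_measure_pmf_finite AE_measure_pmf_iff)

lemma expect_cong:
  fixes f g :: "'a \<Rightarrow> real"
  assumes "\<And>x. x \<in> set_pmf M \<Longrightarrow> f x = g x"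
  shows "expect M f = expect M g"
  using assms by (intro integral_cong_AE) (auto simp: AE_measure_pmf_iff)

lemma expect_le_const:
  fixes f :: "'a \<Rightarrow> real"
  assumes "finite (set_pmf M)" "\<And>x. x \<in> set_pmf M \<Longrightarrow> f x \<le> c"
  shows "expect M f \<le> c"
  using expect_mono[OF assms(1), of f "\<lambda>_. c"] assms(2) by simp

lemma expect_ge_const:
  fixes f :: "'a \<Rightarrow> real"
  assumes "finite (set_pmf M)" "\<And>x. x \<in> set_pmf M \<Longrightarrow> c \<le> f x"
  shows "c \<le> expect M f"
  using expect_mono[OF assms(1), of "\<lambda>_. c" f] assms(2) by simp

lemma expect_add:
  fixes f g :: "'a \<Rightarrow> real"
  assumes "finite (set_pmf M)"
  shows "expect M (\<lambda>x. f x + g x) = expect M f + expect M g"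
  by (rule Bochner_Integration.integral_add) (auto intro: integrable_measure_pmf_finite assms)

lemma expect_diff:
  fixes f g :: "'a \<Rightarrow> real"
  assumes "finite (set_pmf M)"
  shows "expect M (\<lambda>x. f x - g x) = expect M f - expect M g"
  by (rule Bochner_Integration.integral_diff) (auto intro: integrable_measure_pmf_finite assms)

lemma expect_sum:
  fixes f :: "'i \<Rightarrow> 'a \<Rightarrow> real"
  assumes "finite (set_pmf M)"
  shows "expect M (\<lambda>x. \<Sum>i\<in>I. f i x) = (\<Sum>i\<in>I. expect M (f i))"
  by (rule Bochner_Integration.integral_sum) (auto intro: integrable_measure_pmf_finite assms)

section \<open>Click probabilities of ranked lists\<close>

text \<open>\<open>list_value d j ms\<close> is the click probability of a customer at position \<open>j\<close> if the products
  from there on have click probabilities \<open>ms\<close> and she survives position \<open>k\<close> with probability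
  \<open>d k\<close>.  \<open>list_gap\<close> weights the loss against the best remaining product by the probability
  of reaching the position.\<close>

fun list_value :: "(nat \<Rightarrow> real) \<Rightarrow> nat \<Rightarrow> real list \<Rightarrow> real" where
  "list_value d j [] = 0"
| "list_value d j (m # ms) = m + (1 - m) * d j * list_value d (Suc j) ms"

fun list_gap :: "(nat \<Rightarrow> real) \<Rightarrow> nat \<Rightarrow> real list \<Rightarrow> real" where
  "list_gap d j [] = 0"
| "list_gap d j (m # ms) = (Max (set (m # ms)) - m) + (1 - m) * d j * list_gap d (Suc j) ms"

lemma list_value_bounds:
  assumes "\<And>j. 0 \<le> d j \<and> d j \<le> 1" "\<And>x. x \<in> set ms \<Longrightarrow> 0 \<le> x \<and> x \<le> 1"
  shows "0 \<le> list_value d j ms \<and> list_value d j ms \<le> 1"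
  using assms(2)
proof (induction ms arbitrary: j)
  case (Cons m ms)
  have IH: "0 \<le> list_value d (Suc j) ms" "list_value d (Suc j) ms \<le> 1"
    using Cons by auto
  have m: "0 \<le> m" "m \<le> 1" using Cons.prems by auto
  have "0 \<le> d j * list_value d (Suc j) ms" "d j * list_value d (Suc j) ms \<le> 1"
    using IH assms(1)[of j] by (auto intro!: mult_nonneg_nonneg mult_le_one)
  then have "0 \<le> (1 - m) * (d j * list_value d (Suc j) ms)"
     "(1 - m) * (d j * list_value d (Suc j) ms) \<le> (1 - m) * 1"
    using m mult_left_mono[of _ 1 "1 - m"] by (auto intro!: mult_nonneg_nonneg)
  then show ?case using m by (auto simp: mult.assoc)
qed auto

text \<open>The difference of the two sides is \<open>(y - x) * (1 - u) + (1 - y) * (v - u)\<close>,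
  where \<open>u\<close> and \<open>v\<close> are the discounted tail values. Raising a click
  probability helps because no tail is worth more than 1.\<close>

lemma list_value_mono:
  assumes d: "\<And>j. 0 \<le> d j \<and> d j \<le> 1"
    and "0 \<le> x" "x \<le> y" "y \<le> 1" "list_value d (Suc j) xs \<le> list_value d (Suc j) ys"
    and "list_value d (Suc j) xs \<le> 1" "0 \<le> list_value d (Suc j) ys"
  shows "list_value d j (x # xs) \<le> list_value d j (y # ys)"
proof -
  define u v where "u = d j * list_value d (Suc j) xs" and "v = d j * list_value d (Suc j) ys"
  have "u \<le> v" using assms d[of j] by (auto simp: u_def v_def intro: mult_left_mono)
  moreover have "u \<le> 1"
  proof (cases "0 \<le> list_value d (Suc j) xs")
    case True
    then show ?thesis using assms d[of j] by (auto simp: u_def intro!: mult_le_one)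
  next
    case False
    then have "u \<le> 0" using d[of j] by (auto simp: u_def mult_le_0_iff)
    then show ?thesis by simp
  qed
  ultimately have "0 \<le> (y - x) * (1 - u)" "0 \<le> (1 - y) * (v - u)"
    using assms by auto
  moreover have "(y + (1 - y) * v) - (x + (1 - x) * u) = (y - x) * (1 - u) + (1 - y) * (v - u)"
    by (simp add: algebra_simps)
  ultimately have "x + (1 - x) * u \<le> y + (1 - y) * v" by linarith
  then show ?thesis by (simp add: u_def v_def mult.assoc)
qed

text \<open>In front of \<open>a\<close>, the new list is the old one shifted by one place behind
  \<open>b\<close>, and in a decreasing list such a shift dominates the old list entry by entry;
  behind \<open>a\<close> the two lists coincide.\<close>

lemma list_value_replace_by_better:
  assumes d: "\<And>j. 0 \<le> d j \<and> d j \<le> 1"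
  shows "sorted_wrt (\<ge>) (b # xs) \<Longrightarrow> a \<in> set xs \<Longrightarrow> (\<And>x. x \<in> set (b # xs) \<Longrightarrow> 0 \<le> x \<and> x \<le> 1) \<Longrightarrow>
    list_value d j xs \<le> list_value d j (b # remove1 a xs)"
proof (induction xs arbitrary: b j)
  case (Cons x ys)
  have x: "0 \<le> x" "x \<le> b" "b \<le> 1" using Cons.prems by auto
  have ys: "\<And>k. 0 \<le> list_value d k ys \<and> list_value d k ys \<le> 1"
    using Cons.prems by (intro list_value_bounds d) auto
  show ?case
  proof (cases "a = x")
    case True
    then show ?thesis
      using x ys[of "Suc j"] by (simp only: remove1.simps if_True) (intro list_value_mono d; auto)
  next
    case False
    have *: "list_value d (Suc j) ys \<le> list_value d (Suc j) (x # remove1 a ys)"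
      using Cons.prems False by (intro Cons.IH) auto
    have "0 \<le> list_value d (Suc j) (x # remove1 a ys)"
      using * ys[of "Suc j"] by linarith
    then have "list_value d j (x # ys) \<le> list_value d j (b # x # remove1 a ys)"
      using x * ys[of "Suc j"] by (intro list_value_mono d) auto
    then show ?thesis using False by simp
  qed
qed auto

lemma sorted_wrt_remove1: "sorted_wrt R xs \<Longrightarrow> sorted_wrt R (remove1 x xs)"
  using set_remove1_subset by (induction xs) fastforce+

text \<open>Induction on the list shown: its head \<open>m\<close> is compared with the best product
  \<open>b\<close>, at a loss of \<open>b - m\<close>. The optimal continuation after
  \<open>b\<close> differs from the sorted rest of \<open>us\<close> only by containing
  \<open>m\<close> in place of \<open>b\<close>, so it is worth at most as much as that
  rest.\<close>

lemma list_value_sorted_le: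
  assumes d: "\<And>j. 0 \<le> d j \<and> d j \<le> 1"
  shows "sorted_wrt (\<ge>) ys \<Longrightarrow> mset ys = mset us \<Longrightarrow> (\<And>x. x \<in> set us \<Longrightarrow> 0 \<le> x \<and> x \<le> 1) \<Longrightarrow>
    list_value d j ys \<le> list_value d j us + list_gap d j us"
proof (induction us arbitrary: ys j)
  case (Cons m ms)
  from Cons.prems(2) obtain b rs where ys: "ys = b # rs" by (cases ys) auto
  have seteq: "set ys = set (m # ms)" using Cons.prems(2) by (metis set_mset_mset)
  have b: "b = Max (set (m # ms))"
    unfolding seteq[symmetric] using Cons.prems(1)
    by (intro Max_eqI[symmetric]) (auto simp: ys)
  have bnd: "0 \<le> x \<and> x \<le> 1" if "x \<in> set (b # rs)" for x
    using that Cons.prems(3) seteq ys by auto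
  have mb: "0 \<le> m" "m \<le> b" "b \<le> 1"
    using bnd[of b] Cons.prems(3)[of m] by (auto simp: b)
  have *: "list_value d (Suc j) rs \<le> list_value d (Suc j) ms + list_gap d (Suc j) ms"
  proof (cases "m = b")
    case True
    then show ?thesis using Cons.prems ys by (intro Cons.IH) auto
  next
    case False
    then have mrs: "m \<in> set rs" using seteq ys by auto
    have sorted: "sorted_wrt (\<ge>) (b # remove1 m rs)"
      using Cons.prems(1) ys sorted_wrt_remove1[of "(\<ge>)" rs m] set_remove1_subset[of m rs] by auto
    have "list_value d (Suc j) rs \<le> list_value d (Suc j) (b # remove1 m rs)"
      using Cons.prems(1) ys mrs bnd by (intro list_value_replace_by_better d) auto
    also have "\<dots> \<le> list_value d (Suc j) ms + list_gap d (Suc j) ms"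
    proof (rule Cons.IH[OF sorted])
      have "mset (b # rs) = mset (m # ms)" using Cons.prems(2) ys by simp
      then show "mset (b # remove1 m rs) = mset ms"
        using mrs by (metis add_mset_remove_trivial mset.simps(2) mset_remove1 remove1.simps(2) False)
    qed (use Cons.prems in auto)
    finally show ?thesis .
  qed
  have rs: "0 \<le> list_value d (Suc j) rs" using list_value_bounds[OF d, of rs] bnd by auto
  \<comment> \<open>As \<open>b\<close> is clicked at least as often as \<open>m\<close>, no more of
    the tail value is collected after \<open>b\<close>.\<close>
  have "(1 - b) * (d j * list_value d (Suc j) rs) \<le> (1 - m) * (d j * list_value d (Suc j) rs)"
    using mb rs d[of j] by (intro mult_right_mono) auto
  also have "\<dots> \<le> (1 - m) * (d j * (list_value d (Suc j) ms + list_gap d (Suc j) ms))"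
    using mb d[of j] * by (intro mult_left_mono) auto
  finally show ?case unfolding ys using b by (simp add: algebra_simps)
qed auto

section \<open>A real customer\<close>

locale cascade =
  fixes n :: nat and \<mu> q :: "nat \<Rightarrow> real"
  assumes n_pos: "1 \<le> n"
    and mu_range: "\<And>i. i \<in> {1..n} \<Longrightarrow> \<mu> i \<in> {0..1}"
    and mu_decreasing: "\<And>i j. i \<in> {1..n} \<Longrightarrow> j \<in> {1..n} \<Longrightarrow> i < j \<Longrightarrow> \<mu> j < \<mu> i"
    and q_range: "\<And>j. j \<in> {1..n-1} \<Longrightarrow> q j \<in> {0..1}"
begin

text \<open>The value 1 outside the positions \<open>1, ..., n - 1\<close> keeps it in [0,1] where
  \<open>q\<close> is unconstrained; at position \<open>n\<close> it only multiplies the value of an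
  empty list.\<close>

definition survive :: "nat \<Rightarrow> real" where
  "survive j = (if 1 \<le> j \<and> j < n then 1 - q j else 1)"

lemma survive_bounds: "0 \<le> survive j \<and> survive j \<le> 1"
  using q_range[of j] by (auto simp: survive_def)

text \<open>The probability that a real customer who examines position \<open>j\<close> gets as far
  as position \<open>k\<close>.\<close>

definition reach_from :: "ranking \<Rightarrow> nat \<Rightarrow> nat \<Rightarrow> real" where
  "reach_from \<pi> j k = (\<Prod>m=j..<k. (1 - \<mu> (\<pi> m)) * survive m)"

definition reach :: "ranking \<Rightarrow> nat \<Rightarrow> real" where
  "reach \<pi> i = reach_from \<pi> 1 (inv \<pi> i)"

definition win :: "ranking \<Rightarrow> real" where
  "win \<pi> = list_value survive 1 (map (\<lambda>j. \<mu> (\<pi> j)) [1..<Suc n])"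

lemma reach_from_bounds:
  assumes "\<pi> permutes {1..n}" "1 \<le> j" "k \<le> n"
  shows "0 \<le> reach_from \<pi> j k \<and> reach_from \<pi> j k \<le> 1"
proof -
  have "0 \<le> (1 - \<mu> (\<pi> m)) * survive m \<and> (1 - \<mu> (\<pi> m)) * survive m \<le> 1" if "m \<in> {j..<k}" for m
  proof -
    have "\<pi> m \<in> {1..n}" using that assms by (intro permutes_in_image[OF assms(1), THEN iffD2]) auto
    then show ?thesis using mu_range[of "\<pi> m"] survive_bounds[of m] by (auto intro!: mult_le_one)
  qed
  then show ?thesis unfolding reach_from_def by (auto intro!: prod_nonneg prod_le_1)
qed

lemma inv_in: "\<pi> permutes {1..n} \<Longrightarrow> i \<in> {1..n} \<Longrightarrow> inv \<pi> i \<in> {1..n}"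
  by (metis permutes_in_image permutes_inv)

lemma reach_bounds:
  assumes "\<pi> permutes {1..n}" "i \<in> {1..n}"
  shows "0 \<le> reach \<pi> i" "reach \<pi> i \<le> 1"
  using reach_from_bounds[OF assms(1), of 1 "inv \<pi> i"] inv_in[OF assms] by (auto simp: reach_def)

lemma win_bounds:
  assumes "\<pi> permutes {1..n}"
  shows "0 \<le> win \<pi>" "win \<pi> \<le> 1"
proof -
  have "0 \<le> list_value survive 1 (map (\<lambda>j. \<mu> (\<pi> j)) [1..<Suc n]) \<and>
    list_value survive 1 (map (\<lambda>j. \<mu> (\<pi> j)) [1..<Suc n]) \<le> 1"
  proof (rule list_value_bounds[OF survive_bounds])
    fix x assume "x \<in> set (map (\<lambda>j. \<mu> (\<pi> j)) [1..<Suc n])"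
    then obtain j where "j \<in> {1..n}" "x = \<mu> (\<pi> j)"
      by (auto simp: atLeastLessThanSuc_atLeastAtMost simp del: upt_Suc)
    then show "0 \<le> x \<and> x \<le> 1" using mu_range[of "\<pi> j"] permutes_in_image[OF assms, of j] by auto
  qed
  then show "0 \<le> win \<pi>" "win \<pi> \<le> 1" by (auto simp: win_def)
qed

lemma set_customer_from:
  assumes "1 \<le> j" "j \<le> n"
  shows "set_pmf (customer_from n \<mu> q \<pi> j) \<subseteq> (\<Union>k\<in>{j..n}. {(Some (\<pi> k), k), (None, k)})"
  using assms
proof (induction "n - j" arbitrary: j)
  case 0
  then show ?case by (subst customer_from.simps) (auto simp: set_bind_pmf split: if_splits)
next
  case (Suc x)
  have "set_pmf (customer_from n \<mu> q \<pi> (Suc j)) \<subseteq> (\<Union>k\<in>{Suc j..n}. {(Some (\<pi> k), k), (None, k)})"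
    by (rule Suc.hyps(1)) (use Suc in auto)
  also have "\<dots> \<subseteq> (\<Union>k\<in>{j..n}. {(Some (\<pi> k), k), (None, k)})" by fastforce
  finally have sub: "set_pmf (customer_from n \<mu> q \<pi> (Suc j)) \<subseteq> \<dots>" .
  have "set_pmf (customer_from n \<mu> q \<pi> j) \<subseteq>
    {(Some (\<pi> j), j), (None, j)} \<union> set_pmf (customer_from n \<mu> q \<pi> (Suc j))"
    by (subst customer_from.simps) (auto simp: set_bind_pmf split: if_splits)
  also have "\<dots> \<subseteq> (\<Union>k\<in>{j..n}. {(Some (\<pi> k), k), (None, k)})"
    using sub Suc.prems by auto
  finally show ?case .
qed

lemma finite_customer_from:
  assumes "1 \<le> j" "j \<le> n"
  shows "finite (set_pmf (customer_from n \<mu> q \<pi> j))"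
  by (rule finite_subset[OF set_customer_from[OF assms]]) auto

lemma set_real_customer: "set_pmf (real_customer n \<mu> q \<pi>) \<subseteq> possible_responses n \<pi> Real_User"
  using set_customer_from[of 1] n_pos by (auto simp: real_customer_def)

lemma finite_response: "finite (set_pmf (response n \<mu> q \<pi> a))"
  using finite_customer_from[of 1] n_pos by (cases a) (auto simp: real_customer_def)

lemma set_response: "set_pmf (response n \<mu> q \<pi> a) \<subseteq> possible_responses n \<pi> a"
  using set_real_customer by (cases a) auto

lemma expect_customer_from:
  assumes "\<pi> permutes {1..n}" "1 \<le> j" "j \<le> n"
  shows "expect (customer_from n \<mu> q \<pi> j) f =
     \<mu> (\<pi> j) * f (Some (\<pi> j), j) + (1 - \<mu> (\<pi> j)) *
       (if j < n then (1 - survive j) * f (None, j) + survive j * expect (customer_from n \<mu> q \<pi> (Suc j)) f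
        else f (None, j))"
proof -
  have mu: "0 \<le> \<mu> (\<pi> j)" "\<mu> (\<pi> j) \<le> 1"
    using mu_range[of "\<pi> j"] permutes_in_image[OF assms(1), of j] assms by auto
  have q: "0 \<le> q j" "q j \<le> 1" "survive j = 1 - q j" if "j < n"
    using that assms q_range[of j] by (auto simp: survive_def)
  have fin: "finite (set_pmf (customer_from n \<mu> q \<pi> (Suc j)))" if "j < n"
    using that by (intro finite_customer_from) auto
  show ?thesis
    apply (subst customer_from.simps)
    apply (subst expect_bind)
      apply simp
     apply (auto simp: set_bind_pmf fin)[1]
    apply (subst integral_bernoulli_pmf)
    using mu apply (auto simp: expect_bind fin q integral_bernoulli_pmf)
    done
qed

text \<open>The Booleans stand for "examined" and "clicked", so one computation gives their joint
  law; the combination \<open>g False True\<close> cannot occur. It is evaluated with exponentials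
  for the concentration bound and with the first Boolean alone for the examination
  probability.\<close>

lemma expect_customer_from_product:
  assumes perm: "\<pi> permutes {1..n}" and "1 \<le> j" "j \<le> k" "k \<le> n"
  shows "expect (customer_from n \<mu> q \<pi> j) (\<lambda>c. g (k \<le> snd c) (fst c = Some (\<pi> k))) =
     (1 - reach_from \<pi> j k) * g False False +
     reach_from \<pi> j k * (\<mu> (\<pi> k) * g True True + (1 - \<mu> (\<pi> k)) * g True False)"
  using assms(2-)
proof (induction "n - j" arbitrary: j)
  case 0
  then have jk: "j = k" "\<not> k < n" by auto
  have k: "1 \<le> k" "k \<le> n" using 0 by auto
  show ?case unfolding jk(1) expect_customer_from[OF perm k] using jk(2) by (simp add: reach_from_def)
next
  case (Suc x)
  have jn: "j < n" using Suc.hyps(2) by auto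
  show ?case
  proof (cases "j = k")
    case True
    \<comment> \<open>A customer who passes position \<open>j\<close> has examined the product
      there, and by injectivity of the ranking no later click is on this product.\<close>
    have "expect (customer_from n \<mu> q \<pi> (Suc j)) (\<lambda>c. g (k \<le> snd c) (fst c = Some (\<pi> k))) =
      expect (customer_from n \<mu> q \<pi> (Suc j)) (\<lambda>c. g True False)"
    proof (rule expect_cong)
      fix c assume "c \<in> set_pmf (customer_from n \<mu> q \<pi> (Suc j))"
      moreover have "1 \<le> Suc j" "Suc j \<le> n" using jn by auto
      ultimately have "c \<in> (\<Union>k\<in>{Suc j..n}. {(Some (\<pi> k), k), (None, k)})"
        using set_customer_from by blast
      then obtain m where "m \<in> {Suc j..n}" "c = (Some (\<pi> m), m) \<or> c = (None, m)"
        by blast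
      then show "g (k \<le> snd c) (fst c = Some (\<pi> k)) = g True False"
        using True inj_eq[OF permutes_inj[OF perm], of m k] by auto
    qed
    with expect_customer_from[OF perm, of j "\<lambda>c. g (k \<le> snd c) (fst c = Some (\<pi> k))"] True jn Suc.prems
    show ?thesis
      by (simp add: reach_from_def algebra_simps)
  next
    case False
    then have jk: "j < k" using Suc by auto
    note expect_eq = expect_customer_from[OF perm, of j "\<lambda>c. g (k \<le> snd c) (fst c = Some (\<pi> k))"]
    have IH: "expect (customer_from n \<mu> q \<pi> (Suc j)) (\<lambda>c. g (k \<le> snd c) (fst c = Some (\<pi> k))) =
     (1 - reach_from \<pi> (Suc j) k) * g False False +
     reach_from \<pi> (Suc j) k * (\<mu> (\<pi> k) * g True True + (1 - \<mu> (\<pi> k)) * g True False)"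
      by (rule Suc.hyps(1)) (use jk Suc in auto)
    have r: "reach_from \<pi> j k = (1 - \<mu> (\<pi> j)) * survive j * reach_from \<pi> (Suc j) k"
      unfolding reach_from_def using jk by (simp add: prod.atLeast_Suc_lessThan)
    have "\<pi> j \<noteq> \<pi> k" using False permutes_inj[OF perm] by (auto simp: inj_eq)
    with expect_eq jk jn Suc.prems show ?thesis
      unfolding r IH by (simp add: algebra_simps)
  qed
qed

lemma in_examined_iff:
  assumes "\<pi> permutes {1..n}" "i \<in> {1..n}"
  shows "i \<in> examined \<pi> c \<longleftrightarrow> inv \<pi> i \<le> snd c"
proof -
  have "i \<in> examined \<pi> c \<longleftrightarrow> inv \<pi> i \<in> {1..snd c}"
  proof
    assume "i \<in> examined \<pi> c"
    then obtain m where "m \<in> {1..snd c}" "i = \<pi> m" by (auto simp: examined_def)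
    then show "inv \<pi> i \<in> {1..snd c}" by (simp add: permutes_inverses(2)[OF assms(1)])
  next
    assume "inv \<pi> i \<in> {1..snd c}"
    then have "\<pi> (inv \<pi> i) \<in> examined \<pi> c" unfolding examined_def by (rule imageI)
    then show "i \<in> examined \<pi> c" by (simp add: permutes_inverses(1)[OF assms(1)])
  qed
  then show ?thesis using inv_in[OF assms] by auto
qed

lemma expect_real_customer_product:
  assumes perm: "\<pi> permutes {1..n}" and i: "i \<in> {1..n}"
  shows "expect (real_customer n \<mu> q \<pi>) (\<lambda>c. g (i \<in> examined \<pi> c) (fst c = Some i)) =
     (1 - reach \<pi> i) * g False False +
     reach \<pi> i * (\<mu> i * g True True + (1 - \<mu> i) * g True False)"
  using expect_customer_from_product[OF perm, of 1 "inv \<pi> i" g] inv_in[OF assms]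
    permutes_inverses(1)[OF perm, of i]
  by (simp add: real_customer_def reach_def in_examined_iff[OF assms])

section \<open>Click probability and loss of a ranking\<close>

lemma expect_customer_from_click:
  assumes perm: "\<pi> permutes {1..n}" and "1 \<le> j" "j \<le> n"
  shows "expect (customer_from n \<mu> q \<pi> j) (\<lambda>c. of_bool (fst c \<noteq> None)) =
     list_value survive j (map (\<lambda>j. \<mu> (\<pi> j)) [j..<Suc n])"
  using assms(2-)
proof (induction "n - j" arbitrary: j)
  case 0
  then have j: "j = n" by auto
  have "1 \<le> j" "j \<le> n" using 0 by auto
  from expect_customer_from[OF perm this] show ?case using j n_pos by simp
next
  case (Suc x)
  have IH: "expect (customer_from n \<mu> q \<pi> (Suc j)) (\<lambda>c. of_bool (fst c \<noteq> None)) =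
     list_value survive (Suc j) (map (\<lambda>j. \<mu> (\<pi> j)) [Suc j..<Suc n])"
    by (rule Suc.hyps(1)) (use Suc in auto)
  have "[j..<Suc n] = j # [Suc j..<Suc n]" using Suc by (intro upt_conv_Cons) auto
  with expect_customer_from[OF perm, of j "\<lambda>c. of_bool (fst c \<noteq> None)"] Suc.hyps(2) Suc.prems IH
  show ?case by (simp del: upt_Suc)
qed

lemma expect_click:
  assumes perm: "\<pi> permutes {1..n}"
  shows "expect (real_customer n \<mu> q \<pi>) (\<lambda>c. of_bool (fst c \<noteq> None)) = win \<pi>"
  using expect_customer_from_click[OF perm, of 1] n_pos by (simp add: real_customer_def win_def)

text \<open>Products are numbered by decreasing click probability, so the least number is the most
  attractive product still available at position \<open>j\<close>.\<close>

definition best_left :: "ranking \<Rightarrow> nat \<Rightarrow> nat" where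
  "best_left \<pi> j = Min (\<pi> ` {j..n})"

lemma mu_antimono: "i \<in> {1..n} \<Longrightarrow> j \<in> {1..n} \<Longrightarrow> i \<le> j \<Longrightarrow> \<mu> j \<le> \<mu> i"
  using mu_decreasing[of i j] by (cases "i = j") auto

lemma best_left:
  assumes "\<pi> permutes {1..n}" "j \<in> {1..n}"
  shows "best_left \<pi> j \<in> \<pi> ` {j..n}" "\<And>i. i \<in> \<pi> ` {j..n} \<Longrightarrow> best_left \<pi> j \<le> i"
  using assms by (auto simp: best_left_def intro!: Min_in)

lemma Max_left:
  assumes "\<pi> permutes {1..n}" "j \<in> {1..n}"
  shows "Max ((\<lambda>j. \<mu> (\<pi> j)) ` {j..n}) = \<mu> (best_left \<pi> j)"
proof (rule Max_eqI)
  have sub: "\<pi> ` {j..n} \<subseteq> {1..n}"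
    using permutes_in_image[OF assms(1)] assms(2) by fastforce
  show "\<mu> (best_left \<pi> j) \<in> (\<lambda>j. \<mu> (\<pi> j)) ` {j..n}" using best_left(1)[OF assms] by auto
  fix y assume "y \<in> (\<lambda>j. \<mu> (\<pi> j)) ` {j..n}"
  then obtain i where i: "i \<in> \<pi> ` {j..n}" "y = \<mu> i" by auto
  then show "y \<le> \<mu> (best_left \<pi> j)"
    using best_left[OF assms] sub by (auto intro!: mu_antimono)
qed auto

lemma list_gap_eq:
  assumes perm: "\<pi> permutes {1..n}" and "1 \<le> j" "j \<le> n"
  shows "list_gap survive j (map (\<lambda>j. \<mu> (\<pi> j)) [j..<Suc n]) =
    (\<Sum>k=j..n. reach_from \<pi> j k * (\<mu> (best_left \<pi> k) - \<mu> (\<pi> k)))"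
  using assms(2-)
proof (induction "n - j" arbitrary: j)
  case 0
  then have "j = n" by auto
  then show ?case using 0 Max_left[OF perm, of n] by (simp add: reach_from_def)
next
  case (Suc x)
  have IH: "list_gap survive (Suc j) (map (\<lambda>j. \<mu> (\<pi> j)) [Suc j..<Suc n]) =
    (\<Sum>k=Suc j..n. reach_from \<pi> (Suc j) k * (\<mu> (best_left \<pi> k) - \<mu> (\<pi> k)))"
    by (rule Suc.hyps(1)) (use Suc in auto)
  have split: "[j..<Suc n] = j # [Suc j..<Suc n]" using Suc by (intro upt_conv_Cons) auto
  have img: "set (map (\<lambda>j. \<mu> (\<pi> j)) [j..<Suc n]) = (\<lambda>j. \<mu> (\<pi> j)) ` {j..n}"
    by (simp add: atLeastLessThanSuc_atLeastAtMost del: upt_Suc)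
  have "list_gap survive j (map (\<lambda>j. \<mu> (\<pi> j)) [j..<Suc n]) =
    (\<mu> (best_left \<pi> j) - \<mu> (\<pi> j)) + (1 - \<mu> (\<pi> j)) * survive j *
      (\<Sum>k=Suc j..n. reach_from \<pi> (Suc j) k * (\<mu> (best_left \<pi> k) - \<mu> (\<pi> k)))"
    using IH img Max_left[OF perm, of j] Suc.prems unfolding split
    by (simp del: upt_Suc)
  also have "\<dots> = (\<mu> (best_left \<pi> j) - \<mu> (\<pi> j)) +
      (\<Sum>k=Suc j..n. reach_from \<pi> j k * (\<mu> (best_left \<pi> k) - \<mu> (\<pi> k)))"
    unfolding sum_distrib_left
    by (intro arg_cong2[of _ _ _ _ "(+)"] sum.cong)
       (auto simp: reach_from_def prod.atLeast_Suc_lessThan)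
  also have "\<dots> = (\<Sum>k=j..n. reach_from \<pi> j k * (\<mu> (best_left \<pi> k) - \<mu> (\<pi> k)))"
    using Suc.prems by (subst (2) sum.atLeast_Suc_atMost) (auto simp: reach_from_def)
  finally show ?case .
qed

lemma win_gap_positions:
  assumes perm: "\<pi> permutes {1..n}"
  shows "win id - win \<pi> \<le> (\<Sum>k=1..n. reach_from \<pi> 1 k * (\<mu> (best_left \<pi> k) - \<mu> (\<pi> k)))"
proof -
  let ?ys = "map \<mu> [1..<Suc n]" and ?us = "map (\<lambda>j. \<mu> (\<pi> j)) [1..<Suc n]"
  have "list_value survive 1 ?ys \<le> list_value survive 1 ?us + list_gap survive 1 ?us"
  proof (rule list_value_sorted_le[OF survive_bounds])
    show "sorted_wrt (\<ge>) ?ys"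
      unfolding sorted_wrt_map
      by (rule sorted_wrt_mono_rel[OF _ sorted_wrt_upt]) (auto intro: mu_antimono)
    have "mset (map \<pi> [1..<Suc n]) = mset [1..<Suc n]"
    proof (subst set_eq_iff_mset_eq_distinct[symmetric])
      show "distinct (map \<pi> [1..<Suc n])"
        using permutes_inj[OF perm] by (auto simp: distinct_map intro: inj_on_subset)
      show "set (map \<pi> [1..<Suc n]) = set [1..<Suc n]"
        using permutes_image[OF perm] by (auto simp: atLeastLessThanSuc_atLeastAtMost simp del: upt_Suc)
    qed simp
    then have "image_mset \<mu> (mset (map \<pi> [1..<Suc n])) = image_mset \<mu> (mset [1..<Suc n])"
      by (rule arg_cong)
    then show "mset ?ys = mset ?us" by (simp only: mset_map image_mset.compositionality comp_def)
    fix x assume "x \<in> set ?us"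
    then obtain j where "j \<in> {1..n}" "x = \<mu> (\<pi> j)"
      by (auto simp: atLeastLessThanSuc_atLeastAtMost simp del: upt_Suc)
    then show "0 \<le> x \<and> x \<le> 1" using mu_range[of "\<pi> j"] permutes_in_image[OF perm, of j] by auto
  qed
  then show ?thesis using list_gap_eq[OF perm, of 1] n_pos by (simp add: win_def)
qed

text \<open>The loss is rewritten over pairs because the regret bound is a sum over pairs. Each
  product \<open>a\<close> is paired with a single \<open>b\<close>; if that is \<open>a\<close>
  itself, the gap is 0, so pairs with \<open>b < a\<close> suffice.\<close>

lemma win_gap_pairs:
  assumes perm: "\<pi> permutes {1..n}"
  shows "win id - win \<pi> \<le> (\<Sum>b=1..n. \<Sum>a=b+1..n. (\<mu> b - \<mu> a) *
    (if b = best_left \<pi> (inv \<pi> a) then reach \<pi> a else 0))"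
proof -
  have *: "(\<Sum>b=1..n. if a \<in> {b+1..n} then (\<mu> b - \<mu> a) * (if b = best_left \<pi> (inv \<pi> a) then reach \<pi> a else 0) else 0) =
    reach \<pi> a * (\<mu> (best_left \<pi> (inv \<pi> a)) - \<mu> a)" if a: "a \<in> {1..n}" for a
  proof -
    let ?k = "inv \<pi> a"
    have k: "?k \<in> {1..n}" "\<pi> ?k = a" using inv_in[OF perm a] permutes_inverses(1)[OF perm] by auto
    have "best_left \<pi> ?k \<le> a" using best_left(2)[OF perm k(1), of a] k by force
    moreover have "best_left \<pi> ?k \<in> {1..n}"
      using best_left(1)[OF perm k(1)] permutes_in_image[OF perm] k(1) by fastforce
    ultimately have b: "best_left \<pi> ?k \<in> {1..n}" "best_left \<pi> ?k = a \<or> a \<in> {best_left \<pi> ?k + 1..n}"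
      using a by auto
    have "(\<Sum>b=1..n. if a \<in> {b+1..n} then (\<mu> b - \<mu> a) * (if b = best_left \<pi> ?k then reach \<pi> a else 0) else 0) =
      (\<Sum>b=1..n. if b = best_left \<pi> ?k then reach \<pi> a * (\<mu> (best_left \<pi> ?k) - \<mu> a) else 0)"
      using b(2) by (intro sum.cong refl) auto
    then show ?thesis using b(1) by (simp add: sum.delta)
  qed
  have "win id - win \<pi> \<le> (\<Sum>k=1..n. reach_from \<pi> 1 k * (\<mu> (best_left \<pi> k) - \<mu> (\<pi> k)))"
    by (rule win_gap_positions[OF perm])
  also have "\<dots> = (\<Sum>a=1..n. reach \<pi> a * (\<mu> (best_left \<pi> (inv \<pi> a)) - \<mu> a))"
    using sum.reindex_bij_betw[OF permutes_imp_bij[OF perm],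
        of "\<lambda>a. reach \<pi> a * (\<mu> (best_left \<pi> (inv \<pi> a)) - \<mu> a)"]
    by (simp add: reach_def permutes_inverses(2)[OF perm])
  also have "\<dots> = (\<Sum>a=1..n. \<Sum>b=1..n. if a \<in> {b+1..n} then (\<mu> b - \<mu> a) *
    (if b = best_left \<pi> (inv \<pi> a) then reach \<pi> a else 0) else 0)"
    by (intro sum.cong *[symmetric]) auto
  also have "\<dots> = (\<Sum>b=1..n. \<Sum>a=b+1..n. (\<mu> b - \<mu> a) *
    (if b = best_left \<pi> (inv \<pi> a) then reach \<pi> a else 0))"
    by (subst sum.swap, intro sum.cong refl sum.mono_neutral_cong_right) auto
  finally show ?thesis .
qed

end

section \<open>Statistics as functions of the history\<close>

text \<open>The weight of a round of level \<open>l'\<close> in the estimates of level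
  \<open>l\<close>. It turns \<open>eta_hat\<close> into \<open>mass\<close>, and its product with
  \<open>rate_hat\<close> into \<open>click_mass\<close>: sums over rounds with bounded increments,
  to which martingale arguments apply.\<close>

definition level_weight :: "nat \<Rightarrow> nat \<Rightarrow> real" where
  "level_weight l l' = (if l' = l then 1 else if 1 \<le> l' \<and> l' < l then 1 / 2 ^ l else 0)"

definition exam_count :: "forc_history \<Rightarrow> nat \<Rightarrow> nat \<Rightarrow> nat" where
  "exam_count h l i = length (filter (\<lambda>(l', \<pi>, c). l' = l \<and> i \<in> examined \<pi> c) h)"

definition mass :: "forc_history \<Rightarrow> nat \<Rightarrow> nat \<Rightarrow> real" where
  "mass h l i = (\<Sum>(l', \<pi>, c)\<leftarrow>h. level_weight l l' * of_bool (i \<in> examined \<pi> c))"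

definition click_mass :: "forc_history \<Rightarrow> nat \<Rightarrow> nat \<Rightarrow> real" where
  "click_mass h l i =
     (\<Sum>(l', \<pi>, c)\<leftarrow>h. level_weight l l' * of_bool (i \<in> examined \<pi> c \<and> fst c = Some i))"

lemma level_weight_bounds: "0 \<le> level_weight l l'" "level_weight l l' \<le> 1"
  by (auto simp: level_weight_def)

lemma exam_count_Nil [simp]: "exam_count [] l i = 0"
  and exam_count_Cons: "exam_count ((l', \<pi>, c) # h) l i = of_bool (l' = l \<and> i \<in> examined \<pi> c) + exam_count h l i"
  by (auto simp: exam_count_def)

lemma clicks_Nil [simp]: "clicks [] l i = 0"
  and clicks_Cons: "clicks ((l', \<pi>, c) # h) l i =
    of_bool (l' = l \<and> i \<in> examined \<pi> c \<and> fst c = Some i) + clicks h l i"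
  by (auto simp: clicks_def)

lemma mass_Nil [simp]: "mass [] l i = 0"
  and mass_Cons: "mass ((l', \<pi>, c) # h) l i = level_weight l l' * of_bool (i \<in> examined \<pi> c) + mass h l i"
  by (auto simp: mass_def)

lemma click_mass_Nil [simp]: "click_mass [] l i = 0"
  and click_mass_Cons: "click_mass ((l', \<pi>, c) # h) l i =
    level_weight l l' * of_bool (i \<in> examined \<pi> c \<and> fst c = Some i) + click_mass h l i"
  by (auto simp: click_mass_def)

lemma sum_of_bool_level:
  "(\<Sum>g=1..<l. real (of_bool (l' = g \<and> Q))) / 2 ^ l + real (of_bool (l' = l \<and> Q)) =
    level_weight l l' * of_bool Q"
proof -
  have "(\<Sum>g=1..<l. real (of_bool (l' = g \<and> Q))) = (\<Sum>g=1..<l. if g = l' then of_bool Q else 0)"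
    by (intro sum.cong) auto
  then show ?thesis by (auto simp: level_weight_def)
qed

lemma mass_eq: "mass h l i = (\<Sum>g=1..<l. real (exam_count h g i)) / 2 ^ l + real (exam_count h l i)"
proof (induction h)
  case (Cons e h)
  obtain l' \<pi> c where e: "e = (l', \<pi>, c)" by (cases e)
  show ?case
    unfolding e mass_Cons exam_count_Cons of_nat_add sum.distrib Cons.IH
      sum_of_bool_level[symmetric] add_divide_distrib by simp
qed simp

lemma click_mass_eq:
  "click_mass h l i = (\<Sum>g=1..<l. real (clicks h g i)) / 2 ^ l + real (clicks h l i)"
proof (induction h)
  case (Cons e h)
  obtain l' \<pi> c where e: "e = (l', \<pi>, c)" by (cases e)
  show ?case
    unfolding e click_mass_Cons clicks_Cons of_nat_add sum.distrib Cons.IH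
      sum_of_bool_level[symmetric] add_divide_distrib by simp
qed simp

lemma clicks_le_count: "clicks h l i \<le> exam_count h l i"
proof (induction h)
  case (Cons e h)
  then show ?case by (cases e) (auto simp: clicks_Cons exam_count_Cons)
qed simp

lemma count_le_mass: "real (exam_count h l i) \<le> mass h l i"
  by (simp add: mass_eq sum_nonneg)

lemma lower_counts_le_mass: "(\<Sum>g=1..<l. real (exam_count h g i)) \<le> 2 ^ l * mass h l i"
  by (simp add: mass_eq field_simps)

lemma mass_nonneg: "0 \<le> mass h l i"
  using count_le_mass[of h l i] by linarith

section \<open>Invariants of the algorithm\<close>

lemma state_Cons:
  "forc_state_after n T L ((l, \<pi>, c) # h) =
     eliminate L (add_edges n T L (update_hats L l (examined \<pi> c)
          (update_rates ((l, \<pi>, c) # h) l (examined \<pi> c) (forc_state_after n T L h))))"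
  by simp

declare forc_state_after.simps(2) [simp del]

lemma eta_hats_graph_steps [simp]:
  "eta (eliminate L s) = eta s" "eta (add_edges n T L s) = eta s" "eta (update_hats L lt X s) = eta s"
  "rate (eliminate L s) = rate s" "rate (add_edges n T L s) = rate s"
  "rate (update_hats L lt X s) = rate s"
  "eta_hat (eliminate L s) = eta_hat s" "eta_hat (add_edges n T L s) = eta_hat s"
  "eta_hat (update_rates h lt X s) = eta_hat s"
  "rate_hat (eliminate L s) = rate_hat s" "rate_hat (add_edges n T L s) = rate_hat s"
  "rate_hat (update_rates h lt X s) = rate_hat s"
  "graph (eliminate L s) = graph s" "graph (update_hats L lt X s) = graph s"
  "graph (update_rates h lt X s) = graph s"
  "eliminated (add_edges n T L s) = eliminated s" "eliminated (update_hats L lt X s) = eliminated s"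
  "eliminated (update_rates h lt X s) = eliminated s"
  by (simp_all add: eliminate_def add_edges_def update_hats_def update_rates_def Let_def)

lemma eta_state: "eta (forc_state_after n T L h) l i = exam_count h l i"
proof (induction h)
  case (Cons e h)
  obtain l' \<pi> c where e: "e = (l', \<pi>, c)" by (cases e)
  have "eta (forc_state_after n T L (e # h)) l i =
    eta (update_rates (e # h) l' (examined \<pi> c) (forc_state_after n T L h)) l i"
    by (simp add: state_Cons e)
  then show ?case using Cons.IH by (auto simp: e update_rates_def Let_def exam_count_Cons)
qed (simp add: initial_state_def)

text \<open>A product without examinations has rate 0 on both sides, by the convention
  \<open>x / 0 = 0\<close>.\<close>

lemma rate_state:
  "rate (forc_state_after n T L h) l i = real (clicks h l i) / real (exam_count h l i)"
proof (induction h)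
  case (Cons e h)
  obtain l' \<pi> c where e: "e = (l', \<pi>, c)" by (cases e)
  have "rate (forc_state_after n T L (e # h)) l i =
    rate (update_rates (e # h) l' (examined \<pi> c) (forc_state_after n T L h)) l i"
    by (simp add: state_Cons e)
  then show ?case using Cons.IH
    by (auto simp: e update_rates_def Let_def exam_count_Cons clicks_Cons eta_state)
qed (simp add: initial_state_def)

lemma count_times_rate:
  "real (exam_count h l i) * (real (clicks h l i) / real (exam_count h l i)) = real (clicks h l i)"
  using clicks_le_count[of h l i] by (cases "exam_count h l i = 0") auto

lemma hats_state_Cons:
  fixes h :: forc_history
  assumes "e = (l', \<pi>, c)" and s_def: "s = forc_state_after n T L h"
  shows "eta_hat (forc_state_after n T L (e # h)) l i =
      (if l \<in> {l'..L} \<and> i \<in> examined \<pi> c then mass (e # h) l i else eta_hat s l i)"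
    and "rate_hat (forc_state_after n T L (e # h)) l i =
      (if l \<in> {l'..L} \<and> i \<in> examined \<pi> c then click_mass (e # h) l i / mass (e # h) l i
       else rate_hat s l i)"
proof -
  let ?u = "update_rates (e # h) l' (examined \<pi> c) s"
  have eta: "eta ?u l i = exam_count (e # h) l i" for l i
    using eta_state[of n T L "e # h" l i] by (simp add: state_Cons s_def assms(1))
  have rate: "rate ?u l i = real (clicks (e # h) l i) / real (exam_count (e # h) l i)" for l i
    using rate_state[of n T L "e # h" l i] by (simp add: state_Cons s_def assms(1))
  show "eta_hat (forc_state_after n T L (e # h)) l i =
      (if l \<in> {l'..L} \<and> i \<in> examined \<pi> c then mass (e # h) l i else eta_hat s l i)"
    using eta by (simp add: state_Cons s_def assms(1) update_hats_def Let_def mass_eq)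
  have "rate_hat (forc_state_after n T L (e # h)) l i =
    rate_hat (update_hats L l' (examined \<pi> c) ?u) l i"
    by (simp add: state_Cons s_def assms(1))
  also have "\<dots> = (if l \<in> {l'..L} \<and> i \<in> examined \<pi> c
       then (\<Sum>g=1..<l. real (clicks (e # h) g i)) / (2 ^ l * mass (e # h) l i)
         + real (exam_count (e # h) l i) / mass (e # h) l i *
             (real (clicks (e # h) l i) / real (exam_count (e # h) l i))
       else rate_hat s l i)"
    by (simp add: update_hats_def Let_def eta rate count_times_rate mass_eq[symmetric, unfolded One_nat_def]
        del: times_divide_eq_right times_divide_eq_left times_divide_times_eq)
  also have "real (exam_count (e # h) l i) / mass (e # h) l i *
             (real (clicks (e # h) l i) / real (exam_count (e # h) l i)) =
     real (clicks (e # h) l i) / mass (e # h) l i"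
    using count_times_rate[of "e # h" l i]
    by (metis (no_types, lifting) mult.commute times_divide_eq_right)
  also have "(\<Sum>g=1..<l. real (clicks (e # h) g i)) / (2 ^ l * mass (e # h) l i)
         + real (clicks (e # h) l i) / mass (e # h) l i = click_mass (e # h) l i / mass (e # h) l i"
    by (simp add: click_mass_eq add_divide_distrib)
  finally show "rate_hat (forc_state_after n T L (e # h)) l i =
      (if l \<in> {l'..L} \<and> i \<in> examined \<pi> c then click_mass (e # h) l i / mass (e # h) l i
       else rate_hat s l i)" .
qed

lemma hats_state:
  assumes "l \<in> {1..L}"
  shows "eta_hat (forc_state_after n T L h) l i = mass h l i"
    and "rate_hat (forc_state_after n T L h) l i = click_mass h l i / mass h l i"
proof (induction h)
  case Nil
  case 1 show ?case by (simp add: initial_state_def)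
  case 2 show ?case by (simp add: initial_state_def)
next
  case (Cons e h)
  obtain l' \<pi> c where e: "e = (l', \<pi>, c)" by (cases e)
  \<comment> \<open>Entries that the update skips remain correct because the round has weight 0 for
    them: either the product was not examined or the level drawn lies above
    \<open>l\<close>.\<close>
  have *: "mass (e # h) l i = mass h l i" "click_mass (e # h) l i = click_mass h l i"
    if "\<not> (l \<in> {l'..L} \<and> i \<in> examined \<pi> c)"
    using that assms by (auto simp: e mass_Cons click_mass_Cons level_weight_def)
  case 1 show ?case using Cons.IH(1) * by (auto simp: hats_state_Cons[OF e refl])
  case 2 show ?case using Cons.IH(2) * by (auto simp: hats_state_Cons[OF e refl])
qed

lemma new_edges_steps [simp]:
  "new_edges n T L (eliminate L' s) l = new_edges n T L s l"
  "new_edges n T L (add_edges n' T' L' s) l = new_edges n T L s l"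
  by (auto simp: new_edges_def width_def)

lemma eliminated_Cons:
  "\<not> eliminated (forc_state_after n T L (e # h)) g \<Longrightarrow> \<not> eliminated (forc_state_after n T L h) g"
  by (cases e) (simp add: state_Cons eliminate_def)

lemma graph_add_edges:
  "graph (add_edges n T L s) g =
    (if eliminated s g then graph s g
     else graph s g \<union> (\<Union>l\<in>{l \<in> {g..L}. \<not> eliminated s l}. new_edges n T L s l))"
  by (simp add: add_edges_def)

text \<open>Elimination is tested in the state before the round, whereas the new edges may be read
  off the state after it, because adding edges and eliminating leave the estimates
  unchanged.\<close>

lemma graph_Cons:
  "graph (forc_state_after n T L (e # h)) g =
    (if eliminated (forc_state_after n T L h) g then graph (forc_state_after n T L h) g
     else graph (forc_state_after n T L h) g \<union>
       (\<Union>l\<in>{l \<in> {g..L}. \<not> eliminated (forc_state_after n T L h) l}.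
          new_edges n T L (forc_state_after n T L (e # h)) l))"
  by (cases e) (simp add: state_Cons graph_add_edges)

lemma eliminated_Cons_iff:
  "eliminated (forc_state_after n T L (e # h)) g \<longleftrightarrow>
    eliminated (forc_state_after n T L h) g \<or>
    (\<exists>l\<in>{g..L}. \<not> acyclic (graph (forc_state_after n T L (e # h)) l))"
  by (cases e) (simp add: state_Cons eliminate_def)

text \<open>Edges are added in the same round in which the estimates change, so the graph of a live
  level never lags behind its estimates.\<close>

lemma new_edges_subset_graph:
  assumes "l \<in> {1..L}" "\<not> eliminated (forc_state_after n T L h) l"
  shows "new_edges n T L (forc_state_after n T L h) l \<subseteq> graph (forc_state_after n T L h) l"
proof (cases h)
  case Nil
  then show ?thesis by (auto simp: new_edges_def initial_state_def)
next
  case (Cons e h')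
  then have "\<not> eliminated (forc_state_after n T L h') l" using assms(2) eliminated_Cons by auto
  then show ?thesis unfolding Cons graph_Cons using assms(1) by auto
qed

text \<open>Each edge found on a level is also added to the live graphs of all lower levels, and a
  level that is live now has been live in every earlier round.\<close>

lemma graph_antimono:
  assumes "g \<le> l" "\<not> eliminated (forc_state_after n T L h) g" "\<not> eliminated (forc_state_after n T L h) l"
  shows "graph (forc_state_after n T L h) l \<subseteq> graph (forc_state_after n T L h) g"
  using assms(2,3)
proof (induction h)
  case (Cons e h)
  have *: "\<not> eliminated (forc_state_after n T L h) g" "\<not> eliminated (forc_state_after n T L h) l"
    using Cons.prems eliminated_Cons by auto
  show ?case using Cons.IH[OF *] * assms(1) unfolding graph_Cons by fastforce
qed (simp add: initial_state_def)

lemma acyclic_graph: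
  assumes "g \<le> L" "\<not> eliminated (forc_state_after n T L h) g"
  shows "acyclic (graph (forc_state_after n T L h) g)"
proof (cases h)
  case Nil
  then show ?thesis by (simp add: initial_state_def acyclic_def)
next
  case (Cons e h')
  then show ?thesis using assms eliminated_Cons_iff[of n T L e h' g] by fastforce
qed

section \<open>Analysis while the estimates are accurate\<close>

lemma remaining_products:
  fixes n j :: nat
  assumes "\<pi> permutes {1..n}" "1 \<le> j"
  shows "{1..n} - \<pi> ` {1..<j} = \<pi> ` {j..n}"
proof -
  have "\<pi> ` ({1..n} - {1..<j}) = \<pi> ` {1..n} - \<pi> ` {1..<j}"
    by (rule image_set_diff) (rule permutes_inj[OF assms(1)])
  moreover have "{1..n} - {1..<j} = {j..n}" using assms(2) by auto
  ultimately show ?thesis using permutes_image[OF assms(1)] by simp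
qed

lemma graph_rank_selectD:
  assumes "\<pi> \<in> graph_rank_select n \<eta> G" "acyclic G" "j \<in> {1..n}"
  shows "k \<in> \<pi> ` {j..n} \<Longrightarrow> k \<noteq> \<pi> j \<Longrightarrow> (\<pi> j, k) \<notin> G"
    and "i \<in> \<pi> ` {j..n} \<Longrightarrow> (\<And>k. k \<in> \<pi> ` {j..n} \<Longrightarrow> k \<noteq> i \<Longrightarrow> (i, k) \<notin> G) \<Longrightarrow> \<eta> (\<pi> j) \<le> \<eta> i"
proof -
  have perm: "\<pi> permutes {1..n}" using assms(1) by (simp add: graph_rank_select_def)
  have S: "{1..n} - \<pi> ` {1..<j} = \<pi> ` {j..n}"
    using remaining_products[OF perm] assms(3) by simp
  have *: "\<pi> j \<in> {i \<in> \<pi> ` {j..n}. \<forall>k\<in>\<pi> ` {j..n} - {i}. (i, k) \<notin> G} \<and>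
     (\<forall>i\<in>{i \<in> \<pi> ` {j..n}. \<forall>k\<in>\<pi> ` {j..n} - {i}. (i, k) \<notin> G}. \<eta> (\<pi> j) \<le> \<eta> i)"
    using assms unfolding graph_rank_select_def Let_def S[symmetric] by blast
  show "k \<in> \<pi> ` {j..n} \<Longrightarrow> k \<noteq> \<pi> j \<Longrightarrow> (\<pi> j, k) \<notin> G"
    using * by blast
  show "i \<in> \<pi> ` {j..n} \<Longrightarrow> (\<And>k. k \<in> \<pi> ` {j..n} \<Longrightarrow> k \<noteq> i \<Longrightarrow> (i, k) \<notin> G) \<Longrightarrow> \<eta> (\<pi> j) \<le> \<eta> i"
    using * by blast
qed

lemma prod_antimono:
  fixes f :: "'a \<Rightarrow> real"
  assumes "finite B" "A \<subseteq> B" "\<And>x. x \<in> B \<Longrightarrow> 0 \<le> f x \<and> f x \<le> 1"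
  shows "prod f B \<le> prod f A"
proof -
  have "prod f B = prod f A * prod f (B - A)"
    using prod.subset_diff[OF assms(2,1), of f] by (simp add: mult.commute)
  also have "\<dots> \<le> prod f A * 1"
    using assms by (intro mult_left_mono prod_le_1 prod_nonneg) auto
  finally show ?thesis by simp
qed

section \<open>Confidence radii and the edges they certify\<close>

locale forc_setting = cascade +
  fixes T L :: nat
  assumes T_ge: "2 \<le> T" and L_pos: "1 \<le> L" and L_le: "L \<le> T"
begin

abbreviation state :: "forc_history \<Rightarrow> forc_state" where
  "state h \<equiv> forc_state_after n T L h"

definition radius :: "real \<Rightarrow> real" where
  "radius m = sqrt (3 / 2 * (ln (4 * real n * real T / forc_delta n T) / m))
     + (ln (2 * real L / forc_delta n T) + 4) / m"

definition accurate :: "nat \<Rightarrow> forc_history \<Rightarrow> bool" where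
  "accurate l h \<longleftrightarrow> (\<forall>i\<in>{1..n}. mass h l i > 0 \<longrightarrow>
     \<bar>click_mass h l i / mass h l i - \<mu> i\<bar> \<le> radius (mass h l i))"

text \<open>As histories list the most recent round first, \<open>drop k h\<close> runs over all
  earlier histories. Accuracy is required at all of them because graphs keep the edges found in the
  past.\<close>

definition good :: "nat \<Rightarrow> forc_history \<Rightarrow> bool" where
  "good m h \<longleftrightarrow> (\<forall>k. \<forall>l\<in>{m..L}. accurate l (drop k h))"

text \<open>A mass above this makes the confidence radius smaller than an eighth of the gap
  \<open>D\<close>. With the constant 1600, the square root part of the radius is at most
  \<open>3 * D / 40\<close> and the additive part at most \<open>D / 160\<close>.\<close>

definition samples :: "nat \<Rightarrow> nat \<Rightarrow> real" where
  "samples b a = 1600 * ln (real n * real T) / (\<mu> b - \<mu> a)\<^sup>2"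

lemma good_tl: "good m (e # h) \<Longrightarrow> good m h"
  unfolding good_def by (metis drop_Suc_Cons)

lemma good_accurate: "good m h \<Longrightarrow> l \<in> {m..L} \<Longrightarrow> accurate l h"
  unfolding good_def by (metis drop0)

text \<open>The arguments of the two logarithms are \<open>4 * n ^ 4 * T ^ 2\<close> and
  \<open>2 * L * n ^ 3 * T\<close>. Constants are absorbed because \<open>\<Lambda>\<close> is at
  least \<open>ln 2\<close> and hence at least 2/3; in particular 4 is at most
  \<open>6 * \<Lambda>\<close>.\<close>

lemma log_bounds:
  defines "\<Lambda> \<equiv> ln (real n * real T)"
  shows "ln 2 \<le> \<Lambda>" "0 < \<Lambda>"
    "0 \<le> ln (4 * real n * real T / forc_delta n T)" "ln (4 * real n * real T / forc_delta n T) \<le> 6 * \<Lambda>"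
    "0 \<le> ln (2 * real L / forc_delta n T) + 4" "ln (2 * real L / forc_delta n T) + 4 \<le> 10 * \<Lambda>"
proof -
  have n1: "1 \<le> real n" and t2: "2 \<le> real T" using n_pos T_ge by auto
  have l1: "1 \<le> real L" "real L \<le> real T" using L_pos L_le by auto
  have "1 * 2 \<le> real n * real T" using n1 t2 by (intro mult_mono) auto
  then show L2: "ln 2 \<le> \<Lambda>" unfolding \<Lambda>_def by simp
  then show "0 < \<Lambda>" by (smt (verit) ln_gt_zero_iff)
  have Lam: "\<Lambda> = ln (real n) + ln (real T)" using n1 t2 by (simp add: \<Lambda>_def ln_mult)
  have nn: "0 \<le> ln (real n)" "0 \<le> ln (real T)" "0 \<le> ln (real L)" "ln (real L) \<le> ln (real T)"
    using n1 t2 l1 by auto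
  have ln2: "2 / 3 \<le> ln (2::real)" using ln2_ge_two_thirds .
  have e1: "4 * real n * real T / forc_delta n T = 2 ^ 2 * (real n ^ 4 * real T ^ 2)"
    by (simp add: forc_delta_def power_numeral_reduce)
  have e2: "2 * real L / forc_delta n T = 2 * (real L * (real n ^ 3 * real T))"
    by (simp add: forc_delta_def)
  have "ln (4 * real n * real T / forc_delta n T) = ln (2 ^ 2) + (ln (real n ^ 4) + ln (real T ^ 2))"
    unfolding e1 using n1 t2 by (subst ln_mult, simp, simp, subst ln_mult) auto
  also have "\<dots> = 2 * ln 2 + (4 * ln (real n) + 2 * ln (real T))"
    by (subst (1 2 3) ln_realpow) (use n1 t2 in auto)
  finally have A: "ln (4 * real n * real T / forc_delta n T) = 2 * ln 2 + (4 * ln (real n) + 2 * ln (real T))" .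
  have "ln (2 * real L / forc_delta n T) = ln 2 + (ln (real L) + (ln (real n ^ 3) + ln (real T)))"
    unfolding e2 using n1 t2 l1
    by (subst ln_mult, simp, simp, subst ln_mult, simp, simp, subst ln_mult) auto
  also have "\<dots> = ln 2 + (ln (real L) + (3 * ln (real n) + ln (real T)))"
    by (subst ln_realpow) (use n1 in auto)
  finally have B: "ln (2 * real L / forc_delta n T) = ln 2 + (ln (real L) + (3 * ln (real n) + ln (real T)))" .
  show "0 \<le> ln (4 * real n * real T / forc_delta n T)" unfolding A using nn ln2 by linarith
  show "ln (4 * real n * real T / forc_delta n T) \<le> 6 * \<Lambda>" unfolding A using nn ln2 L2 Lam by linarith
  show "0 \<le> ln (2 * real L / forc_delta n T) + 4" unfolding B using nn ln2 by linarith
  show "ln (2 * real L / forc_delta n T) + 4 \<le> 10 * \<Lambda>" unfolding B using nn ln2 L2 Lam by linarith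
qed

lemma radius_small:
  assumes "0 < D" "D \<le> 1" "1600 * ln (real n * real T) / D\<^sup>2 < m"
  shows "radius m < D / 8"
proof -
  define \<Lambda> where "\<Lambda> = ln (real n * real T)"
  note lb = log_bounds[folded \<Lambda>_def]
  have X: "0 < 1600 * \<Lambda> / D\<^sup>2" using lb assms(1) by simp
  then have m: "0 < m" using assms(3) unfolding \<Lambda>_def by linarith
  have lm: "\<Lambda> / m \<le> D\<^sup>2 / 1600"
    using assms m lb(2) by (simp add: \<Lambda>_def field_simps)
  have "3 / 2 * (ln (4 * real n * real T / forc_delta n T) / m) \<le> 3 / 2 * (6 * \<Lambda> / m)"
    using lb(4) m by (intro mult_left_mono divide_right_mono) auto
  also have "\<dots> = 9 * (\<Lambda> / m)" by simp
  also have "\<dots> \<le> 9 * (D\<^sup>2 / 1600)" using lm by linarith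
  also have "\<dots> = (3 * D / 40)\<^sup>2" by (simp add: power2_eq_square)
  finally have "sqrt (3 / 2 * (ln (4 * real n * real T / forc_delta n T) / m)) \<le> 3 * D / 40"
    using assms(1) real_sqrt_le_mono[of _ "(3 * D / 40)\<^sup>2"] by (simp add: real_le_lsqrt)
  moreover have "(ln (2 * real L / forc_delta n T) + 4) / m \<le> 10 * \<Lambda> / m"
    using lb(6) m by (intro divide_right_mono) auto
  moreover have "10 * \<Lambda> / m \<le> D / 160"
  proof -
    have "10 * \<Lambda> / m = 10 * (\<Lambda> / m)" by simp
    also have "\<dots> \<le> 10 * (D\<^sup>2 / 1600)" using lm by linarith
    also have "\<dots> \<le> D / 160" using assms(1,2) by (simp add: power2_eq_square)
    finally show ?thesis .
  qed
  ultimately show ?thesis unfolding radius_def using assms(1) by linarith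
qed

lemma width_eq_radius:
  "l \<in> {1..L} \<Longrightarrow> width n T L (state h) l i = radius (mass h l i)"
  by (simp add: width_def radius_def hats_state)

lemma new_edges_correct:
  assumes "l \<in> {1..L}" "accurate l h"
  shows "new_edges n T L (state h) l \<subseteq> {(i, j). i \<in> {1..n} \<and> j \<in> {1..n} \<and> \<mu> i < \<mu> j}"
proof safe
  fix i j assume "(i, j) \<in> new_edges n T L (state h) l"
  then have *: "i \<in> {1..n}" "j \<in> {1..n}" "mass h l i > 0" "mass h l j > 0"
    "click_mass h l i / mass h l i + radius (mass h l i) < click_mass h l j / mass h l j - radius (mass h l j)"
    using assms(1) by (auto simp: new_edges_def width_eq_radius hats_state)
  have "\<bar>click_mass h l i / mass h l i - \<mu> i\<bar> \<le> radius (mass h l i)"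
    "\<bar>click_mass h l j / mass h l j - \<mu> j\<bar> \<le> radius (mass h l j)"
    using * assms(2) by (auto simp: accurate_def)
  then show "\<mu> i < \<mu> j" using *(5) by (simp only: abs_le_iff) linarith
  show "i \<in> {1..n}" "j \<in> {1..n}" using * by auto
qed

text \<open>An edge needs two estimates separated by both radii, and each estimate may itself be off
  by its radius. Four radii below an eighth of the gap between \<open>b\<close> and \<open>a\<close>
  fit into half of that gap. The compared products \<open>i\<close> and \<open>j\<close> may be
  other ones than \<open>a\<close> and \<open>b\<close>.\<close>

lemma resolved_pair:
  assumes "l \<in> {1..L}" "accurate l h" "i \<in> {1..n}" "j \<in> {1..n}" "a \<in> {1..n}" "b \<in> {1..n}" "b < a"
    and "samples b a < mass h l i" "samples b a < mass h l j" "\<mu> i + (\<mu> b - \<mu> a) / 2 \<le> \<mu> j"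
  shows "(i, j) \<in> new_edges n T L (state h) l"
proof -
  define D where "D = \<mu> b - \<mu> a"
  have D: "0 < D" "D \<le> 1"
    using mu_decreasing[of b a] mu_range[of b] mu_range[of a] assms by (auto simp: D_def)
  have r: "radius (mass h l i) < D / 8" "radius (mass h l j) < D / 8"
    using assms(8,9) D by (intro radius_small; simp add: samples_def D_def)+
  have "0 < samples b a" using log_bounds(2) D(1) by (simp add: samples_def D_def)
  then have pos: "0 < mass h l i" "0 < mass h l j" using assms(8,9) by linarith+
  then have "\<bar>click_mass h l i / mass h l i - \<mu> i\<bar> \<le> radius (mass h l i)"
    "\<bar>click_mass h l j / mass h l j - \<mu> j\<bar> \<le> radius (mass h l j)"
    using assms by (auto simp: accurate_def)
  then have "click_mass h l i / mass h l i + radius (mass h l i) < click_mass h l j / mass h l j - radius (mass h l j)"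
    using r assms(10) unfolding D_def[symmetric] abs_le_iff by linarith
  then show ?thesis
    using assms pos by (auto simp: new_edges_def width_eq_radius hats_state)
qed

text \<open>Correct edges follow the strict order by click probability, so these graphs are acyclic;
  and a level is eliminated only by a cycle on its own or a higher level, all of which are at least
  \<open>m\<close> here.\<close>

lemma good_graph:
  assumes "1 \<le> m" "good m h" "l \<in> {m..L}"
  shows "\<not> eliminated (state h) l \<and>
    graph (state h) l \<subseteq> {(i, j). i \<in> {1..n} \<and> j \<in> {1..n} \<and> \<mu> i < \<mu> j}"
  using assms(2,3)
proof (induction h arbitrary: l)
  case (Cons e h)
  let ?R = "{(i, j). i \<in> {1..n} \<and> j \<in> {1..n} \<and> \<mu> i < \<mu> j}"
  have sub: "graph (state (e # h)) l \<subseteq> ?R" if l: "l \<in> {m..L}" for l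
  proof -
    have "graph (state h) l \<subseteq> ?R" using Cons.IH[OF good_tl] Cons.prems l by blast
    moreover have "new_edges n T L (state (e # h)) k \<subseteq> ?R" if "k \<in> {l..L}" for k
      using that l assms(1) good_accurate[OF Cons.prems(1), of k] by (intro new_edges_correct) auto
    ultimately show ?thesis unfolding graph_Cons by auto
  qed
  have "trans ?R" by (auto simp: trans_def)
  then have "acyclic ?R" by (auto simp: acyclic_def trancl_id)
  then have "acyclic (graph (state (e # h)) k)" if "k \<in> {l..L}" for k
    using sub[of k] that Cons.prems(2) by (auto intro: acyclic_subset)
  then show ?case
    using sub Cons.prems Cons.IH[OF good_tl[OF Cons.prems(1)] Cons.prems(2)]
    by (auto simp: eliminated_Cons_iff)
qed (simp add: initial_state_def)

lemma forc_rankings_permutes: "\<pi> \<in> forc_rankings n L s l \<Longrightarrow> \<pi> permutes {1..n}"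
  by (auto simp: forc_rankings_def graph_rank_select_def Let_def split: if_splits)

lemma good_rankings:
  assumes "1 \<le> m" "good m h" "l \<in> {m..L}" "\<pi> \<in> forc_rankings n L (state h) l"
  shows "\<pi> \<in> graph_rank_select n (exam_count h l) (graph (state h) l)"
proof -
  let ?live = "{g \<in> {l..L}. \<not> eliminated (state h) g}"
  have l: "l \<in> ?live" using good_graph[OF assms(1-3)] assms(3) by auto
  then have "Min ?live = l" by (intro Min_eqI) auto
  moreover have "eta (state h) l = exam_count h l" by (rule ext) (rule eta_state)
  ultimately show ?thesis
    using assms(4) l unfolding forc_rankings_def Let_def by (metis (lifting) empty_iff)
qed

text \<open>The graph used is that of the first live level from \<open>l\<close> on. As level
  \<open>m\<close> is live, this level is at most \<open>m\<close>, and lower live graphs contain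
  higher ones.\<close>

lemma nonrobust_rankings:
  assumes "1 \<le> m" "m \<le> L" "good m h" "l \<in> {1..<m}" "\<pi> \<in> forc_rankings n L (state h) l"
  obtains G where "acyclic G" "graph (state h) m \<subseteq> G" "\<pi> \<in> graph_rank_select n (exam_count h l) G"
proof -
  let ?live = "{g \<in> {l..L}. \<not> eliminated (state h) g}"
  have m: "m \<in> ?live" using good_graph[OF assms(1,3), of m] assms by auto
  have "Min ?live \<in> ?live" by (rule Min_in) (use m in auto)
  moreover have "Min ?live \<le> m" using m by (intro Min_le) auto
  ultimately have *: "Min ?live \<le> m" "\<not> eliminated (state h) (Min ?live)" "Min ?live \<le> L" by auto
  have "eta (state h) l = exam_count h l" by (rule ext) (rule eta_state)
  then have "\<pi> \<in> graph_rank_select n (exam_count h l) (graph (state h) (Min ?live))"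
    using assms(5) m unfolding forc_rankings_def Let_def by (metis (lifting) empty_iff)
  with * m show thesis
    by (intro that[of "graph (state h) (Min ?live)"] acyclic_graph graph_antimono) auto
qed

text \<open>Correct edges lead to better products, so the best remaining product \<open>b\<close>
  has no outgoing edge and was a candidate for the position given to \<open>a\<close>. With both
  counts large, the edge from \<open>a\<close> to \<open>b\<close> would have excluded
  \<open>a\<close>.\<close>

lemma robust_charge:
  assumes "1 \<le> m" "good m h" "l \<in> {m..L}" "\<pi> \<in> forc_rankings n L (state h) l"
    and "a \<in> {1..n}" "b = best_left \<pi> (inv \<pi> a)" "b < a"
  shows "real (exam_count h l a) \<le> samples b a"
proof (rule ccontr)
  assume neg: "\<not> ?thesis"
  have perm: "\<pi> permutes {1..n}" by (rule forc_rankings_permutes[OF assms(4)])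
  let ?j = "inv \<pi> a" and ?G = "graph (state h) l"
  have j: "?j \<in> {1..n}" "\<pi> ?j = a" using inv_in[OF perm assms(5)] permutes_inverses(1)[OF perm] by auto
  have G: "\<not> eliminated (state h) l" "?G \<subseteq> {(i, j). i \<in> {1..n} \<and> j \<in> {1..n} \<and> \<mu> i < \<mu> j}"
    using good_graph[OF assms(1-3)] by auto
  have ac: "acyclic ?G" using G assms(3) by (intro acyclic_graph) auto
  note sel = graph_rank_selectD[OF good_rankings[OF assms(1-4)] ac j(1), unfolded j(2)]
  have b: "b \<in> \<pi> ` {?j..n}" "\<And>i. i \<in> \<pi> ` {?j..n} \<Longrightarrow> b \<le> i"
    using best_left[OF perm j(1)] assms(6) by auto
  have b1: "b \<in> {1..n}" using b(1) permutes_in_image[OF perm] j(1) by fastforce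
  have le: "exam_count h l a \<le> exam_count h l b"
  proof (rule sel(2)[OF b(1)])
    fix k assume k: "k \<in> \<pi> ` {?j..n}" "k \<noteq> b"
    show "(b, k) \<notin> ?G"
    proof
      assume "(b, k) \<in> ?G"
      then have "k \<in> {1..n}" "\<mu> b < \<mu> k" using G(2) by auto
      then show False using mu_antimono[OF b1, of k] b(2)[OF k(1)] by simp
    qed
  qed
  have "(a, b) \<in> new_edges n T L (state h) l"
  proof (rule resolved_pair)
    show "accurate l h" by (rule good_accurate[OF assms(2,3)])
    show "samples b a < mass h l a" "samples b a < mass h l b"
      using neg le count_le_mass[of h l a] count_le_mass[of h l b] by linarith+
    show "\<mu> a + (\<mu> b - \<mu> a) / 2 \<le> \<mu> b" using mu_antimono[OF b1 assms(5)] assms(7) by (simp add: field_simps)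
  qed (use assms b1 in auto)
  then have "(a, b) \<in> ?G" using new_edges_subset_graph[OF _ G(1)] assms by auto
  then show False using sel(1)[OF b(1)] assms(7) by auto
qed

text \<open>Non-click factors belong to products and exit factors to positions. The inclusion gives
  fewer non-click factors for \<open>\<sigma>\<close> and, by cardinality, also a smaller or equal
  position and hence no more exit factors.\<close>

lemma reach_mono:
  assumes perm: "\<pi> permutes {1..n}" "\<sigma> permutes {1..n}" and j: "j \<in> {1..n}" and k: "k \<in> {1..n}"
    and sub: "\<sigma> ` {1..<k} \<subseteq> \<pi> ` {1..<j}"
  shows "reach_from \<pi> 1 j \<le> reach_from \<sigma> 1 k"
proof -
  have inj: "inj_on \<pi> A" "inj_on \<sigma> A" for A
    using permutes_inj[OF perm(1)] permutes_inj[OF perm(2)] by (auto intro: inj_on_subset)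
  have "card (\<sigma> ` {1..<k}) \<le> card (\<pi> ` {1..<j})" by (rule card_mono[OF _ sub]) auto
  then have "k - 1 \<le> j - 1" by (simp add: card_image[OF inj(1)] card_image[OF inj(2)])
  then have kj: "k \<le> j" using j k by auto
  have rng: "0 \<le> 1 - \<mu> x \<and> 1 - \<mu> x \<le> 1" if "x \<in> \<pi> ` {1..<j}" for x
  proof -
    have "x \<in> {1..n}" using that permutes_in_image[OF perm(1)] j by fastforce
    then show ?thesis using mu_range[of x] by auto
  qed
  have "reach_from \<pi> 1 j = prod (\<lambda>x. 1 - \<mu> x) (\<pi> ` {1..<j}) * prod survive {1..<j}"
    by (simp add: reach_from_def prod.distrib prod.reindex[OF inj(1)])
  also have "\<dots> \<le> prod (\<lambda>x. 1 - \<mu> x) (\<sigma> ` {1..<k}) * prod survive {1..<k}"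
  proof (rule mult_mono)
    show "prod (\<lambda>x. 1 - \<mu> x) (\<pi> ` {1..<j}) \<le> prod (\<lambda>x. 1 - \<mu> x) (\<sigma> ` {1..<k})"
      using sub rng by (intro prod_antimono) auto
    show "prod survive {1..<j} \<le> prod survive {1..<k}"
      using kj survive_bounds by (intro prod_antimono) auto
    show "0 \<le> prod (\<lambda>x. 1 - \<mu> x) (\<sigma> ` {1..<k})" using sub rng by (intro prod_nonneg) auto
    show "0 \<le> prod survive {1..<j}" using survive_bounds by (intro prod_nonneg) auto
  qed
  also have "\<dots> = reach_from \<sigma> 1 k"
    by (simp add: reach_from_def prod.distrib prod.reindex[OF inj(2)])
  finally show ?thesis .
qed

text \<open>If the loss of \<open>\<pi>\<close> at \<open>a\<close> cannot be charged to \<open>a\<close> itself, it is charged to the first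
  product \<open>c\<close> of the ranking \<open>\<sigma>\<close> of level \<open>m\<close> that \<open>\<pi>\<close> does not rank above \<open>a\<close>: were \<open>c\<close> well
  explored, it would be nearly as good as \<open>b\<close>, and then level \<open>m\<close> would know that \<open>a\<close> is worse
  than \<open>c\<close>.\<close>

lemma nonrobust_charge:
  assumes "1 \<le> m" "m \<le> L" "good m h" "l \<in> {1..<m}"
    and pi: "\<pi> \<in> forc_rankings n L (state h) l" and sigma: "\<sigma> \<in> forc_rankings n L (state h) m"
    and a: "a \<in> {1..n}" and b_def: "b = best_left \<pi> (inv \<pi> a)" and "b < a"
    and low: "2 ^ m * samples b a < (\<Sum>g=1..<m. real (exam_count h g a))"
  shows "\<exists>c\<in>{1..n}. real (exam_count h m c) \<le> samples b a \<and> reach \<pi> a \<le> reach \<sigma> c"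
proof -
  have perm: "\<pi> permutes {1..n}" "\<sigma> permutes {1..n}"
    using forc_rankings_permutes pi sigma by auto
  obtain G where G: "acyclic G" "graph (state h) m \<subseteq> G" "\<pi> \<in> graph_rank_select n (exam_count h l) G"
    using nonrobust_rankings[OF assms(1-4) pi] .
  let ?j = "inv \<pi> a" and ?H = "graph (state h) m"
  define S where "S = \<pi> ` {?j..n}"
  have j: "?j \<in> {1..n}" "\<pi> ?j = a" using inv_in[OF perm(1) a] permutes_inverses(1)[OF perm(1)] by auto
  note selG = graph_rank_selectD(1)[OF G(3,1) j(1), unfolded j(2), folded S_def]
  have aS: "a \<in> S" unfolding S_def using j by (intro image_eqI[of _ _ ?j]) auto
  have b: "b \<in> S" "\<And>i. i \<in> S \<Longrightarrow> b \<le> i"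
    using best_left[OF perm(1) j(1)] b_def by (auto simp: S_def)
  have Sn: "S = {1..n} - \<pi> ` {1..<?j}" using remaining_products[OF perm(1)] j(1) by (simp add: S_def)
  have b1: "b \<in> {1..n}" using b(1) Sn by auto
  \<comment> \<open>The position of \<open>a\<close> in \<open>\<sigma>\<close> is a witness, so the
    minimum exists and is at most \<open>n\<close>.\<close>
  define k where "k = (LEAST k. 1 \<le> k \<and> \<sigma> k \<in> S)"
  have ka: "1 \<le> inv \<sigma> a \<and> \<sigma> (inv \<sigma> a) \<in> S"
    using inv_in[OF perm(2) a] permutes_inverses(1)[OF perm(2)] aS by auto
  have k: "1 \<le> k" "\<sigma> k \<in> S"
    using LeastI[of "\<lambda>k. 1 \<le> k \<and> \<sigma> k \<in> S", OF ka] by (auto simp: k_def)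
  have "k \<le> inv \<sigma> a" unfolding k_def by (rule Least_le) (rule ka)
  then have kn: "k \<in> {1..n}" using inv_in[OF perm(2) a] k(1) by auto
  have before: "\<sigma> i \<notin> S" if "i \<in> {1..<k}" for i
    using not_less_Least[of i "\<lambda>k. 1 \<le> k \<and> \<sigma> k \<in> S"] that by (auto simp: k_def)
  have sub: "\<sigma> ` {1..<k} \<subseteq> \<pi> ` {1..<?j}"
  proof
    fix x assume x: "x \<in> \<sigma> ` {1..<k}"
    then have "x \<notin> S" using before by auto
    moreover have "x \<in> {1..n}" using x permutes_in_image[OF perm(2)] kn by fastforce
    ultimately show "x \<in> \<pi> ` {1..<?j}" using Sn by auto
  qed
  define c where "c = \<sigma> k"
  have cS: "c \<in> S" and c1: "c \<in> {1..n}" using k(2) Sn by (auto simp: c_def)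
  have "inv \<sigma> c = k" by (simp add: c_def permutes_inverses(2)[OF perm(2)])
  then have reach: "reach \<pi> a \<le> reach \<sigma> c"
    using reach_mono[OF perm j(1) kn sub] by (simp add: reach_def)
  have "real (exam_count h m c) \<le> samples b a"
  proof (rule ccontr)
    assume neg: "\<not> ?thesis"
    have mm: "m \<in> {m..L}" "m \<in> {1..L}" using assms(1,2) by auto
    have acc: "accurate m h" by (rule good_accurate[OF assms(3) mm(1)])
    have H: "\<not> eliminated (state h) m" "?H \<subseteq> {(i, j). i \<in> {1..n} \<and> j \<in> {1..n} \<and> \<mu> i < \<mu> j}"
      using good_graph[OF assms(1,3) mm(1)] by auto
    have acH: "acyclic ?H" using H assms(2) by (intro acyclic_graph) auto
    have known: "new_edges n T L (state h) m \<subseteq> ?H" using new_edges_subset_graph[OF mm(2) H(1)] .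
    note selH = graph_rank_selectD[OF good_rankings[OF assms(1,3) mm(1) sigma] acH kn, folded c_def]
    \<comment> \<open>The product \<open>b\<close> is still available at position \<open>k\<close>
      of \<open>\<sigma>\<close>, so the best available product \<open>b'\<close> there is at least
      as good.\<close>
    define b' where "b' = best_left \<sigma> k"
    have b': "b' \<in> \<sigma> ` {k..n}" "\<And>i. i \<in> \<sigma> ` {k..n} \<Longrightarrow> b' \<le> i"
      using best_left[OF perm(2) kn] by (auto simp: b'_def)
    have S': "\<sigma> ` {k..n} = {1..n} - \<sigma> ` {1..<k}" using remaining_products[OF perm(2) k(1)] by simp
    have b'1: "b' \<in> {1..n}" using b'(1) S' by auto
    have "b \<in> \<sigma> ` {k..n}" unfolding S' using b(1) b1 before by auto
    then have "b' \<le> b" by (rule b'(2))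
    then have mu_b: "\<mu> b \<le> \<mu> b'" by (rule mu_antimono[OF b'1 b1])
    have le: "exam_count h m c \<le> exam_count h m b'"
    proof (rule selH(2)[OF b'(1)])
      fix i assume i: "i \<in> \<sigma> ` {k..n}" "i \<noteq> b'"
      show "(b', i) \<notin> ?H"
      proof
        assume "(b', i) \<in> ?H"
        then have "i \<in> {1..n}" "\<mu> b' < \<mu> i" using H(2) by auto
        then show False using mu_antimono[OF b'1, of i] b'(2)[OF i(1)] by simp
      qed
    qed
    have mc: "samples b a < mass h m c" "samples b a < mass h m b'"
      using neg le count_le_mass[of h m c] count_le_mass[of h m b'] by linarith+
    \<comment> \<open>The examinations of \<open>a\<close> below level \<open>m\<close> enter the
      mass of level \<open>m\<close> with weight \<open>1 / 2 ^ m\<close>; this explains the factor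
      in the hypothesis.\<close>
    have ma: "samples b a < mass h m a"
    proof -
      have "2 ^ m * samples b a < 2 ^ m * mass h m a"
        using low lower_counts_le_mass[of h a m] by linarith
      then show ?thesis by simp
    qed
    have Dpos: "\<mu> a < \<mu> b" by (rule mu_decreasing[OF b1 a \<open>b < a\<close>])
    \<comment> \<open>Otherwise level \<open>m\<close> would have the edge from \<open>c\<close> to
      \<open>b'\<close> and could not have selected \<open>c\<close>. Half of the gap is left to
      separate \<open>a\<close> from \<open>c\<close>, and the edge found there belongs to the
      larger graph used for \<open>\<pi>\<close>.\<close>
    have close: "\<mu> b' < \<mu> c + (\<mu> b - \<mu> a) / 2"
    proof (rule ccontr)
      assume "\<not> ?thesis"
      then have far: "\<mu> c + (\<mu> b - \<mu> a) / 2 \<le> \<mu> b'" by simp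
      then have "b' \<noteq> c" using Dpos by auto
      moreover have "(c, b') \<in> ?H"
        using resolved_pair[OF mm(2) acc c1 b'1 a b1 \<open>b < a\<close> mc far] known by blast
      ultimately show False using selH(1)[OF b'(1)] by blast
    qed
    then have "\<mu> a + (\<mu> b - \<mu> a) / 2 \<le> \<mu> c" using mu_b by (simp add: field_simps)
    then have "(a, c) \<in> new_edges n T L (state h) m" "c \<noteq> a"
      using resolved_pair[OF mm(2) acc a c1 a b1 \<open>b < a\<close> ma mc(1)] Dpos by auto
    then show False using known G(2) selG[OF cS] by blast
  qed
  then show ?thesis using c1 reach by auto
qed

end

section \<open>Expectations over the interaction\<close>

definition platform_history :: "('r \<times> event) list \<Rightarrow> ('r \<times> ranking \<times> observation) list" where
  "platform_history h = map (\<lambda>(x, \<pi>, f, c). (x, \<pi>, c)) h"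

lemma platform_history_simps [simp]:
  "platform_history [] = []"
  "platform_history ((x, \<pi>, f, c) # h) = (x, \<pi>, c) # platform_history h"
  "platform_history (drop k h) = drop k (platform_history h)"
  by (simp_all add: platform_history_def drop_map)

lemma num_fakes_simps [simp]:
  "num_fakes [] = 0"
  "num_fakes ((\<pi>, f, c) # h) = of_bool f + num_fakes h"
  by (simp_all add: num_fakes_def)

lemma finite_actions: "finite (actions n)"
  by (simp add: actions_def)

text \<open>Hoeffding's lemma for a centred Bernoulli variable. \<open>Hoeffdings_lemma_aux\<close>
  is applied to nonnegative \<open>h\<close>; the other sign follows by exchanging success and
  failure.\<close>

lemma Hoeffding_bernoulli:
  fixes p h :: real
  assumes "0 \<le> p" "p \<le> 1"
  shows "p * exp (h * (1 - p)) + (1 - p) * exp (- (h * p)) \<le> exp (h\<^sup>2 / 8)"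
proof -
  have pos: "p * exp (h * (1 - p)) + (1 - p) * exp (- (h * p)) \<le> exp (h\<^sup>2 / 8)"
    if "0 \<le> h" "0 \<le> p" "p \<le> 1" for p h :: real
  proof -
    have "0 \<le> p * (exp h - 1)" using that by simp
    then have one: "0 < 1 + p * (exp h - 1)" by linarith
    have "p * exp (h * (1 - p)) + (1 - p) * exp (- (h * p)) = exp (- h * p) * (1 + p * (exp h - 1))"
      by (simp add: algebra_simps exp_diff exp_minus)
         (simp add: field_simps exp_diff exp_minus exp_add[symmetric])
    also have "\<dots> = exp (- h * p + ln (1 + p * (exp h - 1)))"
      unfolding exp_add using one by simp
    also have "\<dots> \<le> exp (h\<^sup>2 / 8)"
      using Hoeffdings_lemma_aux[OF that(1,2)] by simp
    finally show ?thesis .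
  qed
  show ?thesis
  proof (cases "0 \<le> h")
    case False
    then show ?thesis using pos[of "- h" "1 - p"] assms by (simp add: algebra_simps)
  qed (use pos assms in auto)
qed

text \<open>The platform is kept abstract because both FORC and the platform that always shows the
  optimal ranking are instances. Finite supports make every function of a run integrable.\<close>

locale play = cascade +
  fixes T F :: nat and P :: policy and A :: "'r platform"
  assumes P_policy: "P \<in> policies n T F"
    and A_finite: "\<And>h. finite (set_pmf (A h))"
    and A_permutes: "\<And>h x \<pi>. (x, \<pi>) \<in> set_pmf (A h) \<Longrightarrow> \<pi> permutes {1..n}"
begin

abbreviation rounds :: "nat \<Rightarrow> ('r \<times> event) list pmf" where
  "rounds t \<equiv> run n \<mu> q P A t"

lemma set_P: "set_pmf (P h) \<subseteq> actions n"
  using P_policy by (simp add: policies_def)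

lemma finite_P: "finite (set_pmf (P h))"
  using set_P finite_actions finite_subset by blast

lemma run_Suc:
  "rounds (Suc t) = rounds t \<bind> (\<lambda>h. P (map snd h) \<bind> (\<lambda>a. A (platform_history h) \<bind>
     (\<lambda>y. response n \<mu> q (snd y) a \<bind> (\<lambda>c. return_pmf ((fst y, snd y, a \<noteq> Real_User, c) # h)))))"
  by (simp add: platform_history_def case_prod_beta')

lemma set_run_Suc:
  "set_pmf (rounds (Suc t)) = (\<Union>h\<in>set_pmf (rounds t). \<Union>a\<in>set_pmf (P (map snd h)).
     \<Union>y\<in>set_pmf (A (platform_history h)). \<Union>c\<in>set_pmf (response n \<mu> q (snd y) a).
       {(fst y, snd y, a \<noteq> Real_User, c) # h})"
  unfolding run_Suc by (simp add: set_bind_pmf)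

lemma finite_run: "finite (set_pmf (rounds t))"
proof (induction t)
  case (Suc t)
  then show ?case unfolding set_run_Suc
    using finite_P A_finite finite_response by (intro finite_UN_I) auto
qed simp

lemma expect_run_Suc:
  "expect (rounds (Suc t)) f = expect (rounds t) (\<lambda>h. expect (P (map snd h)) (\<lambda>a.
     expect (A (platform_history h)) (\<lambda>y. expect (response n \<mu> q (snd y) a)
       (\<lambda>c. f ((fst y, snd y, a \<noteq> Real_User, c) # h)))))"
  unfolding run_Suc using finite_run finite_P A_finite finite_response
  by (simp add: expect_bind set_bind_pmf)

lemma length_run: "h \<in> set_pmf (rounds t) \<Longrightarrow> length h = t"
proof (induction t arbitrary: h)
  case (Suc t)
  then show ?case unfolding set_run_Suc by auto
qed simp

lemma possible_run: "h \<in> set_pmf (rounds t) \<Longrightarrow> possible_history n P (map snd h)"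
proof (induction t arbitrary: h)
  case (Suc t)
  then obtain h' a y c where h: "h' \<in> set_pmf (rounds t)" "a \<in> set_pmf (P (map snd h'))"
    "y \<in> set_pmf (A (platform_history h'))" "c \<in> set_pmf (response n \<mu> q (snd y) a)"
    "h = (fst y, snd y, a \<noteq> Real_User, c) # h'"
    unfolding set_run_Suc by blast
  have "snd y permutes {1..n}" using A_permutes[of "fst y" "snd y"] h(3) by simp
  moreover have "c \<in> possible_responses n (snd y) a" using set_response h(4) by blast
  ultimately show ?case using Suc.IH[OF h(1)] h(2) by (auto simp: h(5))
qed simp

lemma possible_responses_nonempty: "\<exists>c. c \<in> possible_responses n \<pi> a"
  using n_pos by (cases a) (auto intro!: exI[of _ "None"] exI[of _ "1::nat"])

text \<open>The budget constrains complete histories only, but every history can be completed.\<close>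

lemma num_fakes_le:
  assumes "possible_history n P h" "length h \<le> T"
  shows "num_fakes h \<le> F"
  using assms
proof (induction "T - length h" arbitrary: h)
  case 0
  then show ?case using P_policy by (auto simp: policies_def)
next
  case (Suc k)
  obtain a where a: "a \<in> set_pmf (P h)" using set_pmf_not_empty by fast
  obtain c where c: "c \<in> possible_responses n id a" using possible_responses_nonempty by blast
  have "possible_history n P ((id, a \<noteq> Real_User, c) # h)"
    using Suc.prems(1) a c by (auto simp: permutes_id)
  then have "num_fakes ((id, a \<noteq> Real_User, c) # h) \<le> F"
    using Suc.hyps(2) by (intro Suc.hyps(1)) auto
  then show ?case by simp
qed

lemma num_fakes_run: "h \<in> set_pmf (rounds t) \<Longrightarrow> t \<le> T \<Longrightarrow> num_fakes (map snd h) \<le> F"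
  using num_fakes_le[OF possible_run, of h t] length_run[of h t] by simp

definition real_rounds_sum :: "(ranking \<Rightarrow> real) \<Rightarrow> ('r \<times> event) list \<Rightarrow> real" where
  "real_rounds_sum w h = (\<Sum>(x, \<pi>, f, c)\<leftarrow>h. if f then 0 else w \<pi>)"

lemma real_rounds_sum_simps [simp]:
  "real_rounds_sum w [] = 0"
  "real_rounds_sum w ((x, \<pi>, f, c) # h) = (if f then 0 else w \<pi>) + real_rounds_sum w h"
  by (simp_all add: real_rounds_sum_def)

text \<open>Given the past and the ranking, a real round is clicked with probability
  \<open>win\<close>, so the difference of the two sums is a martingale.\<close>

lemma expected_real_clicks_eq:
  "expected_real_clicks n \<mu> q P A t = expect (rounds t) (real_rounds_sum win)"
proof -
  have "expect (rounds t) (\<lambda>h. real (real_clicks h) - real_rounds_sum win h) = 0"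
  proof (induction t)
    case 0
    then show ?case by (simp add: real_clicks_def)
  next
    case (Suc t)
    have inner: "expect (response n \<mu> q (snd y) a)
        (\<lambda>c. real (real_clicks ((fst y, snd y, a \<noteq> Real_User, c) # h))
          - real_rounds_sum win ((fst y, snd y, a \<noteq> Real_User, c) # h))
      = real (real_clicks h) - real_rounds_sum win h"
      if y: "y \<in> set_pmf (A (platform_history h))" for h y a
    proof -
      have perm: "snd y permutes {1..n}" using A_permutes[of "fst y" "snd y"] y by simp
      show ?thesis
      proof (cases "a = Real_User")
        case True
        have "expect (real_customer n \<mu> q (snd y)) (\<lambda>c. of_bool (fst c \<noteq> None)
          + (real (real_clicks h) - win (snd y) - real_rounds_sum win h)) =
          win (snd y) + (real (real_clicks h) - win (snd y) - real_rounds_sum win h)"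
          using finite_response[of "snd y" Real_User] expect_click[OF perm]
          by (subst expect_add) auto
        moreover have "expect (response n \<mu> q (snd y) a)
            (\<lambda>c. real (real_clicks ((fst y, snd y, a \<noteq> Real_User, c) # h))
              - real_rounds_sum win ((fst y, snd y, a \<noteq> Real_User, c) # h)) =
          expect (real_customer n \<mu> q (snd y)) (\<lambda>c. of_bool (fst c \<noteq> None)
            + (real (real_clicks h) - win (snd y) - real_rounds_sum win h))"
          unfolding True response.simps
          by (intro expect_cong) (auto simp: real_clicks_def)
        ultimately show ?thesis by simp
      qed (simp add: real_clicks_def)
    qed
    have "expect (rounds (Suc t)) (\<lambda>h. real (real_clicks h) - real_rounds_sum win h) =
      expect (rounds t) (\<lambda>h. expect (P (map snd h)) (\<lambda>a.
        expect (A (platform_history h)) (\<lambda>y. real (real_clicks h) - real_rounds_sum win h)))"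
      unfolding expect_run_Suc by (intro expect_cong inner)
    then show ?case using Suc by simp
  qed
  then show ?thesis
    unfolding expected_real_clicks_def by (simp add: expect_diff[OF finite_run])
qed

text \<open>The product is a supermartingale. The condition fixes the action and averages over the
  platform's choice, as the two are independent given the past; since it covers every action and
  history, adaptive policies are included.\<close>

lemma expect_prod_le_one:
  fixes g :: "'r \<times> event \<Rightarrow> real"
  assumes nonneg: "\<And>e. 0 \<le> g e"
    and step: "\<And>h a. a \<in> actions n \<Longrightarrow> expect (A h) (\<lambda>y. expect (response n \<mu> q (snd y) a)
       (\<lambda>c. g (fst y, snd y, a \<noteq> Real_User, c))) \<le> 1"
  shows "expect (rounds t) (\<lambda>h. prod_list (map g h)) \<le> 1"
proof (induction t)
  case (Suc t)
  have "expect (rounds (Suc t)) (\<lambda>h. prod_list (map g h)) =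
    expect (rounds t) (\<lambda>h. expect (P (map snd h)) (\<lambda>a.
      expect (A (platform_history h)) (\<lambda>y. expect (response n \<mu> q (snd y) a)
       (\<lambda>c. g (fst y, snd y, a \<noteq> Real_User, c)))) * prod_list (map g h))"
    unfolding expect_run_Suc by simp
  also have "\<dots> \<le> expect (rounds t) (\<lambda>h. prod_list (map g h))"
  proof (rule expect_mono[OF finite_run])
    fix h
    have "expect (P (map snd h)) (\<lambda>a.
      expect (A (platform_history h)) (\<lambda>y. expect (response n \<mu> q (snd y) a)
       (\<lambda>c. g (fst y, snd y, a \<noteq> Real_User, c)))) \<le> 1"
      using set_P by (intro expect_le_const finite_P step) blast
    moreover have "0 \<le> prod_list (map g h)" by (rule prod_list_nonneg) (use nonneg in auto)
    ultimately show "expect (P (map snd h)) (\<lambda>a.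
      expect (A (platform_history h)) (\<lambda>y. expect (response n \<mu> q (snd y) a)
       (\<lambda>c. g (fst y, snd y, a \<noteq> Real_User, c)))) * prod_list (map g h) \<le> prod_list (map g h)"
      using mult_right_mono[of _ 1 "prod_list (map g h)"] by simp
  qed
  finally show ?case using Suc by simp
qed simp

lemma expect_run_tl: "expect (rounds (Suc t)) (\<lambda>h. f (tl h)) = expect (rounds t) f"
  unfolding expect_run_Suc by simp

end

lemma prod_list_exp: "prod_list (map (\<lambda>e. exp (z e :: real)) h) = exp (\<Sum>e\<leftarrow>h. z e)"
  by (induction h) (auto simp: exp_add)

section \<open>Concentration of the estimates\<close>

locale forc_play = forc_setting +
  fixes F :: nat and P :: policy and choice :: "forc_history \<Rightarrow> nat \<Rightarrow> ranking pmf"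
  assumes F_policy: "P \<in> policies n T F"
    and choice: "\<And>h l. l \<in> {1..L} \<Longrightarrow> set_pmf (choice h l) \<subseteq> forc_rankings n L (forc_state_after n T L h) l"
begin

definition A :: "nat platform" where
  "A = (\<lambda>h. do { l \<leftarrow> level_pmf L; \<pi> \<leftarrow> choice h l; return_pmf (l, \<pi>) })"

lemma set_level_pmf: "set_pmf (level_pmf L) \<subseteq> {1..L}"
proof
  fix l assume "l \<in> set_pmf (level_pmf L)"
  then have "level_prob L l \<noteq> 0" by (simp add: set_pmf_iff pmf_level_pmf)
  then show "l \<in> {1..L}" using L_pos by (auto simp: level_prob_def split: if_splits)
qed

lemma finite_level: "finite (set_pmf (level_pmf L))"
  using set_level_pmf finite_subset by blast

lemma finite_choice: "l \<in> {1..L} \<Longrightarrow> finite (set_pmf (choice h l))"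
proof (rule finite_subset)
  show "finite {\<pi>. \<pi> permutes {1..n}}" by (rule finite_permutations) simp
  show "l \<in> {1..L} \<Longrightarrow> set_pmf (choice h l) \<subseteq> {\<pi>. \<pi> permutes {1..n}}"
    using choice[of l h] forc_rankings_permutes by blast
qed

lemma set_A: "set_pmf (A h) = (\<Union>l\<in>set_pmf (level_pmf L). \<Union>\<pi>\<in>set_pmf (choice h l). {(l, \<pi>)})"
  by (simp add: A_def set_bind_pmf)

lemma expect_A: "expect (A h) f = expect (level_pmf L) (\<lambda>l. expect (choice h l) (\<lambda>\<pi>. f (l, \<pi>)))"
proof -
  have fin: "finite (set_pmf (choice h l))" if "l \<in> set_pmf (level_pmf L)" for l
    using that set_level_pmf finite_choice by blast
  have "expect (A h) f = expect (level_pmf L) (\<lambda>l. expect (choice h l \<bind> (\<lambda>\<pi>. return_pmf (l, \<pi>))) f)"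
    unfolding A_def using finite_level fin by (intro expect_bind) (auto simp: set_bind_pmf)
  also have "\<dots> = expect (level_pmf L) (\<lambda>l. expect (choice h l) (\<lambda>\<pi>. f (l, \<pi>)))"
    using fin by (intro expect_cong) (simp add: expect_bind)
  finally show ?thesis .
qed

sublocale play n \<mu> q T F P A
proof
  show "P \<in> policies n T F" by (rule F_policy)
  show "finite (set_pmf (A h))" for h
    unfolding set_A using finite_level set_level_pmf finite_choice
    by (intro finite_UN_I) auto
  show "\<pi> permutes {1..n}" if "(x, \<pi>) \<in> set_pmf (A h)" for h x \<pi>
    using that set_level_pmf choice forc_rankings_permutes unfolding set_A by blast
qed

section \<open>Estimation error as martingale noise plus fake weight\<close>

definition noise :: "(nat \<times> event) list \<Rightarrow> nat \<Rightarrow> nat \<Rightarrow> real" where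
  "noise h l i = (\<Sum>(l', \<pi>, f, c)\<leftarrow>h. level_weight l l' * of_bool (\<not> f \<and> i \<in> examined \<pi> c) *
     (of_bool (fst c = Some i) - \<mu> i))"

definition fake_mass :: "(nat \<times> event) list \<Rightarrow> nat \<Rightarrow> real" where
  "fake_mass h l = (\<Sum>(l', \<pi>, f, c)\<leftarrow>h. level_weight l l' * of_bool f)"

definition level_fakes :: "(nat \<times> event) list \<Rightarrow> nat \<Rightarrow> nat" where
  "level_fakes h l = length (filter (\<lambda>(l', \<pi>, f, c). l' = l \<and> f) h)"

lemma noise_simps [simp]:
  "noise [] l i = 0"
  "noise ((l', \<pi>, f, c) # h) l i = level_weight l l' * of_bool (\<not> f \<and> i \<in> examined \<pi> c) *
     (of_bool (fst c = Some i) - \<mu> i) + noise h l i"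
  by (simp_all add: noise_def)

lemma fake_mass_simps [simp]:
  "fake_mass [] l = 0"
  "fake_mass ((l', \<pi>, f, c) # h) l = level_weight l l' * of_bool f + fake_mass h l"
  by (simp_all add: fake_mass_def)

lemma level_fakes_simps [simp]:
  "level_fakes [] l = 0"
  "level_fakes ((l', \<pi>, f, c) # h) l = of_bool (l' = l \<and> f) + level_fakes h l"
  by (simp_all add: level_fakes_def)

text \<open>A real round contributes exactly its noise term. In a fake round the click indicator is
  arbitrary, but it differs from the click probability by at most 1, so the error is at most the
  weight of the round.\<close>

lemma estimation_error:
  assumes "i \<in> {1..n}"
  shows "\<bar>click_mass (platform_history h) l i - \<mu> i * mass (platform_history h) l i - noise h l i\<bar>
    \<le> fake_mass h l"
proof (induction h)
  case (Cons e h)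
  obtain l' \<pi> f c where e: "e = (l', \<pi>, f, c)" by (cases e)
  have mu: "0 \<le> \<mu> i" "\<mu> i \<le> 1" using mu_range[OF assms] by auto
  define w x k where "w = level_weight l l'" and "x = (of_bool (i \<in> examined \<pi> c) :: real)"
    and "k = (of_bool (fst c = Some i) :: real)"
  have w: "0 \<le> w" by (simp add: w_def level_weight_bounds)
  have xk: "\<bar>x * (k - \<mu> i)\<bar> \<le> 1" using mu by (auto simp: x_def k_def)
  have "\<bar>w * x * k - \<mu> i * (w * x) - w * (of_bool (\<not> f) * x) * (k - \<mu> i)\<bar> \<le> w * of_bool f"
  proof (cases f)
    case True
    have "w * x * k - \<mu> i * (w * x) = w * (x * (k - \<mu> i))" by (simp add: algebra_simps)
    then show ?thesis using True w xk mult_left_mono[OF xk w] by (simp add: abs_mult)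
  qed (simp add: algebra_simps)
  moreover have "click_mass (platform_history (e # h)) l i = w * x * k + click_mass (platform_history h) l i"
    "mass (platform_history (e # h)) l i = w * x + mass (platform_history h) l i"
    "noise (e # h) l i = w * (of_bool (\<not> f) * x) * (k - \<mu> i) + noise h l i"
    "fake_mass (e # h) l = w * of_bool f + fake_mass h l"
    by (simp_all add: e click_mass_Cons mass_Cons w_def x_def k_def)
  ultimately show ?case using Cons.IH
    by (simp only: distrib_left abs_le_iff) linarith
qed simp

text \<open>Only the fake rounds drawn on level \<open>l\<close> itself count fully; those of lower
  levels weigh \<open>1 / 2 ^ l\<close> each.\<close>

lemma fake_mass_le: "fake_mass h l \<le> real (level_fakes h l) + real (num_fakes (map snd h)) / 2 ^ l"
proof (induction h)
  case (Cons e h)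
  obtain l' \<pi> f c where e: "e = (l', \<pi>, f, c)" by (cases e)
  have "level_weight l l' * of_bool f \<le> of_bool (l' = l \<and> f) + of_bool f / 2 ^ l"
    by (auto simp: level_weight_def)
  then show ?case using Cons.IH by (simp add: e add_divide_distrib)
qed simp

lemma level_fakes_le: "level_fakes h l \<le> num_fakes (map snd h)"
proof (induction h)
  case (Cons e h)
  then show ?case by (cases e) auto
qed simp

lemma level_fakes_drop: "level_fakes (drop k h) l \<le> level_fakes h l"
proof -
  have "level_fakes h l = level_fakes (take k h) l + level_fakes (drop k h) l"
    unfolding level_fakes_def by (metis append_take_drop_id filter_append length_append)
  then show ?thesis by simp
qed

lemma num_fakes_drop: "num_fakes (drop k h) \<le> num_fakes h"
proof -
  have "num_fakes h = num_fakes (take k h) + num_fakes (drop k h)"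
    unfolding num_fakes_def by (metis append_take_drop_id filter_append length_append)
  then show ?thesis by simp
qed

lemma mass_le_length: "mass h l i \<le> real (length h)"
proof (induction h)
  case (Cons e h)
  obtain l' \<pi> c where e: "e = (l', \<pi>, c)" by (cases e)
  have "level_weight l l' * of_bool (i \<in> examined \<pi> c) \<le> 1"
    using level_weight_bounds[of l l'] by auto
  then show ?case using Cons.IH by (simp add: e mass_Cons)
qed simp

text \<open>Hoeffding's lemma with parameter \<open>s * w\<close> gives the factor
  \<open>exp ((s * w)\<^sup>2 / 8)\<close>, and \<open>w * w \<le> w\<close> for weights in [0,1],
  so the mass itself can serve as compensator. Fake rounds contribute no noise and can only lower
  the exponent.\<close>

lemma expect_exp_noise:
  assumes i: "i \<in> {1..n}"
  shows "expect (rounds t) (\<lambda>h. exp (s * noise h l i - s\<^sup>2 / 8 * mass (platform_history h) l i)) \<le> 1"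
proof -
  define z where "z = (\<lambda>(l', \<pi>, f, c). of_bool (i \<in> examined \<pi> c) *
     (s * level_weight l l' * of_bool (\<not> f) * (of_bool (fst c = Some i) - \<mu> i)
        - s\<^sup>2 / 8 * level_weight l l'))"
  have mu: "0 \<le> \<mu> i" "\<mu> i \<le> 1" using mu_range[OF i] by auto
  have sum: "(\<Sum>e\<leftarrow>h. z e) = s * noise h l i - s\<^sup>2 / 8 * mass (platform_history h) l i" for h
  proof (induction h)
    case (Cons e h)
    then show ?case by (cases e) (auto simp: z_def mass_Cons algebra_simps)
  qed simp
  have "expect (rounds t) (\<lambda>h. prod_list (map (\<lambda>e. exp (z e)) h)) \<le> 1"
  proof (rule expect_prod_le_one)
    fix h a
    show "expect (A h) (\<lambda>y. expect (response n \<mu> q (snd y) a)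
       (\<lambda>c. exp (z (fst y, snd y, a \<noteq> Real_User, c)))) \<le> 1"
    proof (rule expect_le_const[OF A_finite])
      fix y assume "y \<in> set_pmf (A h)"
      then have perm: "snd y permutes {1..n}" using A_permutes[of "fst y" "snd y"] by simp
      define w where "w = level_weight l (fst y)"
      have w: "0 \<le> w" "w \<le> 1" by (simp_all add: w_def level_weight_bounds)
      show "expect (response n \<mu> q (snd y) a) (\<lambda>c. exp (z (fst y, snd y, a \<noteq> Real_User, c))) \<le> 1"
      proof (cases "a = Real_User")
        case False
        then show ?thesis using w
          by (intro expect_le_const finite_response) (auto simp: z_def w_def)
      next
        case True
        define g where "g = (\<lambda>x k. exp (of_bool x * (s * w * (of_bool k - \<mu> i) - s\<^sup>2 / 8 * w)))"
        have "expect (response n \<mu> q (snd y) a) (\<lambda>c. exp (z (fst y, snd y, a \<noteq> Real_User, c))) =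
          expect (real_customer n \<mu> q (snd y)) (\<lambda>c. g (i \<in> examined (snd y) c) (fst c = Some i))"
          unfolding True response.simps by (intro expect_cong) (simp add: z_def g_def w_def)
        also have "\<dots> = (1 - reach (snd y) i) * g False False +
          reach (snd y) i * (\<mu> i * g True True + (1 - \<mu> i) * g True False)"
          by (rule expect_real_customer_product[OF perm i])
        also have "g False False = 1" by (simp add: g_def)
        also have "\<mu> i * g True True + (1 - \<mu> i) * g True False =
          (\<mu> i * exp ((s * w) * (1 - \<mu> i)) + (1 - \<mu> i) * exp (- ((s * w) * \<mu> i))) * exp (- (s\<^sup>2 / 8 * w))"
        proof -
          have "g True True = exp ((s * w) * (1 - \<mu> i)) * exp (- (s\<^sup>2 / 8 * w))"
            "g True False = exp (- ((s * w) * \<mu> i)) * exp (- (s\<^sup>2 / 8 * w))"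
            unfolding exp_add[symmetric] g_def by (simp_all add: algebra_simps)
          then show ?thesis by (simp add: algebra_simps)
        qed
        also have "(1 - reach (snd y) i) * 1 + reach (snd y) i * \<dots> \<le> (1 - reach (snd y) i) * 1 + reach (snd y) i * 1"
        proof (intro add_left_mono mult_left_mono)
          have "(\<mu> i * exp ((s * w) * (1 - \<mu> i)) + (1 - \<mu> i) * exp (- ((s * w) * \<mu> i))) * exp (- (s\<^sup>2 / 8 * w))
            \<le> exp ((s * w)\<^sup>2 / 8) * exp (- (s\<^sup>2 / 8 * w))"
            by (intro mult_right_mono Hoeffding_bernoulli mu) auto
          also have "\<dots> = exp (s\<^sup>2 / 8 * (w * w - w))"
            by (simp add: exp_add[symmetric] power2_eq_square algebra_simps)
          also have "\<dots> \<le> exp 0"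
          proof -
            have "w * w \<le> 1 * w" using w by (intro mult_right_mono)
            then have "s\<^sup>2 / 8 * (w * w - w) \<le> 0" by (simp add: mult_le_0_iff)
            then show ?thesis by simp
          qed
          finally show "(\<mu> i * exp ((s * w) * (1 - \<mu> i)) + (1 - \<mu> i) * exp (- ((s * w) * \<mu> i))) * exp (- (s\<^sup>2 / 8 * w)) \<le> 1"
            by simp
          show "0 \<le> reach (snd y) i" by (rule reach_bounds[OF perm i])
        qed
        finally show ?thesis by simp
      qed
    qed
  qed simp
  then show ?thesis by (simp add: prod_list_exp sum)
qed

section \<open>Uniform control of the noise\<close>

definition confidence :: real where
  "confidence = ln (4 * real n * real T / forc_delta n T)"

text \<open>For mass \<open>k\<close> this is the \<open>s\<close> that minimises
  \<open>(2 * confidence + s\<^sup>2 / 8 * k) / s\<close>, the bound on the noise that follows from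
  the exponential moment.\<close>

definition scale :: "nat \<Rightarrow> real" where
  "scale k = sqrt (16 * confidence / real k)"

text \<open>The two signs of \<open>s\<close> give a two-sided bound. The grid of scales is finite
  so that a union bound applies although the mass is random.\<close>

definition calm :: "(nat \<times> event) list \<Rightarrow> bool" where
  "calm h \<longleftrightarrow> (\<forall>l\<in>{1..L}. \<forall>i\<in>{1..n}. \<forall>k\<in>{1..T}. \<forall>s\<in>{scale k, - scale k}.
     s * noise h l i - s\<^sup>2 / 8 * mass (platform_history h) l i \<le> 2 * confidence)"

lemma confidence_pos: "1 < confidence"
proof -
  have "1 \<le> real n" "2 \<le> real T" using n_pos T_ge by auto
  then have "1 * 2 ^ 2 \<le> real n ^ 4 * real T ^ 2" by (intro mult_mono power_mono one_le_power) auto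
  then have "4 \<le> real n ^ 4 * real T ^ 2" by simp
  then have "exp 1 < 4 * (real n ^ 4 * real T ^ 2)" using exp_le by linarith
  also have "4 * (real n ^ 4 * real T ^ 2) = 4 * real n * real T / forc_delta n T"
    by (simp add: forc_delta_def power_numeral_reduce)
  finally have *: "exp 1 < 4 * real n * real T / forc_delta n T" .
  have "ln (exp 1) < confidence"
    unfolding confidence_def using * by (intro ln_less_cancel_iff[THEN iffD2]) (auto intro: less_trans[OF exp_gt_zero])
  then show ?thesis by simp
qed

text \<open>The bound on the exponential moments is optimised over the scale \<open>s\<close>; the scales
  \<open>scale k\<close> with \<open>k\<close> the rounded value of the mass are precise enough.\<close>

lemma calm_noise:
  assumes "calm h" "l \<in> {1..L}" "i \<in> {1..n}" "length h \<le> T"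
  shows "\<bar>noise h l i\<bar> \<le> sqrt (3 / 2 * confidence * mass (platform_history h) l i)"
proof -
  define V where "V = mass (platform_history h) l i"
  define C where "C = confidence"
  have C: "1 < C" using confidence_pos by (simp add: C_def)
  have V0: "0 \<le> V" by (simp add: V_def mass_nonneg)
  have NV: "\<bar>noise h l i\<bar> \<le> V"
    unfolding V_def
  proof (induction h)
    case (Cons e h)
    obtain l' \<pi> f c where e: "e = (l', \<pi>, f, c)" by (cases e)
    have "\<bar>of_bool (\<not> f \<and> i \<in> examined \<pi> c) * (of_bool (fst c = Some i) - \<mu> i)\<bar> \<le> of_bool (i \<in> examined \<pi> c)"
      using mu_range[OF assms(3)] by auto
    from mult_left_mono[OF this level_weight_bounds(1)[of l l']]
    have "\<bar>level_weight l l' * of_bool (\<not> f \<and> i \<in> examined \<pi> c) * (of_bool (fst c = Some i) - \<mu> i)\<bar>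
      \<le> level_weight l l' * of_bool (i \<in> examined \<pi> c)"
      by (simp add: abs_mult level_weight_bounds mult.assoc)
    then show ?case using Cons.IH by (simp add: e mass_Cons)
  qed simp
  show ?thesis
  \<comment> \<open>For a small mass the trivial bound by the mass is already below the square root.
    Otherwise the mass exceeds 1, so rounding it up at most doubles it.\<close>
  proof (cases "V \<le> 3 / 2 * C")
    case True
    have "V = sqrt (V * V)" using V0 by simp
    also have "\<dots> \<le> sqrt (3 / 2 * C * V)" using True V0 by (intro real_sqrt_le_mono mult_right_mono)
    finally show ?thesis using NV by (simp add: V_def C_def)
  next
    case False
    then have V1: "1 < V" using C by linarith
    define k where "k = nat \<lceil>V\<rceil>"
    have VT: "V \<le> real T"
      using mass_le_length[of "platform_history h" l i] assms(4) by (simp add: V_def platform_history_def)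
    have k: "V \<le> real k" "real k \<le> 2 * V"
      using V1 by (auto simp: k_def) linarith
    have "k \<le> T" using VT by (simp add: k_def nat_le_iff ceiling_le_iff)
    then have kT: "k \<in> {1..T}" using k V1 by auto
    define s where "s = scale k"
    have s2: "s\<^sup>2 = 16 * C / real k" and s0: "0 < s"
      using k V1 C by (auto simp: s_def scale_def C_def)
    have "s * noise h l i - s\<^sup>2 / 8 * V \<le> 2 * C" "(- s) * noise h l i - (- s)\<^sup>2 / 8 * V \<le> 2 * C"
      using assms(1-3) kT unfolding calm_def s_def V_def C_def by blast+
    then have *: "s * \<bar>noise h l i\<bar> \<le> 2 * C + s\<^sup>2 / 8 * V"
      by (cases "0 \<le> noise h l i") auto
    also have "s\<^sup>2 / 8 * V = 2 * C * (V / real k)" by (simp add: s2)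
    finally have N: "s * \<bar>noise h l i\<bar> \<le> 2 * C * (1 + V / real k)" by (simp add: algebra_simps)
    have "(s * \<bar>noise h l i\<bar>)\<^sup>2 \<le> (2 * C * (1 + V / real k))\<^sup>2"
      using N s0 by (intro power_mono) auto
    then have "16 * C / real k * (noise h l i)\<^sup>2 \<le> 4 * C\<^sup>2 * (1 + V / real k)\<^sup>2"
      by (simp add: power_mult_distrib s2)
    \<comment> \<open>Rounding up keeps the ratio \<open>v\<close> between 1/2 and 1, and the
      inequality is tight at \<open>v = 1 / 2\<close>. The resulting constant 18/16 stays below the
      3/2 of the widths.\<close>
    moreover have "(1 + V / real k)\<^sup>2 \<le> 9 / 2 * (V / real k)"
    proof -
      define v where "v = V / real k"
      have v: "1 / 2 \<le> v" "v \<le> 1" using k V1 by (auto simp: v_def field_simps)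
      have "0 \<le> (v - 1 / 2) * (2 - v)" using v by auto
      also have "\<dots> = 9 / 2 * v - (1 + v)\<^sup>2" by (simp add: power2_eq_square field_simps)
      finally show ?thesis unfolding v_def[symmetric] by linarith
    qed
    ultimately have "16 * C / real k * (noise h l i)\<^sup>2 \<le> 4 * C\<^sup>2 * (9 / 2 * (V / real k))"
      by (smt (verit) mult_left_mono zero_le_power2)
    then have "16 * C * (noise h l i)\<^sup>2 \<le> 18 * C\<^sup>2 * V"
      using k V1 by (simp add: field_simps)
    then have "C * (16 * (noise h l i)\<^sup>2) \<le> C * (18 * C * V)"
      by (simp add: power2_eq_square algebra_simps)
    then have "16 * (noise h l i)\<^sup>2 \<le> 18 * C * V" using C by simp
    moreover have "0 \<le> C * V" using C V0 by simp
    ultimately have "(noise h l i)\<^sup>2 \<le> 3 / 2 * C * V" by linarith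
    then show ?thesis unfolding V_def C_def by (rule real_le_rsqrt[of "\<bar>noise h l i\<bar>", simplified])
  qed
qed

lemma of_bool_less_le_exp: "of_bool (b < x) \<le> exp (x - b :: real)"
  by auto

text \<open>A union bound over \<open>2 * L * n * T\<close> events of probability at most
  \<open>exp (- 2 * confidence)\<close> each. The doubled exponent leaves a factor
  \<open>1 / T ^ 2\<close>, enough for a further union bound over the rounds.\<close>

lemma expect_not_calm: "expect (rounds t) (\<lambda>h. of_bool (\<not> calm h)) \<le> 1 / (8 * real T ^ 2)"
proof -
  define Z where "Z = (\<lambda>s l i h. s * noise h l i - s\<^sup>2 / 8 * mass (platform_history h) l i)"
  let ?C = "2 * confidence"
  define B where "B = (\<lambda>h. \<Sum>l=1..L. \<Sum>i=1..n. \<Sum>k=1..T.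
     exp (Z (scale k) l i h - ?C) + exp (Z (- scale k) l i h - ?C))"
  have "of_bool (\<not> calm h) \<le> B h" for h
  proof (cases "calm h")
    case True
    then show ?thesis by (auto simp: B_def intro!: sum_nonneg add_nonneg_nonneg)
  next
    case False
    then obtain l i k where lik: "l \<in> {1..L}" "i \<in> {1..n}" "k \<in> {1..T}"
      "?C < Z (scale k) l i h \<or> ?C < Z (- scale k) l i h"
      by (auto simp: calm_def Z_def not_le)
    have "1 \<le> exp (Z (scale k) l i h - ?C) + exp (Z (- scale k) l i h - ?C)"
      using lik(4) by (smt (verit) exp_ge_zero one_le_exp_iff)
    also have "\<dots> \<le> (\<Sum>k=1..T. exp (Z (scale k) l i h - ?C) + exp (Z (- scale k) l i h - ?C))"
      using lik(3) by (intro member_le_sum) auto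
    also have "\<dots> \<le> (\<Sum>i=1..n. \<Sum>k=1..T. exp (Z (scale k) l i h - ?C) + exp (Z (- scale k) l i h - ?C))"
      using lik(2) by (intro member_le_sum[of i]) (auto intro!: sum_nonneg)
    also have "\<dots> \<le> B h"
      unfolding B_def using lik(1) by (intro member_le_sum[of l]) (auto intro!: sum_nonneg)
    finally show ?thesis by simp
  qed
  then have "expect (rounds t) (\<lambda>h. of_bool (\<not> calm h)) \<le> expect (rounds t) B"
    by (intro expect_mono finite_run)
  also have "\<dots> = (\<Sum>l=1..L. \<Sum>i=1..n. \<Sum>k=1..T. expect (rounds t) (\<lambda>h. exp (Z (scale k) l i h - ?C)) +
      expect (rounds t) (\<lambda>h. exp (Z (- scale k) l i h - ?C)))"
    unfolding B_def by (simp add: expect_sum[OF finite_run] expect_add[OF finite_run])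
  also have "\<dots> \<le> (\<Sum>l=1..L. \<Sum>i=1..n. \<Sum>k=1..T. exp (- ?C) + exp (- ?C))"
  proof (intro sum_mono add_mono)
    fix l i k assume "i \<in> {1..n}"
    have "expect (rounds t) (\<lambda>h. exp (Z s l i h - ?C)) \<le> exp (- ?C)" for s
    proof -
      have "expect (rounds t) (\<lambda>h. exp (Z s l i h - ?C)) = exp (- ?C) * expect (rounds t) (\<lambda>h. exp (Z s l i h))"
        by (simp add: exp_diff exp_minus divide_inverse)
      also have "\<dots> \<le> exp (- ?C) * 1"
        unfolding Z_def using \<open>i \<in> {1..n}\<close> by (intro mult_left_mono expect_exp_noise) auto
      finally show ?thesis by simp
    qed
    then show "expect (rounds t) (\<lambda>h. exp (Z (scale k) l i h - ?C)) \<le> exp (- ?C)"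
      "expect (rounds t) (\<lambda>h. exp (Z (- scale k) l i h - ?C)) \<le> exp (- ?C)" by auto
  qed
  also have "\<dots> = 2 * (real L * real n * real T) * exp (- ?C)" by simp
  also have "exp (- ?C) = 1 / (4 * (real n ^ 4 * real T ^ 2)) ^ 2"
  proof -
    have e: "4 * real n * real T / forc_delta n T = 4 * (real n ^ 4 * real T ^ 2)"
      by (simp add: forc_delta_def power_numeral_reduce)
    have pos: "0 < 4 * (real n ^ 4 * real T ^ 2)" using n_pos T_ge by simp
    have "exp ?C = exp confidence ^ 2" by (simp add: power2_eq_square exp_add[symmetric])
    also have "exp confidence = 4 * (real n ^ 4 * real T ^ 2)"
      unfolding confidence_def e using pos by simp
    finally show ?thesis by (simp add: exp_minus inverse_eq_divide)
  qed
  also have "2 * (real L * real n * real T) * (1 / (4 * (real n ^ 4 * real T ^ 2)) ^ 2)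
    \<le> 2 * (real T * real n ^ 8 * real T) * (1 / (4 * (real n ^ 4 * real T ^ 2)) ^ 2)"
  proof (intro mult_right_mono mult_left_mono mult_mono)
    show "real n \<le> real n ^ 8" using n_pos by (intro self_le_power) auto
  qed (use L_le in auto)
  also have "\<dots> = 1 / (8 * real T ^ 2)"
    using n_pos T_ge by (simp add: power_mult_distrib field_simps power_numeral_reduce)
  finally show ?thesis .
qed

text \<open>A union bound over time: without its last round, a run of length \<open>Suc t\<close> is
  a run of length \<open>t\<close>.\<close>

lemma expect_ever_not_calm:
  "expect (rounds t) (\<lambda>h. of_bool (\<exists>k. \<not> calm (drop k h))) \<le> real (Suc t) * (1 / (8 * real T ^ 2))"
proof (induction t)
  case 0
  then show ?case using expect_not_calm[of 0] by simp
next
  case (Suc t)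
  have "expect (rounds (Suc t)) (\<lambda>h. of_bool (\<exists>k. \<not> calm (drop k h))) \<le>
    expect (rounds (Suc t)) (\<lambda>h. of_bool (\<not> calm h) + of_bool (\<exists>k. \<not> calm (drop k (tl h))))"
  proof (rule expect_mono[OF finite_run])
    fix h assume "h \<in> set_pmf (rounds (Suc t))"
    have "\<not> calm h \<or> (\<exists>k. \<not> calm (drop k (tl h)))" if "\<not> calm (drop k h)" for k
      using that by (cases k) (auto simp: drop_Suc)
    then show "(of_bool (\<exists>k. \<not> calm (drop k h)) :: real) \<le> of_bool (\<not> calm h) + of_bool (\<exists>k. \<not> calm (drop k (tl h)))"
      by auto
  qed
  also have "\<dots> = expect (rounds (Suc t)) (\<lambda>h. of_bool (\<not> calm h)) +
      expect (rounds t) (\<lambda>h. of_bool (\<exists>k. \<not> calm (drop k h)))"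
    by (subst expect_add[OF finite_run]) (simp only: expect_run_tl[of t "\<lambda>h. of_bool (\<exists>k. \<not> calm (drop k h))"])
  also have "\<dots> \<le> 1 / (8 * real T ^ 2) + real (Suc t) * (1 / (8 * real T ^ 2))"
    using Suc expect_not_calm[of "Suc t"] by linarith
  also have "\<dots> = real (Suc (Suc t)) * (1 / (8 * real T ^ 2))"
    by (simp add: algebra_simps add_divide_distrib)
  finally show ?case .
qed

section \<open>Number of fake rounds on one level\<close>

lemma expect_of_bool_eq: "expect M (\<lambda>x. of_bool (x = y)) = pmf M y"
  by (subst integral_measure_pmf_real[where A = "{y}"]) auto

text \<open>A fake round has level \<open>l\<close> with probability \<open>p = 1 / 2 ^ l\<close>,
  whatever the policy knows. The compensator \<open>2 * p\<close> works because
  \<open>1 + p * (exp 1 - 1) \<le> 1 + 2 * p \<le> exp (2 * p)\<close>. Level 1 is left out because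
  its probability is larger than 1/2.\<close>

lemma expect_exp_level_fakes:
  assumes "l \<in> {2..L}"
  shows "expect (rounds t) (\<lambda>h. exp (real (level_fakes h l) - 2 / 2 ^ l * real (num_fakes (map snd h)))) \<le> 1"
proof -
  define p where "p = (1 / 2 ^ l :: real)"
  define z :: "nat \<times> event \<Rightarrow> real"
    where "z = (\<lambda>(l', \<pi>, f, c). of_bool (l' = l \<and> f) - 2 * p * of_bool f)"
  have sum: "(\<Sum>e\<leftarrow>h. z e) = real (level_fakes h l) - 2 / 2 ^ l * real (num_fakes (map snd h))"
    for h :: "(nat \<times> event) list"
  proof (induction h)
    case (Cons e h)
    then show ?case by (cases e) (auto simp: z_def p_def algebra_simps add_divide_distrib)
  qed simp
  have "expect (rounds t) (\<lambda>h. prod_list (map (\<lambda>e. exp (z e)) h)) \<le> 1"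
  proof (rule expect_prod_le_one)
    fix h a
    show "expect (A h) (\<lambda>y. expect (response n \<mu> q (snd y) a)
       (\<lambda>c. exp (z (fst y, snd y, a \<noteq> Real_User, c)))) \<le> 1"
    proof (cases "a = Real_User")
      case True
      then show ?thesis by (simp add: z_def)
    next
      case False
      have "expect (A h) (\<lambda>y. expect (response n \<mu> q (snd y) a)
         (\<lambda>c. exp (z (fst y, snd y, a \<noteq> Real_User, c)))) =
        expect (level_pmf L) (\<lambda>l'. exp (of_bool (l' = l) - 2 * p))"
        unfolding expect_A using False by (simp add: z_def)
      also have "\<dots> = expect (level_pmf L) (\<lambda>l'. exp (- (2 * p)) * (1 + of_bool (l' = l) * (exp 1 - 1)))"
        by (intro expect_cong) (auto simp: exp_diff exp_minus field_simps)
      also have "\<dots> = exp (- (2 * p)) * (1 + p * (exp 1 - 1))"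
      proof -
        have "pmf (level_pmf L) l = p" using assms by (simp add: pmf_level_pmf level_prob_def p_def)
        then show ?thesis
          by (simp add: expect_add[OF finite_level] expect_of_bool_eq)
      qed
      also have "\<dots> \<le> exp (- (2 * p)) * exp (2 * p)"
      proof (rule mult_left_mono)
        have "p * (exp 1 - 1) \<le> p * 2" using exp_le by (intro mult_left_mono) (auto simp: p_def)
        then show "1 + p * (exp 1 - 1) \<le> exp (2 * p)" using exp_ge_add_one_self[of "2 * p"] by linarith
      qed simp
      also have "\<dots> = 1" by (simp add: exp_add[symmetric])
      finally show ?thesis .
    qed
  qed simp
  then show ?thesis by (simp add: prod_list_exp sum)
qed

text \<open>One less than the numerator of the additive term of the widths: the remaining 1 pays for
  the fake rounds of lower levels.\<close>

definition fake_bound :: real where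
  "fake_bound = ln (2 * real L / forc_delta n T) + 3"

definition quiet :: "nat \<Rightarrow> (nat \<times> event) list \<Rightarrow> bool" where
  "quiet m h \<longleftrightarrow> (\<forall>l\<in>{m..L} \<inter> {2..}. real (level_fakes h l) \<le> fake_bound)"

text \<open>Markov's inequality for the exponential moment. The compensator is at most 2 because the
  budget is at most \<open>2 ^ m\<close> and thus at most \<open>2 ^ l\<close>.\<close>

lemma expect_not_quiet:
  assumes "1 \<le> m" "real F \<le> 2 ^ m" "t \<le> T"
  shows "expect (rounds t) (\<lambda>h. of_bool (\<not> quiet m h)) \<le> 1 / (2 * real T)"
proof -
  let ?I = "{m..L} \<inter> {2..}"
  have L0: "0 < 2 * real L / forc_delta n T"
    using L_pos n_pos T_ge by (simp add: forc_delta_def)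
  have "expect (rounds t) (\<lambda>h. of_bool (\<not> quiet m h)) \<le>
    expect (rounds t) (\<lambda>h. \<Sum>l\<in>?I. of_bool (fake_bound < real (level_fakes h l)))"
  proof (rule expect_mono[OF finite_run])
    fix h
    show "(of_bool (\<not> quiet m h) :: real) \<le> (\<Sum>l\<in>?I. of_bool (fake_bound < real (level_fakes h l)))"
    proof (cases "quiet m h")
      case False
      then obtain l where l: "l \<in> ?I" "fake_bound < real (level_fakes h l)"
        by (auto simp: quiet_def not_le)
      then have "(1::real) = of_bool (fake_bound < real (level_fakes h l))" by simp
      also have "\<dots> \<le> (\<Sum>l\<in>?I. of_bool (fake_bound < real (level_fakes h l)))"
        using l(1) by (intro member_le_sum) auto
      finally show ?thesis using False by simp
    qed (simp add: sum_nonneg)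
  qed
  also have "\<dots> = (\<Sum>l\<in>?I. expect (rounds t) (\<lambda>h. of_bool (fake_bound < real (level_fakes h l))))"
    by (rule expect_sum[OF finite_run])
  also have "\<dots> \<le> (\<Sum>l\<in>?I. forc_delta n T / (2 * real L))"
  proof (rule sum_mono)
    fix l assume l: "l \<in> ?I"
    have "expect (rounds t) (\<lambda>h. of_bool (fake_bound < real (level_fakes h l))) \<le>
      expect (rounds t) (\<lambda>h. exp (real (level_fakes h l) - 2 / 2 ^ l * real (num_fakes (map snd h))) * exp (2 - fake_bound))"
    proof (rule expect_mono[OF finite_run])
      fix h assume h: "h \<in> set_pmf (rounds t)"
      have "real (num_fakes (map snd h)) \<le> real F" using num_fakes_run[OF h assms(3)] by simp
      also have "\<dots> \<le> 2 ^ m" by (rule assms(2))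
      also have "\<dots> \<le> 2 ^ l" using l by (intro power_increasing) auto
      finally have "2 / 2 ^ l * real (num_fakes (map snd h)) \<le> 2" by (simp add: field_simps)
      then have "real (level_fakes h l) - fake_bound \<le>
        (real (level_fakes h l) - 2 / 2 ^ l * real (num_fakes (map snd h))) + (2 - fake_bound)" by simp
      moreover have "of_bool (fake_bound < real (level_fakes h l)) \<le> exp (real (level_fakes h l) - fake_bound)"
        by (rule of_bool_less_le_exp)
      ultimately show "of_bool (fake_bound < real (level_fakes h l)) \<le>
        exp (real (level_fakes h l) - 2 / 2 ^ l * real (num_fakes (map snd h))) * exp (2 - fake_bound)"
        unfolding exp_add[symmetric] by (meson exp_le_cancel_iff order_trans)
    qed
    also have "\<dots> = expect (rounds t) (\<lambda>h. exp (real (level_fakes h l) - 2 / 2 ^ l * real (num_fakes (map snd h)))) * exp (2 - fake_bound)"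
      by simp
    also have "\<dots> \<le> 1 * exp (2 - fake_bound)"
      using l by (intro mult_right_mono expect_exp_level_fakes) auto
    also have "\<dots> \<le> exp (- ln (2 * real L / forc_delta n T))" by (simp add: fake_bound_def)
    also have "\<dots> = forc_delta n T / (2 * real L)" using L0 by (simp add: exp_minus)
    finally show "expect (rounds t) (\<lambda>h. of_bool (fake_bound < real (level_fakes h l))) \<le> forc_delta n T / (2 * real L)" .
  qed
  also have "\<dots> = real (card ?I) * (forc_delta n T / (2 * real L))" by simp
  also have "\<dots> \<le> real L * (forc_delta n T / (2 * real L))"
  proof (rule mult_right_mono)
    have "card ?I \<le> card {1..L}" using assms(1) by (intro card_mono) auto
    then show "real (card ?I) \<le> real L" by simp
  qed (simp add: forc_delta_def)
  also have "\<dots> = forc_delta n T / 2" using L_pos by simp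
  also have "\<dots> \<le> 1 / (2 * real T)"
  proof -
    have "1 * real T \<le> real n ^ 3 * real T" using n_pos by (intro mult_right_mono one_le_power) auto
    then show ?thesis using T_ge n_pos by (simp add: forc_delta_def frac_le)
  qed
  finally show ?thesis .
qed

text \<open>The noise has to be controlled at every earlier time, whereas the number of fake rounds
  on a level only grows, so bounding it at the end suffices. Division by the mass turns the two
  error terms into the two summands of \<open>radius\<close>.\<close>

lemma calm_quiet_good:
  assumes "1 \<le> m" "real F \<le> 2 ^ m" "t \<le> T" "h \<in> set_pmf (rounds t)"
    and calm: "\<And>k. calm (drop k h)" and quiet: "quiet m h"
  shows "good m (platform_history h)"
  unfolding good_def
proof (intro allI ballI)
  fix k l assume l: "l \<in> {m..L}"
  define h' where "h' = drop k h"
  have l1: "l \<in> {1..L}" using l assms(1) by auto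
  have fakes: "real (num_fakes (map snd h')) \<le> real F"
    using num_fakes_run[OF assms(4,3)] num_fakes_drop[of k "map snd h"] by (simp add: h'_def drop_map)
  have len: "length h' \<le> T" using length_run[OF assms(4)] assms(3) by (simp add: h'_def)
  have lf: "real (level_fakes h' l) \<le> fake_bound"
  proof (cases "2 \<le> l")
    case True
    then have "real (level_fakes h l) \<le> fake_bound" using quiet l by (auto simp: quiet_def)
    then show ?thesis using level_fakes_drop[of k h l] by (simp add: h'_def)
  next
    case False
    \<comment> \<open>Level 1 matters only for \<open>m = 1\<close>; the budget is then at most 2,
      which \<open>fake_bound\<close> exceeds for certain.\<close>
    then have "m = 1" using l assms(1) by auto
    then have "real (level_fakes h' l) \<le> 2"
      using level_fakes_le[of h' l] fakes assms(2) by simp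
    then show ?thesis
      using ln_ge_zero[of "2 * real L / forc_delta n T"] L_pos n_pos T_ge
    proof -
      have "1 * 1 \<le> real n ^ 3 * real T" using n_pos T_ge by (intro mult_mono one_le_power) auto
      then have "1 * 1 \<le> 2 * real L * (real n ^ 3 * real T)"
        using L_pos by (intro mult_mono) auto
      then have "0 \<le> ln (2 * real L / forc_delta n T)" by (simp add: forc_delta_def)
      then show ?thesis using \<open>real (level_fakes h' l) \<le> 2\<close> by (simp add: fake_bound_def)
    qed
  qed
  have "real (num_fakes (map snd h')) / 2 ^ l \<le> 1"
  proof -
    have "real (num_fakes (map snd h')) \<le> 2 ^ m" using fakes assms(2) by linarith
    also have "\<dots> \<le> 2 ^ l" using l by (intro power_increasing) auto
    finally show ?thesis by simp
  qed
  then have fm: "fake_mass h' l \<le> ln (2 * real L / forc_delta n T) + 4"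
    using fake_mass_le[of h' l] lf unfolding fake_bound_def by linarith
  have "accurate l (platform_history h')"
    unfolding accurate_def
  proof (intro ballI impI)
    fix i assume i: "i \<in> {1..n}" and pos: "0 < mass (platform_history h') l i"
    define V where "V = mass (platform_history h') l i"
    have V: "0 < V" using pos by (simp add: V_def)
    have "\<bar>click_mass (platform_history h') l i - \<mu> i * V\<bar> \<le> \<bar>noise h' l i\<bar> + fake_mass h' l"
      using estimation_error[OF i, of h' l] unfolding V_def by linarith
    also have "\<dots> \<le> sqrt (3 / 2 * confidence * V) + (ln (2 * real L / forc_delta n T) + 4)"
      using calm_noise[OF calm[of k, folded h'_def] l1 i len] fm by (simp add: V_def)
    finally have *: "\<bar>click_mass (platform_history h') l i - \<mu> i * V\<bar> / V \<le>
      (sqrt (3 / 2 * confidence * V) + (ln (2 * real L / forc_delta n T) + 4)) / V"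
      using V by (intro divide_right_mono) auto
    have "sqrt (3 / 2 * confidence * V) / V = sqrt (3 / 2 * confidence * V) / sqrt (V ^ 2)" using V by simp
    also have "\<dots> = sqrt (3 / 2 * confidence * V / V ^ 2)" by (simp only: real_sqrt_divide)
    also have "3 / 2 * confidence * V / V ^ 2 = 3 / 2 * (confidence / V)"
      using V by (simp add: power2_eq_square)
    finally have "(sqrt (3 / 2 * confidence * V) + (ln (2 * real L / forc_delta n T) + 4)) / V = radius V"
      by (simp add: radius_def add_divide_distrib confidence_def)
    moreover have "\<bar>click_mass (platform_history h') l i - \<mu> i * V\<bar> / V =
      \<bar>click_mass (platform_history h') l i / V - \<mu> i\<bar>"
    proof -
      have "click_mass (platform_history h') l i / V - \<mu> i = (click_mass (platform_history h') l i - \<mu> i * V) / V"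
        using V by (simp add: field_simps)
      then show ?thesis using V by (simp add: abs_divide)
    qed
    ultimately show "\<bar>click_mass (platform_history h') l i / mass (platform_history h') l i - \<mu> i\<bar>
      \<le> radius (mass (platform_history h') l i)"
      using * by (simp add: V_def)
  qed
  then show "accurate l (drop k (platform_history h))" by (simp add: h'_def)
qed

text \<open>The bound \<open>1 / T\<close> makes all failures together cost at most 1, since a round
  loses at most 1.\<close>

lemma expect_not_good:
  assumes "1 \<le> m" "real F \<le> 2 ^ m" "t < T"
  shows "expect (rounds t) (\<lambda>h. of_bool (\<not> good m (platform_history h))) \<le> 1 / real T"
proof -
  have "expect (rounds t) (\<lambda>h. of_bool (\<not> good m (platform_history h))) \<le>
    expect (rounds t) (\<lambda>h. of_bool (\<exists>k. \<not> calm (drop k h)) + of_bool (\<not> quiet m h))"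
    using calm_quiet_good[OF assms(1,2), of t] assms(3)
    by (intro expect_mono[OF finite_run]) auto
  also have "\<dots> = expect (rounds t) (\<lambda>h. of_bool (\<exists>k. \<not> calm (drop k h))) + expect (rounds t) (\<lambda>h. of_bool (\<not> quiet m h))"
    by (rule expect_add[OF finite_run])
  also have "\<dots> \<le> real (Suc t) * (1 / (8 * real T ^ 2)) + 1 / (2 * real T)"
    using expect_ever_not_calm[of t] expect_not_quiet[OF assms(1,2), of t] assms(3) by (intro add_mono) auto
  also have "\<dots> \<le> real T * (1 / (8 * real T ^ 2)) + 1 / (2 * real T)"
    using assms(3) by (intro add_right_mono mult_right_mono) auto
  also have "\<dots> \<le> 1 / real T" using T_ge by (simp add: field_simps power2_eq_square)
  finally show ?thesis .
qed

end

section \<open>Charging the regret\<close>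

lemma level_prob_ge:
  assumes "l \<in> {1..L}"
  shows "1 / 2 ^ l \<le> level_prob L l"
proof (cases "l = 1")
  case True
  \<comment> \<open>Level 1 receives the remaining probability
    \<open>1 / 2 + 1 / 2 ^ L\<close>.\<close>
  have "(\<Sum>k=2..L. 1 / 2 ^ k :: real) = 1 / 2 - 1 / 2 ^ L" if "1 \<le> L" for L
    using that
  proof (induction L rule: nat_induct_at_least)
    case (Suc L)
    then show ?case by (simp add: atLeastAtMostSuc_conv field_simps)
  qed simp
  then show ?thesis using True assms by (simp add: level_prob_def)
qed (use assms in \<open>auto simp: level_prob_def\<close>)

locale forc_robust = forc_play +
  fixes m :: nat
  assumes m_range: "m \<in> {1..L}" and F_le: "real F \<le> 2 ^ m"
begin

definition low :: "forc_history \<Rightarrow> nat \<Rightarrow> real" where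
  "low h a = (\<Sum>g=1..<m. real (exam_count h g a))"

definition pair_sum :: "(nat \<Rightarrow> nat \<Rightarrow> real) \<Rightarrow> real" where
  "pair_sum f = (\<Sum>b=1..n. \<Sum>a=b+1..n. (\<mu> b - \<mu> a) * f b a)"

text \<open>Here \<open>r\<close> is either the indicator of the examined products or the vector of
  their probabilities; \<open>direct\<close> and \<open>explore\<close> are linear in it, so
  expectations pass through. Levels below \<open>m\<close> are pooled because only the sum of their
  counts enters the mass of level \<open>m\<close>.\<close>

definition direct :: "forc_history \<Rightarrow> nat \<Rightarrow> (nat \<Rightarrow> real) \<Rightarrow> real" where
  "direct h l r = pair_sum (\<lambda>b a.
     of_bool (if l < m then low h a \<le> 2 ^ m * samples b a else real (exam_count h l a) \<le> samples b a) * r a)"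

definition explore :: "forc_history \<Rightarrow> (nat \<Rightarrow> real) \<Rightarrow> real" where
  "explore h r = of_bool (1 < m) *
     pair_sum (\<lambda>b a. \<Sum>c=1..n. of_bool (real (exam_count h m c) \<le> samples b a) * r c)"

text \<open>Without lower levels, i.e. for \<open>m = 1\<close>, the exploration term has to vanish: its factor \<open>n\<close>
  would spoil the bound for \<open>F = 0\<close>.\<close>

definition potential :: "forc_history \<Rightarrow> real" where
  "potential h = pair_sum (\<lambda>b a. (\<Sum>l=m..L. min (real (exam_count h l a)) (samples b a + 1))
       + min (low h a) (2 ^ m * samples b a + 1))
     + 2 ^ m * of_bool (1 < m) *
       pair_sum (\<lambda>b a. \<Sum>c=1..n. min (real (exam_count h m c)) (samples b a + 1))"

lemma pair_sum_mono:
  assumes "\<And>b a. b \<in> {1..n} \<Longrightarrow> a \<in> {1..n} \<Longrightarrow> b < a \<Longrightarrow> f b a \<le> g b a"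
  shows "pair_sum f \<le> pair_sum g"
  unfolding pair_sum_def using mu_decreasing
  by (intro sum_mono mult_left_mono assms) (auto intro!: less_imp_le)

lemma pair_sum_add: "pair_sum (\<lambda>b a. f b a + g b a) = pair_sum f + pair_sum g"
  by (simp add: pair_sum_def distrib_left sum.distrib)

lemma pair_sum_scale: "pair_sum (\<lambda>b a. k * f b a) = k * pair_sum f"
  by (simp add: pair_sum_def sum_distrib_left mult_ac)

lemma pair_sum_nonneg:
  assumes "\<And>b a. b \<in> {1..n} \<Longrightarrow> a \<in> {1..n} \<Longrightarrow> b < a \<Longrightarrow> 0 \<le> f b a"
  shows "0 \<le> pair_sum f"
  using pair_sum_mono[of "\<lambda>_ _. 0" f] assms by (simp add: pair_sum_def)

lemma expect_pair_sum:
  assumes "finite (set_pmf M)"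
  shows "expect M (\<lambda>x. pair_sum (f x)) = pair_sum (\<lambda>b a. expect M (\<lambda>x. f x b a))"
  unfolding pair_sum_def by (simp add: expect_sum[OF assms])

lemma samples_nonneg: "0 \<le> samples b a"
  using log_bounds(2) by (simp add: samples_def)

lemma direct_nonneg: "(\<And>i. i \<in> {1..n} \<Longrightarrow> 0 \<le> r i) \<Longrightarrow> 0 \<le> direct h l r"
  unfolding direct_def by (intro pair_sum_nonneg) auto

lemma explore_nonneg: "(\<And>i. i \<in> {1..n} \<Longrightarrow> 0 \<le> r i) \<Longrightarrow> 0 \<le> explore h r"
  unfolding explore_def by (intro mult_nonneg_nonneg pair_sum_nonneg sum_nonneg) auto

lemma expect_direct:
  assumes "finite (set_pmf M)"
  shows "expect M (\<lambda>x. direct h l (r x)) = direct h l (\<lambda>i. expect M (\<lambda>x. r x i))"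
  unfolding direct_def by (simp add: expect_pair_sum[OF assms])

lemma expect_explore:
  assumes "finite (set_pmf M)"
  shows "expect M (\<lambda>x. explore h (r x)) = explore h (\<lambda>i. expect M (\<lambda>x. r x i))"
  unfolding explore_def by (simp add: expect_pair_sum[OF assms] expect_sum[OF assms])

text \<open>A count \<open>x\<close> capped at \<open>X + 1\<close> grows by a full unit whenever
  the product is examined while \<open>x \<le> X\<close>; this is the reason for the added 1 in the
  caps.\<close>

lemma potential_Cons:
  assumes l: "l \<in> {1..L}" and r_def: "r = (\<lambda>i. of_bool (i \<in> examined \<pi> c))"
  shows "potential h + direct h l r + of_bool (l = m) * (2 ^ m * explore h r)
    \<le> potential ((l, \<pi>, c) # h)"
proof -
  let ?h = "(l, \<pi>, c) # h"
  have cnt: "real (exam_count ?h g i) = of_bool (l = g) * r i + real (exam_count h g i)" for g i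
    by (simp add: exam_count_Cons r_def)
  have low: "low ?h i = of_bool (l < m) * r i + low h i" for i
  proof -
    have "low ?h i = (\<Sum>g=1..<m. of_bool (l = g) * r i) + low h i"
      unfolding low_def cnt by (rule sum.distrib)
    also have "(\<Sum>g=1..<m. of_bool (l = g) * r i) = (\<Sum>g=1..<m. if g = l then r i else 0)"
      by (intro sum.cong) auto
    also have "\<dots> = of_bool (l < m) * r i" using l by (simp add: sum.delta)
    finally show ?thesis .
  qed
  have min1: "min x (X + 1) + of_bool (x \<le> X) * r i \<le> min (r i + x) (X + 1)" for x X :: real and i
    by (auto simp: r_def)
  have min0: "min x (X + 1) \<le> min (of_bool Q * r i + x) (X + 1)" for x X :: real and i Q
    by (auto simp: r_def)
  have "pair_sum (\<lambda>b a. (\<Sum>g=m..L. min (real (exam_count h g a)) (samples b a + 1))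
       + min (low h a) (2 ^ m * samples b a + 1)) + direct h l r
     \<le> pair_sum (\<lambda>b a. (\<Sum>g=m..L. min (real (exam_count ?h g a)) (samples b a + 1))
       + min (low ?h a) (2 ^ m * samples b a + 1))"
    unfolding direct_def pair_sum_add[symmetric]
  proof (rule pair_sum_mono)
    fix b a
    show "(\<Sum>g=m..L. min (real (exam_count h g a)) (samples b a + 1)) + min (low h a) (2 ^ m * samples b a + 1) +
      of_bool (if l < m then low h a \<le> 2 ^ m * samples b a else real (exam_count h l a) \<le> samples b a) * r a
     \<le> (\<Sum>g=m..L. min (real (exam_count ?h g a)) (samples b a + 1)) + min (low ?h a) (2 ^ m * samples b a + 1)"
    proof (cases "l < m")
      case True
      have "(\<Sum>g=m..L. min (real (exam_count h g a)) (samples b a + 1)) \<le>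
        (\<Sum>g=m..L. min (real (exam_count ?h g a)) (samples b a + 1))"
        unfolding cnt by (intro sum_mono min0)
      moreover have "low ?h a = r a + low h a" using True by (simp add: low)
      ultimately show ?thesis
        unfolding if_P[OF True] using min1[of "low h a" "2 ^ m * samples b a" a] by linarith
    next
      case False
      have "(\<Sum>g=m..L. min (real (exam_count h g a)) (samples b a + 1)) +
          of_bool (real (exam_count h l a) \<le> samples b a) * r a =
        (\<Sum>g=m..L. min (real (exam_count h g a)) (samples b a + 1) +
          (if g = l then of_bool (real (exam_count h l a) \<le> samples b a) * r a else 0))"
        using False l by (simp add: sum.distrib sum.delta)
      also have "\<dots> \<le> (\<Sum>g=m..L. min (real (exam_count ?h g a)) (samples b a + 1))"
      proof (rule sum_mono)
        fix g
        show "min (real (exam_count h g a)) (samples b a + 1) +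
          (if g = l then of_bool (real (exam_count h l a) \<le> samples b a) * r a else 0)
          \<le> min (real (exam_count ?h g a)) (samples b a + 1)"
          unfolding cnt using min1[of "real (exam_count h g a)" "samples b a" a] by auto
      qed
      finally show ?thesis using False by (simp add: low)
    qed
  qed
  moreover have "2 ^ m * of_bool (1 < m) *
       pair_sum (\<lambda>b a. \<Sum>c=1..n. min (real (exam_count h m c)) (samples b a + 1)) +
      of_bool (l = m) * (2 ^ m * explore h r)
    \<le> 2 ^ m * of_bool (1 < m) *
       pair_sum (\<lambda>b a. \<Sum>c=1..n. min (real (exam_count ?h m c)) (samples b a + 1))"
  proof -
    have "2 ^ m * of_bool (1 < m) *
       pair_sum (\<lambda>b a. \<Sum>c=1..n. min (real (exam_count h m c)) (samples b a + 1)) +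
      of_bool (l = m) * (2 ^ m * explore h r) = 2 ^ m * of_bool (1 < m) *
       (pair_sum (\<lambda>b a. \<Sum>c=1..n. min (real (exam_count h m c)) (samples b a + 1)) +
        of_bool (l = m) * pair_sum (\<lambda>b a. \<Sum>c=1..n. of_bool (real (exam_count h m c) \<le> samples b a) * r c))"
      by (simp add: explore_def algebra_simps)
    also have "\<dots> \<le> 2 ^ m * of_bool (1 < m) *
       pair_sum (\<lambda>b a. \<Sum>c=1..n. min (real (exam_count ?h m c)) (samples b a + 1))"
    proof (rule mult_left_mono)
      show "pair_sum (\<lambda>b a. \<Sum>c=1..n. min (real (exam_count h m c)) (samples b a + 1)) +
        of_bool (l = m) * pair_sum (\<lambda>b a. \<Sum>c=1..n. of_bool (real (exam_count h m c) \<le> samples b a) * r c)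
        \<le> pair_sum (\<lambda>b a. \<Sum>c=1..n. min (real (exam_count ?h m c)) (samples b a + 1))"
      proof (cases "l = m")
        case True
        have "pair_sum (\<lambda>b a. (\<Sum>c=1..n. min (real (exam_count h m c)) (samples b a + 1)) +
           (\<Sum>c=1..n. of_bool (real (exam_count h m c) \<le> samples b a) * r c))
          \<le> pair_sum (\<lambda>b a. \<Sum>c=1..n. min (real (exam_count ?h m c)) (samples b a + 1))"
          unfolding sum.distrib[symmetric] cnt using True
          by (intro pair_sum_mono sum_mono) (simp only: True simp_thms of_bool_eq mult_1_left min1)
        then show ?thesis using True by (simp add: pair_sum_add)
      next
        case False
        then show ?thesis unfolding cnt by simp
      qed
    qed simp
    finally show ?thesis .
  qed
  ultimately show ?thesis unfolding potential_def by linarith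
qed

lemma expect_examined:
  assumes "\<pi> permutes {1..n}" "i \<in> {1..n}"
  shows "expect (real_customer n \<mu> q \<pi>) (\<lambda>c. of_bool (i \<in> examined \<pi> c)) = reach \<pi> i"
  using expect_real_customer_product[OF assms, of "\<lambda>x k. of_bool x"] by simp

lemma pair_sum_cong:
  assumes "\<And>b a. b \<in> {1..n} \<Longrightarrow> a \<in> {1..n} \<Longrightarrow> f b a = g b a"
  shows "pair_sum f = pair_sum g"
  unfolding pair_sum_def by (intro sum.cong refl arg_cong2[of _ _ _ _ "(*)"] assms) auto

lemma direct_cong: "(\<And>i. i \<in> {1..n} \<Longrightarrow> r i = r' i) \<Longrightarrow> direct h l r = direct h l r'"
  unfolding direct_def by (intro pair_sum_cong) auto

lemma explore_cong: "(\<And>i. i \<in> {1..n} \<Longrightarrow> r i = r' i) \<Longrightarrow> explore h r = explore h r'"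
  unfolding explore_def by (intro arg_cong2[of _ _ _ _ "(*)"] refl pair_sum_cong sum.cong) auto

lemma expect_potential_real:
  assumes "\<pi> permutes {1..n}" "l \<in> {1..L}"
  shows "potential h + direct h l (reach \<pi>) + of_bool (l = m) * (2 ^ m * explore h (reach \<pi>))
    \<le> expect (real_customer n \<mu> q \<pi>) (\<lambda>c. potential ((l, \<pi>, c) # h))"
proof -
  have fin: "finite (set_pmf (real_customer n \<mu> q \<pi>))"
    using finite_response[of \<pi> Real_User] by simp
  let ?r = "\<lambda>c i. of_bool (i \<in> examined \<pi> c)"
  have "direct h l (reach \<pi>) = direct h l (\<lambda>i. expect (real_customer n \<mu> q \<pi>) (\<lambda>c. ?r c i))"
    "explore h (reach \<pi>) = explore h (\<lambda>i. expect (real_customer n \<mu> q \<pi>) (\<lambda>c. ?r c i))"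
    by (auto intro!: direct_cong explore_cong simp: expect_examined[OF assms(1)])
  then have "potential h + direct h l (reach \<pi>) + of_bool (l = m) * (2 ^ m * explore h (reach \<pi>)) =
    expect (real_customer n \<mu> q \<pi>) (\<lambda>c. potential h + direct h l (?r c) + of_bool (l = m) * (2 ^ m * explore h (?r c)))"
    by (simp add: expect_add[OF fin] expect_direct[OF fin] expect_explore[OF fin])
  also have "\<dots> \<le> expect (real_customer n \<mu> q \<pi>) (\<lambda>c. potential ((l, \<pi>, c) # h))"
    using potential_Cons[OF assms(2) refl] by (intro expect_mono fin)
  finally show ?thesis .
qed

text \<open>Serves the fake rounds: they may add to the counts, but this never lowers the
  potential.\<close>

lemma potential_mono:
  assumes "l \<in> {1..L}"
  shows "potential h \<le> potential ((l, \<pi>, c) # h)"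
proof -
  let ?r = "\<lambda>i. of_bool (i \<in> examined \<pi> c)"
  have "0 \<le> direct h l ?r + of_bool (l = m) * (2 ^ m * explore h ?r)"
    by (intro add_nonneg_nonneg mult_nonneg_nonneg direct_nonneg explore_nonneg) auto
  then show ?thesis using potential_Cons[OF assms refl, of h \<pi> c] by linarith
qed

lemma win_gap_robust:
  assumes "good m h" "l \<in> {m..L}" "\<pi> \<in> forc_rankings n L (state h) l"
  shows "win id - win \<pi> \<le> direct h l (reach \<pi>)"
proof -
  have perm: "\<pi> permutes {1..n}" by (rule forc_rankings_permutes[OF assms(3)])
  have "win id - win \<pi> \<le> pair_sum (\<lambda>b a. if b = best_left \<pi> (inv \<pi> a) then reach \<pi> a else 0)"
    unfolding pair_sum_def by (rule win_gap_pairs[OF perm])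
  also have "\<dots> \<le> direct h l (reach \<pi>)"
    unfolding direct_def
  proof (rule pair_sum_mono)
    fix b a assume ba: "b \<in> {1..n}" "a \<in> {1..n}" "b < a"
    show "(if b = best_left \<pi> (inv \<pi> a) then reach \<pi> a else 0) \<le>
      of_bool (if l < m then low h a \<le> 2 ^ m * samples b a else real (exam_count h l a) \<le> samples b a) * reach \<pi> a"
      using robust_charge[OF _ assms ba(2) _ ba(3)] m_range assms(2) reach_bounds[OF perm ba(2)] by auto
  qed
  finally show ?thesis .
qed

lemma win_gap_nonrobust:
  assumes "good m h" "l \<in> {1..<m}" "\<pi> \<in> forc_rankings n L (state h) l"
    and "\<sigma> \<in> forc_rankings n L (state h) m"
  shows "win id - win \<pi> \<le> direct h l (reach \<pi>) + explore h (reach \<sigma>)"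
proof -
  have perm: "\<pi> permutes {1..n}" "\<sigma> permutes {1..n}"
    using forc_rankings_permutes assms(3,4) by auto
  have "win id - win \<pi> \<le> pair_sum (\<lambda>b a. if b = best_left \<pi> (inv \<pi> a) then reach \<pi> a else 0)"
    unfolding pair_sum_def by (rule win_gap_pairs[OF perm(1)])
  also have "\<dots> \<le> pair_sum (\<lambda>b a.
      of_bool (if l < m then low h a \<le> 2 ^ m * samples b a else real (exam_count h l a) \<le> samples b a) * reach \<pi> a
      + (\<Sum>c=1..n. of_bool (real (exam_count h m c) \<le> samples b a) * reach \<sigma> c))"
  proof (rule pair_sum_mono)
    fix b a assume ba: "b \<in> {1..n}" "a \<in> {1..n}" "b < a"
    let ?E = "\<Sum>c=1..n. of_bool (real (exam_count h m c) \<le> samples b a) * reach \<sigma> c"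
    have E0: "0 \<le> ?E" using reach_bounds[OF perm(2)] by (intro sum_nonneg) auto
    \<comment> \<open>The product \<open>c\<close> depends on both rankings, so it is replaced by
      the sum over all products; this is the source of the factor \<open>n\<close>.\<close>
    have "reach \<pi> a \<le> ?E" if best: "b = best_left \<pi> (inv \<pi> a)" and "2 ^ m * samples b a < low h a"
    proof -
      obtain c where c: "c \<in> {1..n}" "real (exam_count h m c) \<le> samples b a" "reach \<pi> a \<le> reach \<sigma> c"
        using nonrobust_charge[OF _ _ assms ba(2) best ba(3)] \<open>2 ^ m * samples b a < low h a\<close> m_range
        by (auto simp: low_def)
      have "reach \<sigma> c = of_bool (real (exam_count h m c) \<le> samples b a) * reach \<sigma> c" using c(2) by simp
      also have "\<dots> \<le> ?E" using c(1) reach_bounds[OF perm(2)] by (intro member_le_sum) auto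
      finally show ?thesis using c(3) by linarith
    qed
    then show "(if b = best_left \<pi> (inv \<pi> a) then reach \<pi> a else 0) \<le>
      of_bool (if l < m then low h a \<le> 2 ^ m * samples b a else real (exam_count h l a) \<le> samples b a) * reach \<pi> a + ?E"
      using E0 reach_bounds[OF perm(1) ba(2)] assms(2) by (auto simp: not_le)
  qed
  also have "\<dots> = direct h l (reach \<pi>) + explore h (reach \<sigma>)"
    using assms(2) by (simp add: pair_sum_add direct_def explore_def)
  finally show ?thesis .
qed

text \<open>When a lower level is drawn, the ranking of level \<open>m\<close> in the charge is a
  hypothetical draw from \<open>choice h m\<close> at the same history. Its expected charge
  \<open>Q\<close> depends on the history only, and the same charge really accrues in expectation
  when level \<open>m\<close> is drawn. This has probability at least \<open>1 / 2 ^ m\<close>, for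
  which the factor \<open>2 ^ m\<close> makes up.\<close>

lemma expected_loss:
  assumes "good m h"
  shows "expect (A h) (\<lambda>y. win id - win (snd y)) \<le>
    expect (A h) (\<lambda>y. direct h (fst y) (reach (snd y)) +
      of_bool (fst y = m) * (2 ^ m * explore h (reach (snd y))))"
proof -
  define Q where "Q = expect (choice h m) (\<lambda>\<sigma>. explore h (reach \<sigma>))"
  define D where "D = (\<lambda>l. expect (choice h l) (\<lambda>\<pi>. direct h l (reach \<pi>)))"
  have rank: "\<pi> \<in> forc_rankings n L (state h) l" if "l \<in> {1..L}" "\<pi> \<in> set_pmf (choice h l)" for l \<pi>
    using choice[OF that(1)] that(2) by blast
  have Q0: "0 \<le> Q"
    unfolding Q_def
    by (intro expect_ge_const finite_choice[OF m_range] explore_nonneg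
        reach_bounds(1)[OF forc_rankings_permutes[OF rank[OF m_range]]])
  have "expect (A h) (\<lambda>y. win id - win (snd y)) \<le> expect (level_pmf L) (\<lambda>l. D l + Q)"
    unfolding expect_A
  proof (rule expect_mono[OF finite_level])
    fix l assume "l \<in> set_pmf (level_pmf L)"
    then have l: "l \<in> {1..L}" using set_level_pmf by blast
    have "win id - win \<pi> \<le> direct h l (reach \<pi>) + Q" if pi: "\<pi> \<in> set_pmf (choice h l)" for \<pi>
    proof (cases "l < m")
      case True
      \<comment> \<open>The bound holds for every ranking of level \<open>m\<close>, hence also
        after averaging over it.\<close>
      have "win id - win \<pi> - direct h l (reach \<pi>) \<le> Q"
        unfolding Q_def
      proof (rule expect_ge_const)
        show "finite (set_pmf (choice h m))" by (rule finite_choice[OF m_range])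
        fix \<sigma> assume "\<sigma> \<in> set_pmf (choice h m)"
        then show "win id - win \<pi> - direct h l (reach \<pi>) \<le> explore h (reach \<sigma>)"
          using win_gap_nonrobust[OF assms _ rank[OF l pi] rank[OF m_range, of \<sigma>]] True l by simp
      qed
      then show ?thesis by simp
    next
      case False
      then show ?thesis using win_gap_robust[OF assms _ rank[OF l pi]] l Q0 by simp
    qed
    then have "expect (choice h l) (\<lambda>\<pi>. win id - win \<pi>) \<le> expect (choice h l) (\<lambda>\<pi>. direct h l (reach \<pi>) + Q)"
      by (intro expect_mono finite_choice[OF l])
    also have "\<dots> = D l + Q" by (simp add: D_def expect_add[OF finite_choice[OF l]])
    finally show "expect (choice h l) (\<lambda>\<pi>. win id - win (snd (l, \<pi>))) \<le> D l + Q" by simp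
  qed
  also have "\<dots> = expect (level_pmf L) D + Q" by (simp add: expect_add[OF finite_level])
  also have "\<dots> \<le> expect (level_pmf L) D + pmf (level_pmf L) m * (2 ^ m * Q)"
  proof -
    have "1 = 1 / 2 ^ m * (2 ^ m :: real)" by simp
    also have "\<dots> \<le> pmf (level_pmf L) m * 2 ^ m"
      using level_prob_ge[OF m_range] by (intro mult_right_mono) (simp_all add: pmf_level_pmf)
    finally show ?thesis using mult_right_mono[OF _ Q0] by (fastforce simp: mult.assoc)
  qed
  also have "\<dots> = expect (level_pmf L) (\<lambda>l. D l + of_bool (l = m) * (2 ^ m * Q))"
    by (simp add: expect_add[OF finite_level] expect_of_bool_eq)
  also have "\<dots> = expect (A h) (\<lambda>y. direct h (fst y) (reach (snd y)) +
      of_bool (fst y = m) * (2 ^ m * explore h (reach (snd y))))"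
    unfolding expect_A
  proof (rule expect_cong)
    fix l assume "l \<in> set_pmf (level_pmf L)"
    then have l: "l \<in> {1..L}" using set_level_pmf by blast
    show "D l + of_bool (l = m) * (2 ^ m * Q) = expect (choice h l) (\<lambda>\<pi>. direct h (fst (l, \<pi>)) (reach (snd (l, \<pi>))) +
      of_bool (fst (l, \<pi>) = m) * (2 ^ m * explore h (reach (snd (l, \<pi>)))))"
      by (cases "l = m") (simp_all add: expect_add[OF finite_choice[OF l]] expect_add[OF finite_choice[OF m_range]] D_def Q_def)
  qed
  finally show ?thesis .
qed

text \<open>While the estimates are accurate, the loss minus the potential does not grow in
  expectation; otherwise a round adds at most 1, and this has probability at most
  \<open>1 / T\<close>. In fake rounds the loss stays and the potential does not drop.\<close>

lemma expected_total_loss: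
  "t \<le> T \<Longrightarrow> expect (rounds t) (\<lambda>h. real_rounds_sum (\<lambda>\<pi>. win id - win \<pi>) h - potential (platform_history h))
    \<le> real t / real T"
proof (induction t)
  case 0
  have "0 \<le> potential []"
    unfolding potential_def
    by (intro add_nonneg_nonneg mult_nonneg_nonneg pair_sum_nonneg sum_nonneg)
       (simp_all add: samples_nonneg low_def add_nonneg_nonneg)
  then show ?case by simp
next
  case (Suc t)
  define W where "W = (\<lambda>h. real_rounds_sum (\<lambda>\<pi>. win id - win \<pi>) h - potential (platform_history h))"
  have step: "expect (A (platform_history h)) (\<lambda>y. expect (response n \<mu> q (snd y) a)
       (\<lambda>c. W ((fst y, snd y, a \<noteq> Real_User, c) # h))) \<le> W h + of_bool (\<not> good m (platform_history h))"
    for h a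
  proof -
    let ?H = "platform_history h"
    have y: "fst y \<in> {1..L}" "snd y permutes {1..n}" if "y \<in> set_pmf (A ?H)" for y
      using that A_permutes[of "fst y" "snd y"] set_level_pmf by (auto simp: set_A)
    show ?thesis
    proof (cases "a = Real_User")
      case False
      have "expect (A ?H) (\<lambda>y. expect (response n \<mu> q (snd y) a)
         (\<lambda>c. W ((fst y, snd y, a \<noteq> Real_User, c) # h))) \<le> W h"
        using False potential_mono y
        by (intro expect_le_const A_finite finite_response) (auto simp: W_def)
      then show ?thesis by (smt (verit) of_bool_def)
    next
      case True
      define R where "R = (\<lambda>y. direct ?H (fst y) (reach (snd y)) +
        of_bool (fst y = m) * (2 ^ m * explore ?H (reach (snd y))))"
      have R0: "0 \<le> R y" if "y \<in> set_pmf (A ?H)" for y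
        unfolding R_def using reach_bounds[OF y(2)[OF that]]
        by (intro add_nonneg_nonneg mult_nonneg_nonneg direct_nonneg explore_nonneg) auto
      have "expect (A ?H) (\<lambda>y. expect (response n \<mu> q (snd y) a)
         (\<lambda>c. W ((fst y, snd y, a \<noteq> Real_User, c) # h))) \<le>
        expect (A ?H) (\<lambda>y. W h + ((win id - win (snd y)) - R y))"
      proof (rule expect_mono[OF A_finite])
        fix z assume z: "z \<in> set_pmf (A ?H)"
        have fin: "finite (set_pmf (real_customer n \<mu> q (snd z)))"
          using finite_response[of "snd z" Real_User] by simp
        have "expect (response n \<mu> q (snd z) a) (\<lambda>c. W ((fst z, snd z, a \<noteq> Real_User, c) # h)) =
          expect (real_customer n \<mu> q (snd z)) (\<lambda>c. (win id - win (snd z) + real_rounds_sum (\<lambda>\<pi>. win id - win \<pi>) h)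
             - potential ((fst z, snd z, c) # ?H))"
          using True by (simp add: W_def)
        also have "\<dots> = win id - win (snd z) + real_rounds_sum (\<lambda>\<pi>. win id - win \<pi>) h
          - expect (real_customer n \<mu> q (snd z)) (\<lambda>c. potential ((fst z, snd z, c) # ?H))"
          by (simp add: expect_diff[OF fin])
        also have "\<dots> \<le> W h + ((win id - win (snd z)) - R z)"
          using expect_potential_real[OF y(2)[OF z] y(1)[OF z], of ?H] by (simp add: W_def R_def)
        finally show "expect (response n \<mu> q (snd z) a) (\<lambda>c. W ((fst z, snd z, a \<noteq> Real_User, c) # h))
          \<le> W h + ((win id - win (snd z)) - R z)" .
      qed
      also have "\<dots> = W h + (expect (A ?H) (\<lambda>y. win id - win (snd y)) - expect (A ?H) R)"
        by (simp add: expect_add[OF A_finite] expect_diff[OF A_finite])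
      also have "\<dots> \<le> W h + of_bool (\<not> good m ?H)"
      proof (cases "good m ?H")
        case True
        then show ?thesis using expected_loss[OF True] by (simp add: R_def)
      next
        case False
        have "expect (A ?H) (\<lambda>y. win id - win (snd y)) \<le> 1"
          using win_bounds(1)[OF y(2)] win_bounds(2)[OF permutes_id]
          by (intro expect_le_const A_finite) fastforce
        moreover have "0 \<le> expect (A ?H) R" using R0 by (intro expect_ge_const A_finite)
        ultimately show ?thesis using False by simp
      qed
      finally show ?thesis .
    qed
  qed
  have "expect (rounds (Suc t)) W \<le> expect (rounds t) (\<lambda>h. W h + of_bool (\<not> good m (platform_history h)))"
    unfolding expect_run_Suc
    by (intro expect_mono finite_run expect_le_const finite_P step)
  also have "\<dots> = expect (rounds t) W + expect (rounds t) (\<lambda>h. of_bool (\<not> good m (platform_history h)))"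
    by (rule expect_add[OF finite_run])
  also have "\<dots> \<le> real t / real T + 1 / real T"
  proof (rule add_mono)
    show "expect (rounds t) W \<le> real t / real T"
      unfolding W_def by (rule Suc.IH) (use Suc.prems in simp)
    show "expect (rounds t) (\<lambda>h. of_bool (\<not> good m (platform_history h))) \<le> 1 / real T"
      using m_range F_le Suc.prems by (intro expect_not_good) auto
  qed
  also have "\<dots> = real (Suc t) / real T" by (simp add: add_divide_distrib)
  finally show ?case by (simp only: W_def)
qed

section \<open>Size of the potential and the total loss\<close>

definition inverse_gaps :: real where
  "inverse_gaps = (\<Sum>b=1..n. \<Sum>a=b+1..n. ln (real n * real T) / (\<mu> b - \<mu> a))"

lemma potential_le:
  "potential h \<le> 1602 * (real L + 2 ^ m + of_bool (1 < m) * (2 ^ m * real n)) * inverse_gaps"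
proof -
  define \<Lambda> where "\<Lambda> = ln (real n * real T)"
  define K where "K = real L + 2 ^ m + of_bool (1 < m) * (2 ^ m * real n)"
  have K0: "0 \<le> K" by (simp add: K_def)
  have "potential h \<le> pair_sum (\<lambda>b a. (\<Sum>l=m..L. samples b a + 1) + 2 ^ m * (samples b a + 1))
     + 2 ^ m * of_bool (1 < m) * pair_sum (\<lambda>b a. \<Sum>c=1..n. samples b a + 1)"
    unfolding potential_def
  proof (intro add_mono mult_left_mono pair_sum_mono sum_mono)
    fix b a
    have "min (low h a) (2 ^ m * samples b a + 1) \<le> 2 ^ m * samples b a + 1" by simp
    also have "\<dots> \<le> 2 ^ m * (samples b a + 1)" by (simp add: distrib_left)
    finally show "min (low h a) (2 ^ m * samples b a + 1) \<le> 2 ^ m * (samples b a + 1)" .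
  qed auto
  also have "\<dots> = pair_sum (\<lambda>b a. (\<Sum>l=m..L. samples b a + 1) + 2 ^ m * (samples b a + 1)
     + 2 ^ m * of_bool (1 < m) * (\<Sum>c=1..n. samples b a + 1))"
    by (simp only: pair_sum_add pair_sum_scale)
  also have "\<dots> \<le> pair_sum (\<lambda>b a. K * (samples b a + 1))"
  proof (rule pair_sum_mono)
    fix b a
    have "(\<Sum>l=m..L. samples b a + 1) \<le> real L * (samples b a + 1)"
      using m_range samples_nonneg[of b a] by (simp add: mult_right_mono)
    then show "(\<Sum>l=m..L. samples b a + 1) + 2 ^ m * (samples b a + 1)
      + 2 ^ m * of_bool (1 < m) * (\<Sum>c=1..n. samples b a + 1) \<le> K * (samples b a + 1)"
      by (simp add: K_def algebra_simps)
  qed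
  also have "\<dots> \<le> (\<Sum>b=1..n. \<Sum>a=b+1..n. 1602 * K * (\<Lambda> / (\<mu> b - \<mu> a)))"
    unfolding pair_sum_def
  proof (intro sum_mono)
    fix b a assume "b \<in> {1..n}" "a \<in> {b+1..n}"
    then have ba: "b \<in> {1..n}" "a \<in> {1..n}" "b < a" by auto
    define D where "D = \<mu> b - \<mu> a"
    have D: "0 < D" "D \<le> 1"
      using mu_decreasing[OF ba] mu_range[OF ba(1)] mu_range[OF ba(2)] by (auto simp: D_def)
    \<comment> \<open>The added 1 of the caps is absorbed by the logarithm: as
      \<open>D \<le> 1\<close> and \<open>\<Lambda>\<close> is at least 2/3, \<open>D\<close> is at
      most \<open>2 * (\<Lambda> / D)\<close>. This turns 1600 into 1602.\<close>
    have "2 / 3 \<le> \<Lambda>" using log_bounds(1) ln2_ge_two_thirds by (simp add: \<Lambda>_def)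
    then have "D \<le> 2 * \<Lambda>" using D by linarith
    also have "2 * \<Lambda> \<le> 2 * (\<Lambda> / D)"
      using D \<open>2 / 3 \<le> \<Lambda>\<close> by (simp add: le_divide_eq mult_left_le)
    finally have "D * (1600 * \<Lambda> / D\<^sup>2 + 1) \<le> 1602 * (\<Lambda> / D)"
      using D by (simp add: power2_eq_square distrib_left)
    then have "K * (D * (1600 * \<Lambda> / D\<^sup>2 + 1)) \<le> K * (1602 * (\<Lambda> / D))"
      using K0 by (rule mult_left_mono)
    then show "(\<mu> b - \<mu> a) * (K * (samples b a + 1)) \<le> 1602 * K * (\<Lambda> / (\<mu> b - \<mu> a))"
      by (simp add: samples_def D_def \<Lambda>_def mult_ac)
  qed
  also have "\<dots> = 1602 * K * inverse_gaps"
    by (simp add: inverse_gaps_def \<Lambda>_def sum_distrib_left)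
  finally show ?thesis by (simp add: K_def)
qed

lemma real_rounds_sum_win:
  "real_rounds_sum win h + real_rounds_sum (\<lambda>\<pi>. win id - win \<pi>) h =
    (real (length h) - real (num_fakes (map snd h))) * win id"
proof (induction h)
  case (Cons e h)
  then show ?case by (cases e) (auto simp: algebra_simps)
qed simp

text \<open>Compared with \<open>T\<close> real rounds of the optimal ranking, fake users cost at
  most \<open>F\<close> and inaccurate estimates at most 1; the rest is paid by the
  potential.\<close>

lemma expected_clicks_ge:
  "real T * win id - (real F + 1 +
     1602 * (real L + 2 ^ m + of_bool (1 < m) * (2 ^ m * real n)) * inverse_gaps)
    \<le> expected_real_clicks n \<mu> q P A T"
proof -
  let ?M = "1602 * (real L + 2 ^ m + of_bool (1 < m) * (2 ^ m * real n)) * inverse_gaps"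
  let ?loss = "\<lambda>h. real_rounds_sum (\<lambda>\<pi>. win id - win \<pi>) h"
  have "expect (rounds T) (\<lambda>h. ?loss h - ?M) \<le> expect (rounds T) (\<lambda>h. ?loss h - potential (platform_history h))"
    using potential_le by (intro expect_mono finite_run) simp
  also have "\<dots> \<le> 1" using expected_total_loss[of T] T_ge by simp
  finally have loss: "expect (rounds T) ?loss \<le> 1 + ?M" by (simp add: expect_diff[OF finite_run])
  have "real T * win id - real F \<le> expect (rounds T) (\<lambda>h. real_rounds_sum win h + ?loss h)"
  proof (rule expect_ge_const[OF finite_run])
    fix h assume h: "h \<in> set_pmf (rounds T)"
    have "real (num_fakes (map snd h)) * win id \<le> real F * 1"
      using num_fakes_run[OF h] win_bounds[OF permutes_id] by (intro mult_mono) auto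
    then show "real T * win id - real F \<le> real_rounds_sum win h + ?loss h"
      unfolding real_rounds_sum_win length_run[OF h] by (simp add: left_diff_distrib)
  qed
  then have "real T * win id - real F \<le> expect (rounds T) (real_rounds_sum win) + expect (rounds T) ?loss"
    by (simp add: expect_add[OF finite_run])
  then show ?thesis using loss unfolding expected_real_clicks_eq by linarith
qed

end

section \<open>The regret bound\<close>

lemma num_levels:
  assumes "2 \<le> T" "int L \<in> {\<lfloor>log 2 (real T)\<rfloor>, \<lceil>log 2 (real T)\<rceil>}"
  shows "1 \<le> L" "L \<le> T" "real T < 2 * 2 ^ L" "real L \<le> 3 * ln (real T)"
proof -
  have T: "0 < real T" "2 \<le> real T" using assms(1) by auto
  have lg1: "1 \<le> log 2 (real T)" using T by (simp add: le_log_iff)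
  have L: "log 2 (real T) - 1 < real L" "real L < log 2 (real T) + 1"
  proof -
    have "real_of_int (int L) \<in> {real_of_int \<lfloor>log 2 (real T)\<rfloor>, real_of_int \<lceil>log 2 (real T)\<rceil>}"
      using assms(2) by (simp only: insert_iff empty_iff of_int_eq_iff)
    then consider "real L = real_of_int \<lfloor>log 2 (real T)\<rfloor>" | "real L = real_of_int \<lceil>log 2 (real T)\<rceil>"
      by auto
    then have "log 2 (real T) - 1 < real L \<and> real L < log 2 (real T) + 1"
      by cases linarith+
    then show "log 2 (real T) - 1 < real L" "real L < log 2 (real T) + 1" by auto
  qed
  have "0 < real L" using lg1 L(1) by linarith
  then show "1 \<le> L" by simp
  have "real T < 2 ^ T" using of_nat_less_two_power[of T] by simp
  then have "real T \<le> 2 powr real T" by (simp add: powr_realpow)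
  then have "log 2 (real T) \<le> real T" using T by (simp add: log_le_iff)
  then have "real L < real (Suc T)" using L by simp
  then show "L \<le> T" by linarith
  have "real T = 2 powr log 2 (real T)" using T by simp
  also have "\<dots> < 2 powr (real L + 1)" using L by (intro powr_less_mono) auto
  also have "\<dots> = 2 * 2 ^ L" by (simp add: powr_add powr_realpow)
  finally show "real T < 2 * 2 ^ L" .
  have ln2: "2 / 3 \<le> ln (2 :: real)" by (rule ln2_ge_two_thirds)
  have "real L \<le> 2 * log 2 (real T)" using L lg1 by linarith
  also have "\<dots> \<le> 3 * ln (real T)"
  proof -
    have "2 / 3 * log 2 (real T) \<le> ln 2 * log 2 (real T)" using ln2 lg1 by (intro mult_right_mono) auto
    also have "\<dots> = ln (real T)" by (simp add: log_def)
    finally show ?thesis by simp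
  qed
  finally show "real L \<le> 3 * ln (real T)" .
qed

text \<open>The same policy may use different numbers of fake users against the two platforms, so
  they are not compared round by round; the optimal one is given credit for all \<open>t\<close>
  rounds.\<close>

lemma (in cascade) expected_optimal_clicks_le:
  assumes "P \<in> policies n T F"
  shows "expected_real_clicks n \<mu> q P optimal_platform t \<le> real t * win id"
proof -
  interpret opt: play n \<mu> q T F P optimal_platform
    by unfold_locales (auto simp: assms optimal_platform_def permutes_id)
  have "opt.real_rounds_sum win h \<le> real t * win id" if "h \<in> set_pmf (opt.rounds t)" for h
    using that
  proof (induction t arbitrary: h)
    case (Suc t)
    then obtain h' a c where h: "h' \<in> set_pmf (opt.rounds t)" "h = ((), id, a \<noteq> Real_User, c) # h'"
      unfolding opt.set_run_Suc by (auto simp: optimal_platform_def)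
    show ?case using Suc.IH[OF h(1)] win_bounds(1)[OF permutes_id] by (auto simp: h(2) algebra_simps id_def)
  qed simp
  then show ?thesis
    unfolding opt.expected_real_clicks_eq by (intro expect_le_const opt.finite_run)
qed

text \<open>Private values do not reach the policy, so after projection to the events only the
  rankings matter. This serves the case \<open>n = 1\<close>, where the cost \<open>F\<close> of the
  general estimate would be too much.\<close>

lemma expected_real_clicks_identity_platform:
  assumes "\<And>h y. y \<in> set_pmf (A h) \<Longrightarrow> snd y = id"
  shows "expected_real_clicks n \<mu> q P A t = expected_real_clicks n \<mu> q P optimal_platform t"
proof -
  define step where "step = (\<lambda>g. P g \<bind> (\<lambda>a. response n \<mu> q id a \<bind>
    (\<lambda>c. return_pmf ((id, a \<noteq> Real_User, c) # g))))"
  have run_step: "map_pmf (map snd) (run n \<mu> q P B (Suc t)) = map_pmf (map snd) (run n \<mu> q P B t) \<bind> step"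
    if "\<And>h y. y \<in> set_pmf (B h) \<Longrightarrow> snd y = id" for B :: "'x platform" and t
  proof -
    have "map_pmf (map snd) (run n \<mu> q P B (Suc t)) = run n \<mu> q P B t \<bind> (\<lambda>h. P (map snd h) \<bind> (\<lambda>a.
       B (map (\<lambda>(x, \<pi>, f, c). (x, \<pi>, c)) h) \<bind> (\<lambda>y. response n \<mu> q (snd y) a \<bind>
         (\<lambda>c. return_pmf ((snd y, a \<noteq> Real_User, c) # map snd h)))))"
      by (simp add: map_bind_pmf case_prod_beta')
    also have "\<dots> = run n \<mu> q P B t \<bind> (\<lambda>h. P (map snd h) \<bind> (\<lambda>a.
       B (map (\<lambda>(x, \<pi>, f, c). (x, \<pi>, c)) h) \<bind> (\<lambda>y. response n \<mu> q id a \<bind>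
         (\<lambda>c. return_pmf ((id, a \<noteq> Real_User, c) # map snd h)))))"
      using that by (intro bind_pmf_cong refl) simp_all
    also have "\<dots> = map_pmf (map snd) (run n \<mu> q P B t) \<bind> step"
      by (simp add: bind_map_pmf step_def)
    finally show ?thesis .
  qed
  have same: "map_pmf (map snd) (run n \<mu> q P A t) = map_pmf (map snd) (run n \<mu> q P optimal_platform t)"
  proof (induction t)
    case (Suc t)
    have opt: "snd y = id" if "y \<in> set_pmf (optimal_platform h)" for h y
      using that by (simp add: optimal_platform_def)
    show ?case
      using run_step[of A t, OF assms] run_step[of optimal_platform t, OF opt] Suc
      by (simp del: run.simps)
  qed simp
  have clicks: "expected_real_clicks n \<mu> q P B t = expect (map_pmf (map snd) (run n \<mu> q P B t))
      (\<lambda>g. real (length (filter (\<lambda>(\<pi>, f, c). \<not> f \<and> fst c \<noteq> None) g)))" for B :: "'x platform"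
  proof -
    have "real_clicks h = length (filter (\<lambda>(\<pi>, f, c). \<not> f \<and> fst c \<noteq> None) (map snd h))"
      for h :: "('x \<times> event) list"
      by (simp add: real_clicks_def filter_map comp_def case_prod_beta')
    then show ?thesis by (simp add: expected_real_clicks_def)
  qed
  show ?thesis unfolding clicks same ..
qed

lemma policies_nonempty: "policies n T F \<noteq> {}"
proof -
  let ?P = "\<lambda>_. return_pmf Real_User"
  have "num_fakes h = 0" if "possible_history n ?P h" for h
    using that by (induction h) auto
  then have "?P \<in> policies n T F" by (auto simp: policies_def actions_def)
  then show ?thesis by blast
qed

section \<open>Collecting the constants\<close>

context forc_play
begin

definition loss_bound :: real where
  "loss_bound = (real n ^ 2 * real F + ln (real T)) *
     (\<Sum>b=1..n. \<Sum>a=b+1..n. ln (real n * real T) / (\<mu> b - \<mu> a))"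

lemma ln_T_pos: "2 / 3 \<le> ln (real T)"
proof -
  have "ln 2 \<le> ln (real T)" using T_ge by simp
  then show ?thesis using ln2_ge_two_thirds by linarith
qed

text \<open>Products 1 and 2 alone contribute this much, which allows additive terms to be absorbed
  into the product in the bound.\<close>

lemma inverse_gaps_ge:
  assumes "2 \<le> n"
  shows "2 / 3 \<le> (\<Sum>b=1..n. \<Sum>a=b+1..n. ln (real n * real T) / (\<mu> b - \<mu> a))"
proof -
  define \<Lambda> where "\<Lambda> = ln (real n * real T)"
  have Lam: "2 / 3 \<le> \<Lambda>" using log_bounds(1) ln2_ge_two_thirds by (simp add: \<Lambda>_def)
  have nonneg: "0 \<le> \<Lambda> / (\<mu> b - \<mu> a)" if "b \<in> {1..n}" "a \<in> {b+1..n}" for b a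
    using mu_decreasing[of b a] that Lam by (intro divide_nonneg_nonneg) auto
  have D: "0 < \<mu> 1 - \<mu> 2" "\<mu> 1 - \<mu> 2 \<le> 1"
    using mu_decreasing[of 1 2] mu_range[of 1] mu_range[of 2] assms by auto
  have "\<Lambda> \<le> \<Lambda> / (\<mu> 1 - \<mu> 2)" using D Lam by (simp add: le_divide_eq mult_left_le)
  also have "\<dots> \<le> (\<Sum>a=1+1..n. \<Lambda> / (\<mu> 1 - \<mu> a))"
    using assms nonneg[of 1] by (intro member_le_sum[of 2 _ "\<lambda>a. \<Lambda> / (\<mu> 1 - \<mu> a)"]) (auto simp: numeral_2_eq_2)
  also have "\<dots> \<le> (\<Sum>b=1..n. \<Sum>a=b+1..n. \<Lambda> / (\<mu> b - \<mu> a))"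
    using assms nonneg
    by (intro member_le_sum[of 1 _ "\<lambda>b. \<Sum>a=b+1..n. \<Lambda> / (\<mu> b - \<mu> a)"]) (auto intro!: sum_nonneg)
  finally show ?thesis using Lam by (simp add: \<Lambda>_def)
qed

lemma regret_against_policy:
  assumes "real T < 2 * 2 ^ L" "real L \<le> 3 * ln (real T)"
  shows "expected_real_clicks n \<mu> q P optimal_platform T - expected_real_clicks n \<mu> q P A T
    \<le> 10000 * loss_bound"
proof (cases "n = 1")
  case True
  have "snd y = id" if "y \<in> set_pmf (A h)" for h y
    using A_permutes[of "fst y" "snd y" h] that True by simp
  then have "expected_real_clicks n \<mu> q P A T = expected_real_clicks n \<mu> q P optimal_platform T"
    by (rule expected_real_clicks_identity_platform)
  moreover have "loss_bound = 0" unfolding loss_bound_def using True by simp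
  ultimately show ?thesis by simp
next
  case False
  then have n2: "2 \<le> n" using n_pos by simp
  define S where "S = (\<Sum>b=1..n. \<Sum>a=b+1..n. ln (real n * real T) / (\<mu> b - \<mu> a))"
  have S: "2 / 3 \<le> S" using inverse_gaps_ge[OF n2] by (simp add: S_def)
  have nF: "real F \<le> real n ^ 2 * real F"
    using n_pos mult_right_mono[of 1 "real n ^ 2" "real F"] by simp
  define E where "E = real n ^ 2 * real F + ln (real T)"
  have E: "real F \<le> E" "2 / 3 \<le> E" "ln (real T) \<le> E" "loss_bound = E * S"
    using nF ln_T_pos by (auto simp: E_def loss_bound_def S_def)
  have opt: "expected_real_clicks n \<mu> q P optimal_platform T \<le> real T * win id"
    by (rule expected_optimal_clicks_le[OF F_policy])
  show ?thesis
  proof (cases "real F \<le> 2 ^ L")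
    \<comment> \<open>No level copes with such a budget, but then the horizon is below
      \<open>2 * F\<close> and the trivial bound by \<open>T\<close> suffices.\<close>
    case False
    have "0 \<le> expected_real_clicks n \<mu> q P A T"
      unfolding expected_real_clicks_def by (intro expect_ge_const finite_run) simp
    moreover have "real T * win id \<le> real T * 1"
      using win_bounds(2)[OF permutes_id] by (intro mult_left_mono) auto
    ultimately have "expected_real_clicks n \<mu> q P optimal_platform T - expected_real_clicks n \<mu> q P A T \<le> 2 * E"
      using opt assms(1) False E(1) by linarith
    also have "\<dots> \<le> 10000 * (E * (2 / 3))" using E by linarith
    also have "\<dots> \<le> 10000 * (E * S)" using S E by (intro mult_left_mono) auto
    finally show ?thesis by (simp add: E(4))
  next
    case True
    define m where "m = (LEAST m. 1 \<le> m \<and> real F \<le> 2 ^ m)"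
    have mL: "1 \<le> L \<and> real F \<le> 2 ^ L" using L_pos True by simp
    have m: "1 \<le> m \<and> real F \<le> 2 ^ m" unfolding m_def using mL by (rule LeastI)
    have "m \<le> L" unfolding m_def using mL by (rule Least_le)
    then interpret forc_robust n \<mu> q T L F P choice m
      by unfold_locales (use m in auto)
    have K: "real L + 2 ^ m + of_bool (1 < m) * (2 ^ m * real n) \<le> 6 * E"
    proof (cases "m = 1")
      case True
      \<comment> \<open>There are no lower levels, and the remaining \<open>2 ^ m = 2\<close> is at
        most \<open>3 * ln T\<close>.\<close>
      then show ?thesis using assms(2) ln_T_pos E(3) by simp
    next
      case False
      then have m2: "1 < m" using m by simp
      \<comment> \<open>By minimality the previous level is too low for \<open>F\<close>, which
        gives \<open>2 ^ m \<le> 2 * F\<close>. For \<open>n \<ge> 2\<close> the factor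
        \<open>1 + n\<close> is at most \<open>n ^ 2\<close>.\<close>
      have "\<not> (1 \<le> m - 1 \<and> real F \<le> 2 ^ (m - 1))"
        unfolding m_def by (rule not_less_Least) (use m2 m_def in simp)
      then have "2 ^ (m - 1) < real F" using m2 by auto
      moreover have "(2::real) ^ m = 2 * 2 ^ (m - 1)" using m2 by (simp add: power_eq_if)
      ultimately have m_le: "2 ^ m \<le> 2 * real F" by simp
      have "2 ^ m * (1 + real n) \<le> 2 * real F * real n ^ 2"
      proof (rule mult_mono[OF m_le])
        have "1 + real n \<le> 2 * real n" using n2 by simp
        also have "\<dots> \<le> real n * real n" using n2 by (intro mult_right_mono) auto
        finally show "1 + real n \<le> real n ^ 2" by (simp add: power2_eq_square)
      qed auto
      then have "2 ^ m + of_bool (1 < m) * (2 ^ m * real n) \<le> 2 * (real n ^ 2 * real F)"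
        using m2 by (simp add: algebra_simps)
      then have "real L + (2 ^ m + of_bool (1 < m) * (2 ^ m * real n)) \<le>
        3 * ln (real T) + 2 * (real n ^ 2 * real F)"
        using assms(2) by (rule add_mono[rotated])
      also have "\<dots> \<le> 6 * ln (real T) + 6 * (real n ^ 2 * real F)"
        using ln_T_pos by (intro add_mono mult_right_mono) auto
      also have "\<dots> = 6 * E" by (simp add: E_def)
      finally show ?thesis by (simp only: add.assoc)
    qed
    have "expected_real_clicks n \<mu> q P optimal_platform T - expected_real_clicks n \<mu> q P A T \<le>
      real F + 1 + 1602 * (real L + 2 ^ m + of_bool (1 < m) * (2 ^ m * real n)) * S"
      using expected_clicks_ge opt by (simp add: inverse_gaps_def S_def)
    \<comment> \<open>The constant 9612 is \<open>1602 * 6\<close>; since \<open>S\<close> is at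
      least 2/3, the additive terms amount to at most \<open>15 / 4 * (E * S)\<close>, and 10000
      covers both.\<close>
    also have "\<dots> \<le> E + 3 / 2 * E + 1602 * (6 * E) * S"
      using K S E by (intro add_mono mult_right_mono mult_left_mono) auto
    also have "\<dots> = 5 / 2 * E * 1 + 9612 * (E * S)" by simp
    also have "5 / 2 * E * 1 \<le> 5 / 2 * E * (3 / 2 * S)" using S E by (intro mult_left_mono) auto
    also have "5 / 2 * E * (3 / 2 * S) + 9612 * (E * S) \<le> 10000 * (E * S)"
    proof -
      have "0 \<le> E * S" using S E by simp
      then show ?thesis by simp
    qed
    finally show ?thesis by (simp add: E(4))
  qed
qed

end

theorem theorem3:
  shows "\<exists>C::real. C > 0 \<and>
    (\<forall>(n::nat) (T::nat) (L::nat) (F::nat) (\<mu>::nat \<Rightarrow> real) (q::nat \<Rightarrow> real) (A::nat platform).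
       n \<ge> 1 \<longrightarrow> T \<ge> 2 \<longrightarrow>
       (\<forall>i\<in>{1..n}. \<mu> i \<in> {0..1}) \<longrightarrow>
       (\<forall>i\<in>{1..n}. \<forall>j\<in>{1..n}. i < j \<longrightarrow> \<mu> i > \<mu> j) \<longrightarrow>
       (\<forall>j\<in>{1..n - 1}. q j \<in> {0..1}) \<longrightarrow>
       int L \<in> {\<lfloor>log 2 (real T)\<rfloor>, \<lceil>log 2 (real T)\<rceil>} \<longrightarrow>
       A \<in> forc n T L \<longrightarrow>
       regret n \<mu> q T F A
         \<le> C * ((real n ^ 2 * real F + ln (real T))
                * (\<Sum>j=1..n. \<Sum>i=j+1..n. ln (real n * real T) / (\<mu> j - \<mu> i))))"
proof (intro exI[of _ 10000] conjI allI impI)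
  fix n T L F :: nat and \<mu> q :: "nat \<Rightarrow> real" and A :: "nat platform"
  assume n: "n \<ge> 1" and T: "T \<ge> 2"
    and mu: "\<forall>i\<in>{1..n}. \<mu> i \<in> {0..1}" "\<forall>i\<in>{1..n}. \<forall>j\<in>{1..n}. i < j \<longrightarrow> \<mu> i > \<mu> j"
    and q: "\<forall>j\<in>{1..n - 1}. q j \<in> {0..1}"
    and L: "int L \<in> {\<lfloor>log 2 (real T)\<rfloor>, \<lceil>log 2 (real T)\<rceil>}" and A: "A \<in> forc n T L"
  note levels = num_levels[OF T L]
  obtain choice where choice:
    "\<forall>h. \<forall>l\<in>{1..L}. set_pmf (choice h l) \<subseteq> forc_rankings n L (forc_state_after n T L h) l"
    "A = (\<lambda>h. do { l \<leftarrow> level_pmf L; \<pi> \<leftarrow> choice h l; return_pmf (l, \<pi>) })"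
    using A unfolding forc_def by blast
  interpret forc_setting n \<mu> q T L
    by unfold_locales (use n T mu q levels in auto)
  show "regret n \<mu> q T F A
    \<le> 10000 * ((real n ^ 2 * real F + ln (real T))
                * (\<Sum>j=1..n. \<Sum>i=j+1..n. ln (real n * real T) / (\<mu> j - \<mu> i)))"
    unfolding regret_def
  proof (rule cSUP_least[OF policies_nonempty])
    fix P assume P: "P \<in> policies n T F"
    interpret play: forc_play n \<mu> q T L F P choice
      by unfold_locales (use P choice(1) in auto)
    have "A = play.A" by (simp only: play.A_def choice(2))
    then show "expected_real_clicks n \<mu> q P optimal_platform T - expected_real_clicks n \<mu> q P A T
      \<le> 10000 * ((real n ^ 2 * real F + ln (real T))
                * (\<Sum>j=1..n. \<Sum>i=j+1..n. ln (real n * real T) / (\<mu> j - \<mu> i)))"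
      using play.regret_against_policy[OF levels(3,4)] by (simp only: play.loss_bound_def)
  qed
qed simp

end
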